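(* Let $\lambda'\in X_+$, $p\ge0$, and let $\lambda=\lambda'-2p\varpi_1\in X_+$. Let $m\ge0$, $t=t_{m+1}$, and let $\mu\in X$ with $\mu<t\mu\le\lambda$. Let $T$ be an element of the atom $\mathcal{A}(\lambda-a\varpi_2)\subset\mathcal{P}(\lambda)\subset\mathcal{B}(\lambda')$ with $\mathrm{wt}(T)=t\mu$, and suppose that $e=(\mu\to t\mu)$ is an edge of $\Gamma_{\lambda-a\varpi_2}$. Let $\psi_{t\mu}(T)$ be the only element of weight $\mu$ in the atom $\mathcal{A}(\lambda-(a+\Omega(e))\varpi_2)\subset\mathcal{P}(\lambda)$, where $\Omega(e)$ is the elevation of $e$ as an edge of $\Gamma_{\lambda-a\varpi_2}$. Then $$\sigma_{m+1}(T)=\sigma_{m+1}(\psi_{t\mu}(T))-1 .$$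
   Context: **Root data (type $C_2$).** $X=\mathbb{Z}\varpi_1\oplus\mathbb{Z}\varpi_2$ is the weight lattice of $Sp_4(\mathbb{C})$, $\mu=(\mu_1,\mu_2)=\mu_1\varpi_1+\mu_2\varpi_2$, $X_+=\{\mu:\mu_1,\mu_2\ge 0\}$. Positive roots (the set $\Phi_+$ of the root system $\Phi$): $\alpha_1=2\varpi_1-\varpi_2$, $\alpha_2=-2\varpi_1+2\varpi_2$, $\alpha_{12}=2\alpha_1+\alpha_2=2\varpi_1$, $\alpha_{21}=\alpha_1+\alpha_2=\varpi_2$; $\langle\mu,\alpha_1^\vee\rangle=\mu_1$, $\langle\mu,\alpha_2^\vee\rangle=\mu_2$, $\langle\mu,\alpha_{12}^\vee\rangle=\mu_1+\mu_2$, $\langle\mu,\alpha_{21}^\vee\rangle=\mu_1+2\mu_2$. $W$ is generated by $s_1(\mu)=(-\mu_1,\mu_1+\mu_2)$ and $s_2(\mu)=(\mu_1+2\mu_2,-\mu_2)$. For $\lambda\in X_+$, $\mu\le\lambda$ means $\mu\in\mathrm{Conv}(W\lambda)\cap(\lambda+\mathbb{Z}\Phi)$. **Crystals.** $\mathcal{B}(\lambda)$ is the (normal) crystal of the irreducible $\mathfrak{sp}_4$-module of highest weight $\lambda$, with operators $e_i,f_i$ and $\varepsilon_i(T)=\max\{k:e_i^kT\neq0\}$ ($i=1,2$); $s_1$ acts on it by reversing each $f_1$-string. For $T\in\mathcal{B}(\lambda)$, $\mathrm{str}_2(T)=(a,b,c,d)$ is the adapted string for $s_2s_1s_2s_1$: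 $a=\varepsilon_2(T)$, $b=\varepsilon_1(e_2^aT)$, $c=\varepsilon_2(e_1^be_2^aT)$, $d=\varepsilon_1(e_2^ce_1^be_2^aT)$; it determines $T$. There is an injective weight-preserving map $\Phi:\mathcal{B}(\lambda)\to\mathcal{B}(\lambda+2\varpi_1)$ with $\mathrm{str}_2(\Phi(T))=\mathrm{str}_2(T)+(0,1,1,1)$. Principal preatom: $\mathcal{P}(\kappa)=\mathcal{B}(\kappa)\setminus\Phi(\mathcal{B}(\kappa-2\varpi_1))$ if $\kappa_1\ge2$, and $\mathcal{P}(\kappa)=\mathcal{B}(\kappa)$ if $\kappa_1\le 1$. For $T\in\mathcal{B}(\lambda')$, $\mathrm{pat}(T)$ is the maximal $p\ge0$ with $T\in\Phi^p(\mathcal{B}(\lambda'-2p\varpi_1))$; then $T=\Phi^p(T')$ with $T'\in\mathcal{P}(\lambda'-2p\varpi_1)$. The image of $\mathcal{P}(\lambda'-2p\varpi_1)$ under $\Phi^p$ is called the preatom $\mathcal{P}(\lambda'-2p\varpi_1)\subset\mathcal{B}(\lambda')$. **Atoms.** For $T\in\mathcal{P}(\kappa)$ with $\mathrm{str}_2(T)=(a,b,c,d)$, $\Psi(T)\in\mathcal{P}(\kappa+\varpi_2)$ is the element with $\mathrm{str}_2=(a,b+1,c+1,d)$ if $d\in\{0,\kappa_1\}$ and $(a,b,c+1,d+1)$ otherwise. $\overline\Psi(T)=\Psi(T)$ if $\mathrm{wt}(T)_1\le0$ and $\overline\Psi(T)=s_1\Psi(s_1T)$ if $\mathrm{wt}(T)_1\ge0$;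 $\overline\Psi:\mathcal{P}(\kappa)\to\mathcal{P}(\kappa+\varpi_2)$ is injective and weight preserving. With $\mathcal{P}(\nu)=\emptyset$ for $\nu$ not dominant, put $\mathcal{A}(\kappa)=\mathcal{P}(\kappa)\setminus\overline\Psi(\mathcal{P}(\kappa-\varpi_2))$ if $\kappa_1>0$ and $\mathcal{A}(\kappa)=\mathcal{P}(\kappa)\setminus\overline\Psi^2(\mathcal{P}(\kappa-2\varpi_2))$ if $\kappa_1=0$. Every weight $\mu\le\kappa$ occurs exactly once as the weight of an element of $\mathcal{A}(\kappa)$. $\mathcal{P}(\kappa)$ is the disjoint union of the sets $\overline\Psi^a(\mathcal{A}(\kappa-a\varpi_2))$, $0\le a\le\kappa_2$ (only $a$ even if $\kappa_1=0$); the image of $\mathcal{A}(\kappa-a\varpi_2)$ under $\Phi^p\overline\Psi^a$ is called the atom $\mathcal{A}(\kappa-a\varpi_2)\subset\mathcal{P}(\kappa)\subset\mathcal{B}(\kappa+2p\varpi_1)$. The atomic number: for $T'\in\mathcal{P}(\kappa)$, $\mathrm{at}(T')$ is the maximal integer $a\ge0$ such that $T'$ is in the image of $\overline\Psi^a:\mathcal{P}(\kappa-a\varpi_2)\to\mathcal{P}(\kappa)$; for $T=\Phi^p(T')\in\mathcal{B}(\lambda')$ with $p=\mathrm{pat}(T)$ and $T'\in\mathcal{P}(\lambda'-2p\varpi_1)$, $\mathrm{at}(T)=\mathrm{at}(T')$. **Bruhat graphs.** For $\lambda\in X_+$, $\Gamma_\lambda$ is the directed labelled graph with vertices $\{\mu\le\lambda\}$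 and one edge between $\mu$ and $\mu-k\beta$ for each $\beta\in\Phi_+$, $k\ge1$ with both $\le\lambda$: with $j=\langle\mu,\beta^\vee\rangle-k$, if $j<0$ it is $\mu\to\mu-k\beta$ with label $|j|\delta-\beta^\vee$; if $j\ge0$ it is $\mu-k\beta\to\mu$ with label $\beta^\vee+j\delta$. Put $\gamma_{4M-3}=(2M-1)\delta-\alpha_{21}^\vee$, $\gamma_{4M-2}=M\delta-\alpha_{12}^\vee$, $\gamma_{4M-1}=2M\delta-\alpha_{21}^\vee$, $\gamma_{4M}=M\delta-\alpha_2^\vee$ ($M\ge1$); $t_m$ is the reflection of $\gamma_m$, where the reflection of $M\delta-\beta^\vee$ is $\mu\mapsto\mu-(\langle\mu,\beta^\vee\rangle+M)\beta$; $\mu<t_m\mu$ means $\langle\mu,\beta^\vee\rangle+M>0$ for $\gamma_m=M\delta-\beta^\vee$. $\Gamma^m_\lambda$ is obtained from $\Gamma_\lambda$ by reversing all edges with label in $\{\gamma_1,\dots,\gamma_m\}$, and $\ell_m(\mu,\lambda)$ is the number of edges of $\Gamma_\lambda^m$ pointing to $\mu$. An edge $\mu\to t_{m+1}\mu$ of $\Gamma_\lambda$ (label $\gamma_{m+1}$) is *swappable* if $\ell_m(\mu,\lambda)=\ell_m(t_{m+1}\mu,\lambda)-1$, otherwise *non-swappable*; $E^S(\lambda)$, $E^N(\lambda)$ are the sets of swappable, resp. non-swappable, edges of $\Gamma_\lambda$. $\mathcal{N}_m(\mu,\lambda)$ is the number of non-swappable edges of $\Gamma_\lambda$ starting at $\mu$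 with label in $\{\gamma_1,\dots,\gamma_m\}$. An *NS-staircase over $(\mu,\lambda)$* of length $a$ is a sequence $e_i=(\mu\to\mu-(n+i)\alpha)\in E^N(\lambda+i\varpi_2)$, $1\le i\le a$, with a fixed root $\alpha$ and a fixed integer $n\ge0$, such that $n=0$ or $(\mu\to\mu-n\alpha)\in E^S(\lambda)$. $\widehat{\mathcal{D}}_m(\mu,\lambda)$ is the maximal length (0 if none) of an NS-staircase over $(\mu,\lambda)$ all of whose edges $e_i$ have label in $\{\gamma_1,\dots,\gamma_m\}$; $\mathcal{D}_m(\mu,\kappa,a)=\min(a,\widehat{\mathcal{D}}_m(\mu,\kappa-a\varpi_2))$. **Elevation.** For an edge $e=(\mu\to\mu-k\alpha)$ of $\Gamma_\nu$, the elevation $\Omega(e)$ is the minimum integer $j\ge0$ such that $(\mu\to\mu-(k-j)\alpha)\in E^S(\nu-j\varpi_2)$ (it is taken as part of the definition that such a $j$ exists). **$\sigma_m$.** For $T\in\mathcal{B}(\lambda')$ with $\mu=\mathrm{wt}(T)$, $p=\mathrm{pat}(T)$, $a=\mathrm{at}(T)$, $\lambda=\lambda'-2p\varpi_1$: $\sigma_m(T)=\ell_m(\mu,\lambda-a\varpi_2)-\mathcal{N}_m(\mu,\lambda-a\varpi_2)+\mathcal{D}_m(\mu,\lambda,a)+a+2p$.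
   Formalization: For κ_1=0 the atomic number is the maximum over even a only, as in the atomic decomposition; with all a the claim fails (λ=2ϖ_2, μ=0, tμ=−ϖ_2). Existence of the elevation Ω(e) is an explicit hypothesis, since some edges have none. *)

theory Defs
  imports "HOL-Analysis.Analysis"
begin

section \<open>Root data of type $C_2$\<close>

text \<open>The weight $\mu_1\varpi_1+\mu_2\varpi_2$ is the pair $(\mu_1,\mu_2)$; a pair $(c_1,c_2)$ in
  the coroot lattice stands for $c_1\alpha_1^\vee+c_2\alpha_2^\vee$.\<close>

type_synonym weight = "int \<times> int"
type_synonym coweight = "int \<times> int"

definition zscale :: "int \<Rightarrow> weight \<Rightarrow> weight"  (infixr "*\<^sub>Z" 75) where
  "k *\<^sub>Z \<mu> = (k * fst \<mu>, k * snd \<mu>)"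

abbreviation varpi1 :: weight where "varpi1 \<equiv> (1, 0)"
abbreviation varpi2 :: weight where "varpi2 \<equiv> (0, 1)"

definition dominant :: "weight \<Rightarrow> bool" where
  "dominant lam \<longleftrightarrow> 0 \<le> fst lam \<and> 0 \<le> snd lam"

datatype posroot = A1 | A2 | A12 | A21

fun pos_root :: "posroot \<Rightarrow> weight" where
  "pos_root A1 = (2, -1)"
| "pos_root A2 = (-2, 2)"
| "pos_root A12 = (2, 0)"
| "pos_root A21 = (0, 1)"

fun coroot :: "posroot \<Rightarrow> coweight" where
  "coroot A1 = (1, 0)"
| "coroot A2 = (0, 1)"
| "coroot A12 = (1, 1)"
| "coroot A21 = (1, 2)"

definition pairing :: "weight \<Rightarrow> coweight \<Rightarrow> int" where
  "pairing \<mu> h = fst \<mu> * fst h + snd \<mu> * snd h"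

fun refl1 :: "weight \<Rightarrow> weight" where
  "refl1 (x, y) = (- x, x + y)"

fun refl2 :: "weight \<Rightarrow> weight" where
  "refl2 (x, y) = (x + 2 * y, - y)"

inductive_set weyl_orbit :: "weight \<Rightarrow> weight set" for lam :: weight where
  "lam \<in> weyl_orbit lam"
| "\<mu> \<in> weyl_orbit lam \<Longrightarrow> refl1 \<mu> \<in> weyl_orbit lam"
| "\<mu> \<in> weyl_orbit lam \<Longrightarrow> refl2 \<mu> \<in> weyl_orbit lam"

definition root_lattice :: "weight set" where
  "root_lattice = {i *\<^sub>Z pos_root A1 + j *\<^sub>Z pos_root A2 | i j. True}"

fun to_plane :: "weight \<Rightarrow> real \<times> real" where
  "to_plane (x, y) = (real_of_int x, real_of_int y)"

text \<open>The relation $\mu\le\lambda$. It is false by convention when $\lambda$ is not dominant, so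
  that every Bruhat graph of a non-dominant weight below is empty.\<close>

definition weight_le :: "weight \<Rightarrow> weight \<Rightarrow> bool"  (infix "\<preceq>" 50) where
  "\<mu> \<preceq> lam \<longleftrightarrow> dominant lam \<and> to_plane \<mu> \<in> convex hull (to_plane ` weyl_orbit lam)
     \<and> \<mu> - lam \<in> root_lattice"

section \<open>Crystals\<close>

text \<open>The crystal of the vector representation is
  $1 \stackrel{1}{\to} 2 \stackrel{2}{\to} \bar 2 \stackrel{1}{\to} \bar 1$, and a word
  $x_1 \cdots x_n$ is the element $x_1\otimes\cdots\otimes x_n$ of its $n$-th tensor power, with
  Kashiwara's tensor product rule. The crystal of highest weight
  $\lambda=\lambda_1\varpi_1+\lambda_2\varpi_2$ is realised as the connected component of the highest
  weight word $1^{\lambda_1+\lambda_2}2^{\lambda_2}$.\<close>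

datatype letter = L1 | L2 | L2bar | L1bar
datatype node = N1 | N2

fun letter_f :: "node \<Rightarrow> letter \<Rightarrow> letter option" where
  "letter_f N1 L1 = Some L2"
| "letter_f N1 L2bar = Some L1bar"
| "letter_f N2 L2 = Some L2bar"
| "letter_f _ _ = None"

fun letter_e :: "node \<Rightarrow> letter \<Rightarrow> letter option" where
  "letter_e N1 L2 = Some L1"
| "letter_e N1 L1bar = Some L2bar"
| "letter_e N2 L2bar = Some L2"
| "letter_e _ _ = None"

fun letter_wt :: "letter \<Rightarrow> weight" where
  "letter_wt L1 = (1, 0)"
| "letter_wt L2 = (-1, 1)"
| "letter_wt L2bar = (1, -1)"
| "letter_wt L1bar = (-1, 0)"

definition letter_eps :: "node \<Rightarrow> letter \<Rightarrow> nat" where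
  "letter_eps i x = (if letter_e i x = None then 0 else 1)"

definition letter_phi :: "node \<Rightarrow> letter \<Rightarrow> nat" where
  "letter_phi i x = (if letter_f i x = None then 0 else 1)"

type_synonym word = "letter list"

text \<open>$\varepsilon_i(x\otimes w)=\varepsilon_i(x)+\max(0,\varepsilon_i(w)-\varphi_i(x))$; natural number
  subtraction provides the maximum.\<close>

fun tensor_eps :: "node \<Rightarrow> word \<Rightarrow> nat" where
  "tensor_eps i [] = 0"
| "tensor_eps i (x # w) = letter_eps i x + (tensor_eps i w - letter_phi i x)"

fun cr_f :: "node \<Rightarrow> word \<Rightarrow> word option" where
  "cr_f i [] = None"
| "cr_f i (x # w) =
     (if letter_phi i x > tensor_eps i w then map_option (\<lambda>y. y # w) (letter_f i x)
      else map_option ((#) x) (cr_f i w))"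

fun cr_e :: "node \<Rightarrow> word \<Rightarrow> word option" where
  "cr_e i [] = None"
| "cr_e i (x # w) =
     (if letter_phi i x \<ge> tensor_eps i w then map_option (\<lambda>y. y # w) (letter_e i x)
      else map_option ((#) x) (cr_e i w))"

definition wt :: "word \<Rightarrow> weight" where
  "wt T = sum_list (map letter_wt T)"

definition highest_word :: "weight \<Rightarrow> word" where
  "highest_word lam = replicate (nat (fst lam + snd lam)) L1 @ replicate (nat (snd lam)) L2"

text \<open>The set $\mathcal{B}(\lambda)$; it is empty when $\lambda$ is not dominant.\<close>

inductive_set crystal :: "weight \<Rightarrow> word set" for lam :: weight where
  "dominant lam \<Longrightarrow> highest_word lam \<in> crystal lam"
| "T \<in> crystal lam \<Longrightarrow> cr_f i T = Some U \<Longrightarrow> U \<in> crystal lam"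
| "T \<in> crystal lam \<Longrightarrow> cr_e i T = Some U \<Longrightarrow> U \<in> crystal lam"

definition e_pow :: "node \<Rightarrow> nat \<Rightarrow> word \<Rightarrow> word option" where
  "e_pow i k T = ((\<lambda>x. Option.bind x (cr_e i)) ^^ k) (Some T)"

definition f_pow :: "node \<Rightarrow> nat \<Rightarrow> word \<Rightarrow> word option" where
  "f_pow i k T = ((\<lambda>x. Option.bind x (cr_f i)) ^^ k) (Some T)"

definition eps :: "node \<Rightarrow> word \<Rightarrow> nat" where
  "eps i T = Max {k. e_pow i k T \<noteq> None}"

definition phi :: "node \<Rightarrow> word \<Rightarrow> nat" where
  "phi i T = Max {k. f_pow i k T \<noteq> None}"

definition e_top :: "node \<Rightarrow> word \<Rightarrow> word" where
  "e_top i T = the (e_pow i (eps i T) T)"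

text \<open>Reversal of the $f_1$-string: an element at distance $\varepsilon_1$ from the top and
  $\varphi_1$ from the bottom goes to the element at distance $\varphi_1$ from the top.\<close>

definition s1 :: "word \<Rightarrow> word" where
  "s1 T = the (f_pow N1 (phi N1 T) (e_top N1 T))"

definition str2 :: "word \<Rightarrow> nat \<times> nat \<times> nat \<times> nat" where
  "str2 T = (let T1 = e_top N2 T; T2 = e_top N1 T1; T3 = e_top N2 T2
             in (eps N2 T, eps N1 T1, eps N2 T2, eps N1 T3))"

section \<open>Preatoms\<close>

text \<open>\<open>Phi lam\<close> is the map $\Phi:\mathcal{B}(\lambda)\to\mathcal{B}(\lambda+2\varpi_1)$, and
  \<open>Phi_pow p lam\<close> is $\Phi^p:\mathcal{B}(\lambda)\to\mathcal{B}(\lambda+2p\varpi_1)$.\<close>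

definition Phi :: "weight \<Rightarrow> word \<Rightarrow> word" where
  "Phi lam T = (THE U. U \<in> crystal (lam + 2 *\<^sub>Z varpi1) \<and> str2 U = str2 T + (0, 1, 1, 1))"

fun Phi_pow :: "nat \<Rightarrow> weight \<Rightarrow> word \<Rightarrow> word" where
  "Phi_pow 0 lam T = T"
| "Phi_pow (Suc p) lam T = Phi (lam + (2 * int p) *\<^sub>Z varpi1) (Phi_pow p lam T)"

definition preatom :: "weight \<Rightarrow> word set" where
  "preatom \<kappa> = (if fst \<kappa> \<ge> 2
     then crystal \<kappa> - Phi (\<kappa> - 2 *\<^sub>Z varpi1) ` crystal (\<kappa> - 2 *\<^sub>Z varpi1)
     else crystal \<kappa>)"

definition pat :: "weight \<Rightarrow> word \<Rightarrow> nat" where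
  "pat lam' T = Max {p. T \<in> Phi_pow p (lam' - (2 * int p) *\<^sub>Z varpi1)
                             ` crystal (lam' - (2 * int p) *\<^sub>Z varpi1)}"

section \<open>Atoms\<close>

definition Psi :: "weight \<Rightarrow> word \<Rightarrow> word" where
  "Psi \<kappa> T = (case str2 T of (a, b, c, d) \<Rightarrow>
     (THE U. U \<in> preatom (\<kappa> + varpi2) \<and>
        str2 U = (if int d \<in> {0, fst \<kappa>} then (a, b + 1, c + 1, d) else (a, b, c + 1, d + 1))))"

definition Psibar :: "weight \<Rightarrow> word \<Rightarrow> word" where
  "Psibar \<kappa> T = (if fst (wt T) \<le> 0 then Psi \<kappa> T else s1 (Psi \<kappa> (s1 T)))"

fun Psibar_pow :: "nat \<Rightarrow> weight \<Rightarrow> word \<Rightarrow> word" where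
  "Psibar_pow 0 \<kappa> T = T"
| "Psibar_pow (Suc a) \<kappa> T = Psibar (\<kappa> + int a *\<^sub>Z varpi2) (Psibar_pow a \<kappa> T)"

definition atom :: "weight \<Rightarrow> word set" where
  "atom \<kappa> = (if fst \<kappa> > 0
     then preatom \<kappa> - Psibar (\<kappa> - varpi2) ` preatom (\<kappa> - varpi2)
     else preatom \<kappa> - Psibar_pow 2 (\<kappa> - 2 *\<^sub>Z varpi2) ` preatom (\<kappa> - 2 *\<^sub>Z varpi2))"

text \<open>The exponents $a$ for which $\mathcal{A}(\kappa-a\varpi_2)$ is an atom of
  $\mathcal{P}(\kappa)$: when $\kappa_1=0$ only even $a$ occur.\<close>

definition atom_exponent :: "weight \<Rightarrow> nat \<Rightarrow> bool" where
  "atom_exponent \<kappa> a \<longleftrightarrow> int a \<le> snd \<kappa> \<and> (fst \<kappa> = 0 \<longrightarrow> even a)"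

text \<open>\<open>atom_in p \<kappa> a\<close> is the atom
  $\mathcal{A}(\kappa-a\varpi_2)\subset\mathcal{P}(\kappa)\subset\mathcal{B}(\kappa+2p\varpi_1)$.\<close>

definition atom_in :: "nat \<Rightarrow> weight \<Rightarrow> nat \<Rightarrow> word set" where
  "atom_in p \<kappa> a = (if atom_exponent \<kappa> a
     then (\<lambda>T. Phi_pow p \<kappa> (Psibar_pow a (\<kappa> - int a *\<^sub>Z varpi2) T)) ` atom (\<kappa> - int a *\<^sub>Z varpi2)
     else {})"

text \<open>The atomic number on $\mathcal{P}(\kappa)$. The maximum is over the exponents of the atomic
  decomposition of $\mathcal{P}(\kappa)$: for $\kappa_1=0$ the map $\overline\Psi$ does not carry
  atoms to atoms, only its even powers do.\<close>

definition atomic_number_preatom :: "weight \<Rightarrow> word \<Rightarrow> nat" where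
  "atomic_number_preatom \<kappa> T = Max {a. atom_exponent \<kappa> a \<and>
     T \<in> Psibar_pow a (\<kappa> - int a *\<^sub>Z varpi2) ` preatom (\<kappa> - int a *\<^sub>Z varpi2)}"

definition atomic_number :: "weight \<Rightarrow> word \<Rightarrow> nat" where
  "atomic_number lam' T =
     (let p = pat lam' T; \<kappa> = lam' - (2 * int p) *\<^sub>Z varpi1
      in atomic_number_preatom \<kappa> (THE T'. T' \<in> preatom \<kappa> \<and> Phi_pow p \<kappa> T' = T))"

section \<open>Bruhat graphs\<close>

text \<open>The label $h+j\delta$ is the pair $(h,j)$; an edge is a triple (source, target, label).\<close>

type_synonym aff_coroot = "coweight \<times> int"
type_synonym edge = "weight \<times> weight \<times> aff_coroot"

definition bruhat_edges :: "weight \<Rightarrow> edge set" where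
  "bruhat_edges lam =
     {(\<mu>, \<mu> - k *\<^sub>Z pos_root \<beta>, (- coroot \<beta>, \<bar>pairing \<mu> (coroot \<beta>) - k\<bar>)) | \<mu> k \<beta>.
        1 \<le> k \<and> \<mu> \<preceq> lam \<and> \<mu> - k *\<^sub>Z pos_root \<beta> \<preceq> lam \<and> pairing \<mu> (coroot \<beta>) - k < 0} \<union>
     {(\<mu> - k *\<^sub>Z pos_root \<beta>, \<mu>, (coroot \<beta>, pairing \<mu> (coroot \<beta>) - k)) | \<mu> k \<beta>.
        1 \<le> k \<and> \<mu> \<preceq> lam \<and> \<mu> - k *\<^sub>Z pos_root \<beta> \<preceq> lam \<and> pairing \<mu> (coroot \<beta>) - k \<ge> 0}"

text \<open>For $m\ge1$, $\gamma_m=M\delta-\beta^\vee$ with $\beta$ = \<open>gamma_root m\<close> and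
  $M$ = \<open>gamma_level m\<close>.\<close>

definition gamma_root :: "nat \<Rightarrow> posroot" where
  "gamma_root m = (if m mod 4 = 0 then A2 else if m mod 4 = 2 then A12 else A21)"

definition gamma_level :: "nat \<Rightarrow> int" where
  "gamma_level m = (let M = int ((m + 3) div 4)
     in if m mod 4 = 1 then 2 * M - 1 else if m mod 4 = 3 then 2 * M else M)"

definition gamma :: "nat \<Rightarrow> aff_coroot" where
  "gamma m = (- coroot (gamma_root m), gamma_level m)"

definition t_refl :: "nat \<Rightarrow> weight \<Rightarrow> weight" where
  "t_refl m \<mu> = \<mu> - (pairing \<mu> (coroot (gamma_root m)) + gamma_level m) *\<^sub>Z pos_root (gamma_root m)"

definition less_t :: "nat \<Rightarrow> weight \<Rightarrow> bool" where
  "less_t m \<mu> \<longleftrightarrow> pairing \<mu> (coroot (gamma_root m)) + gamma_level m > 0"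

definition twisted_edges :: "nat \<Rightarrow> weight \<Rightarrow> edge set" where
  "twisted_edges m lam =
     {(x, y, l) | x y l. (x, y, l) \<in> bruhat_edges lam \<and> l \<notin> gamma ` {1..m}} \<union>
     {(y, x, l) | x y l. (x, y, l) \<in> bruhat_edges lam \<and> l \<in> gamma ` {1..m}}"

definition ell :: "nat \<Rightarrow> weight \<Rightarrow> weight \<Rightarrow> nat" where
  "ell m \<mu> lam = card {(x, y, l) \<in> twisted_edges m lam. y = \<mu>}"

definition swappable_edges :: "weight \<Rightarrow> edge set" where
  "swappable_edges lam = {(\<mu>, t_refl (m + 1) \<mu>, gamma (m + 1)) | \<mu> m.
     (\<mu>, t_refl (m + 1) \<mu>, gamma (m + 1)) \<in> bruhat_edges lam \<and>
     int (ell m \<mu> lam) = int (ell m (t_refl (m + 1) \<mu>) lam) - 1}"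

definition nonswappable_edges :: "weight \<Rightarrow> edge set" where
  "nonswappable_edges lam = {(\<mu>, t_refl (m + 1) \<mu>, gamma (m + 1)) | \<mu> m.
     (\<mu>, t_refl (m + 1) \<mu>, gamma (m + 1)) \<in> bruhat_edges lam \<and>
     int (ell m \<mu> lam) \<noteq> int (ell m (t_refl (m + 1) \<mu>) lam) - 1}"

definition NS_count :: "nat \<Rightarrow> weight \<Rightarrow> weight \<Rightarrow> nat" where
  "NS_count m \<mu> lam = card {(x, y, l) \<in> nonswappable_edges lam. x = \<mu> \<and> l \<in> gamma ` {1..m}}"

text \<open>An NS-staircase of length $a$ over $(\mu,\lambda)$ with root $\alpha$ and start $n$, all of
  whose labels lie in $\{\gamma_1,\dots,\gamma_m\}$. Length $0$ is always possible (take $n=0$), so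
  the maximum below is $0$ if there is no staircase of positive length.\<close>

definition NS_staircase :: "nat \<Rightarrow> weight \<Rightarrow> weight \<Rightarrow> posroot \<Rightarrow> nat \<Rightarrow> nat \<Rightarrow> bool" where
  "NS_staircase m \<mu> lam \<alpha> n a \<longleftrightarrow>
     (n = 0 \<or> (\<exists>l. (\<mu>, \<mu> - int n *\<^sub>Z pos_root \<alpha>, l) \<in> swappable_edges lam)) \<and>
     (\<forall>i\<in>{1..a}. \<exists>l \<in> gamma ` {1..m}.
        (\<mu>, \<mu> - int (n + i) *\<^sub>Z pos_root \<alpha>, l) \<in> nonswappable_edges (lam + int i *\<^sub>Z varpi2))"

definition Dhat :: "nat \<Rightarrow> weight \<Rightarrow> weight \<Rightarrow> nat" where
  "Dhat m \<mu> lam = Max {a. \<exists>\<alpha> n. NS_staircase m \<mu> lam \<alpha> n a}"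

definition Dtrunc :: "nat \<Rightarrow> weight \<Rightarrow> weight \<Rightarrow> nat \<Rightarrow> nat" where
  "Dtrunc m \<mu> \<kappa> a = min a (Dhat m \<mu> (\<kappa> - int a *\<^sub>Z varpi2))"

section \<open>Elevation, the statistics $\sigma_m$ and the map $\psi$\<close>

text \<open>\<open>lowers_to_swappable \<nu> e j\<close>: writing $e=(\mu\to\mu-k\alpha)$, the edge
  $\mu\to\mu-(k-j)\alpha$ exists and is swappable in $\Gamma_{\nu-j\varpi_2}$. Not every edge admits
  such a $j$; those that do are the edges for which the elevation is defined.\<close>

definition lowers_to_swappable :: "weight \<Rightarrow> edge \<Rightarrow> nat \<Rightarrow> bool" where
  "lowers_to_swappable \<nu> e j \<longleftrightarrow> (\<exists>\<mu> k \<alpha> l l'. 1 \<le> k \<and> e = (\<mu>, \<mu> - k *\<^sub>Z pos_root \<alpha>, l) \<and>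
     (\<mu>, \<mu> - (k - int j) *\<^sub>Z pos_root \<alpha>, l') \<in> swappable_edges (\<nu> - int j *\<^sub>Z varpi2))"

definition has_elevation :: "weight \<Rightarrow> edge \<Rightarrow> bool" where
  "has_elevation \<nu> e \<longleftrightarrow> (\<exists>j. lowers_to_swappable \<nu> e j)"

definition elevation :: "weight \<Rightarrow> edge \<Rightarrow> nat" where
  "elevation \<nu> e = (LEAST j. lowers_to_swappable \<nu> e j)"

definition sigma_stat :: "nat \<Rightarrow> weight \<Rightarrow> word \<Rightarrow> int" where
  "sigma_stat m lam' T =
     (let \<mu> = wt T; p = pat lam' T; a = atomic_number lam' T;
          lam = lam' - (2 * int p) *\<^sub>Z varpi1; \<nu> = lam - int a *\<^sub>Z varpi2
      in int (ell m \<mu> \<nu>) - int (NS_count m \<mu> \<nu>) + int (Dtrunc m \<mu> lam a) + int a + 2 * int p)"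

text \<open>The element of weight $\mu$ in the atom
  $\mathcal{A}(\kappa-b\varpi_2)\subset\mathcal{P}(\kappa)\subset\mathcal{B}(\kappa+2p\varpi_1)$.\<close>

definition atom_elt :: "nat \<Rightarrow> weight \<Rightarrow> nat \<Rightarrow> weight \<Rightarrow> word" where
  "atom_elt p \<kappa> b \<mu> = (THE U. U \<in> atom_in p \<kappa> b \<and> wt U = \<mu>)"

text \<open>$\psi_{t\mu}(T)$ for $T$ in the atom
  $\mathcal{A}(\kappa-a\varpi_2)\subset\mathcal{P}(\kappa)\subset\mathcal{B}(\kappa+2p\varpi_1)$ and
  the edge $e$ with source $\mu$ and target $t\mu=\mathrm{wt}(T)$; it depends on $T$ only through
  its atom and $e$.\<close>

definition psi :: "nat \<Rightarrow> weight \<Rightarrow> nat \<Rightarrow> edge \<Rightarrow> word" where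
  "psi p \<kappa> a e = atom_elt p \<kappa> (a + elevation (\<kappa> - int a *\<^sub>Z varpi2) e) (fst e)"

end

theory Submission
  imports Defs
begin

text \<open>The words of a crystal are pairs of rows, so the adapted strings are cut out by explicit
  inequalities and the preatoms become explicit as well. Each weight then occurs at most once in an
  atom, and the pattern and atomic numbers of $T$ and $\psi_{t\mu}(T)$ can be read off, which leaves
  an identity about Bruhat graphs.

  The edges ending at $\mu$ lie on the four root lines through $\mu$. In coordinates the order
  ideal of $\lambda$ is a lattice octagon, so $\ell_m(\mu,\lambda)$ is a sum of lengths of intervals,
  cut off at the boundary of the octagon. Comparing the two ends of an edge, it is non-swappable only
  in the directions $\alpha_2$ and $\alpha_{12}$, and then exactly under three linear inequalities
  that persist when $\lambda$ is raised by $\varpi_2$ along the edge. Hence at $t\mu$ neither the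
  non-swappable edges nor the staircases contribute, at $\mu$ the longest staircase has length
  $\Omega(e)$, and the remaining terms balance.\<close>

subsection \<open>Words and signatures\<close>

text \<open>On the crystal side the obstacle is \<open>s1\<close>: atoms are defined through
  \<open>Psibar\<close>, which uses it, while the strings begin with the node 2 and do not see it.
  The way out is that the image of \<Phi> meets every 1-string symmetrically; weights with
  nonpositive first coordinate are then handled by strings, the others by \<open>s1\<close>. On the
  graph side, reversing the labels \<gamma>_1..\<gamma>_m only moves a threshold on each root line,
  so the number of incoming edges is the untwisted number at a shifted pairing minus the part beyond
  the octagon (\<open>string_count_eq\<close>). Reflection in an edge permutes, up to
  \<open>gcount_flip\<close>, the shifted pairings on the other lines, so swappability depends only
  on the parts cut off; comparing them gives the three inequalities of \<open>ns_cond\<close>. When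
  the edge and \<lambda> are lowered together, each inequality loses at a constant rate, and
  \<Omega>(e) is the first failure, a minimum of three explicit numbers
  (\<open>elevation_core\<close>). The steps that leave the lowered octagon are missing both from
  \<open>ell\<close> and from the number of non-swappable edges at \<mu>, so they cancel in
  \<sigma>_m.\<close>

lemma cr_e_eq_None_iff: "cr_e i w = None \<longleftrightarrow> tensor_eps i w = 0"
proof (induction w)
  case (Cons x w)
  then show ?case
    by (cases i; cases x; auto simp: letter_phi_def letter_eps_def)
qed simp

lemma cr_e_SomeD:
  "cr_e i w = Some u \<Longrightarrow> tensor_eps i w = Suc (tensor_eps i u) \<and> cr_f i u = Some w"
proof (induction w arbitrary: u)
  case (Cons x w)
  then show ?case
    by (cases i; cases x; cases "tensor_eps i w";
        fastforce simp: letter_phi_def letter_eps_def cr_e_eq_None_iff split: if_splits)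
qed simp

lemma cr_f_SomeD:
  "cr_f i w = Some u \<Longrightarrow> tensor_eps i u = Suc (tensor_eps i w) \<and> cr_e i u = Some w"
proof (induction w arbitrary: u)
  case (Cons x w)
  then show ?case
    by (cases i; cases x; cases "tensor_eps i w";
        fastforce simp: letter_phi_def letter_eps_def cr_e_eq_None_iff split: if_splits)
qed simp

fun simple_root :: "node \<Rightarrow> weight" where
  "simple_root N1 = (2, -1)"
| "simple_root N2 = (-2, 2)"

lemma wt_Nil [simp]: "wt [] = (0, 0)"
  by (simp add: wt_def zero_prod_def)

lemma wt_Cons [simp]: "wt (x # w) = letter_wt x + wt w"
  by (simp add: wt_def)

lemma wt_append [simp]: "wt (v @ w) = wt v + wt w"
  by (simp add: wt_def)

lemma wt_replicate [simp]: "wt (replicate k x) = int k *\<^sub>Z letter_wt x"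
  by (induction k) (simp_all add: zscale_def algebra_simps prod_eq_iff)

lemma wt_cr_f: "cr_f i w = Some u \<Longrightarrow> wt u = wt w - simple_root i"
proof (induction w arbitrary: u)
  case (Cons x w)
  then show ?case
    by (cases i; cases x; fastforce simp: letter_phi_def split: if_splits)
qed simp

lemma wt_cr_e: "cr_e i w = Some u \<Longrightarrow> wt u = wt w + simple_root i"
  using cr_e_SomeD wt_cr_f by fastforce

text \<open>\<phi>_i is taken from \<epsilon>_i and the weight, which spares a second bracketing
  recursion. The \<open>nat\<close> never truncates, see \<open>tensor_phi_nonneg\<close>.\<close>

fun tensor_phi :: "node \<Rightarrow> word \<Rightarrow> nat" where
  "tensor_phi N1 w = nat (int (tensor_eps N1 w) + fst (wt w))"
| "tensor_phi N2 w = nat (int (tensor_eps N2 w) + snd (wt w))"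

lemma tensor_phi_nonneg:
  "0 \<le> int (tensor_eps N1 w) + fst (wt w)" "0 \<le> int (tensor_eps N2 w) + snd (wt w)"
proof (induction w)
  case (Cons x w)
  case 1 show ?case using Cons(1) by (cases x; auto simp: letter_phi_def letter_eps_def)
  case 2 show ?case using Cons(2) by (cases x; auto simp: letter_phi_def letter_eps_def)
qed simp_all

lemma cr_f_eq_None_iff: "cr_f i w = None \<longleftrightarrow> tensor_phi i w = 0"
proof (induction w)
  case (Cons x w)
  then show ?case using tensor_phi_nonneg[of w]
    by (cases i; cases x; auto simp: letter_phi_def letter_eps_def)
qed (cases i; simp)

lemma e_pow_0 [simp]: "e_pow i 0 w = Some w" by (simp add: e_pow_def)
lemma f_pow_0 [simp]: "f_pow i 0 w = Some w" by (simp add: f_pow_def)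

lemma e_pow_Suc: "e_pow i (Suc k) w = Option.bind (e_pow i k w) (cr_e i)"
  by (simp add: e_pow_def)
lemma f_pow_Suc: "f_pow i (Suc k) w = Option.bind (f_pow i k w) (cr_f i)"
  by (simp add: f_pow_def)

lemma e_pow_Suc': "e_pow i (Suc k) w = Option.bind (cr_e i w) (e_pow i k)"
  by (induction k arbitrary: w) (simp_all add: e_pow_Suc cong: bind_option_cong)
lemma f_pow_Suc': "f_pow i (Suc k) w = Option.bind (cr_f i w) (f_pow i k)"
  by (induction k arbitrary: w) (simp_all add: f_pow_Suc cong: bind_option_cong)

lemma e_pow_eq_None_iff: "e_pow i k w = None \<longleftrightarrow> tensor_eps i w < k"
proof (induction k arbitrary: w)
  case (Suc k)
  show ?case
  proof (cases "cr_e i w")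
    case None
    moreover from None have "tensor_eps i w = 0" by (simp only: cr_e_eq_None_iff)
    ultimately show ?thesis by (simp add: e_pow_Suc')
  next
    case (Some u)
    then show ?thesis using Suc cr_e_SomeD[OF Some] by (simp add: e_pow_Suc')
  qed
qed simp

lemma tensor_phi_cr_f: "cr_f i w = Some u \<Longrightarrow> tensor_phi i w = Suc (tensor_phi i u)"
  using wt_cr_f[of i w u] cr_f_SomeD[of i w u] tensor_phi_nonneg[of u]  tensor_phi_nonneg[of w]
  by (cases i) auto

lemma f_pow_eq_None_iff: "f_pow i k w = None \<longleftrightarrow> tensor_phi i w < k"
proof (induction k arbitrary: w)
  case (Suc k)
  show ?case
  proof (cases "cr_f i w")
    case None
    moreover from None have "tensor_phi i w = 0" by (simp only: cr_f_eq_None_iff)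
    ultimately show ?thesis by (simp add: f_pow_Suc')
  next
    case (Some u)
    then show ?thesis using Suc tensor_phi_cr_f[OF Some] by (simp add: f_pow_Suc')
  qed
qed simp

lemma eps_eq: "eps i w = tensor_eps i w"
proof -
  have "{k. e_pow i k w \<noteq> None} = {..tensor_eps i w}"
    by (auto simp: e_pow_eq_None_iff simp del: not_None_eq)
  then show ?thesis unfolding eps_def by (auto intro: Max_eqI)
qed

lemma phi_eq: "phi i w = tensor_phi i w"
proof -
  have "{k. f_pow i k w \<noteq> None} = {..tensor_phi i w}"
    by (auto simp: f_pow_eq_None_iff simp del: not_None_eq)
  then show ?thesis unfolding phi_def by (auto intro: Max_eqI simp del: tensor_phi.simps)
qed

lemma e_pow_imp_f_pow: "e_pow i k w = Some u \<Longrightarrow> f_pow i k u = Some w"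
proof (induction k arbitrary: u)
  case (Suc k)
  then obtain v where v: "e_pow i k w = Some v" "cr_e i v = Some u"
    by (auto simp: e_pow_Suc bind_eq_Some_conv)
  then show ?case using Suc.IH cr_e_SomeD by (fastforce simp: f_pow_Suc')
qed simp

lemma f_pow_imp_e_pow: "f_pow i k w = Some u \<Longrightarrow> e_pow i k u = Some w"
proof (induction k arbitrary: u)
  case (Suc k)
  then obtain v where v: "f_pow i k w = Some v" "cr_f i v = Some u"
    by (auto simp: f_pow_Suc bind_eq_Some_conv)
  then show ?case using Suc.IH cr_f_SomeD by (fastforce simp: e_pow_Suc')
qed simp

lemma tensor_eps_e_pow: "e_pow i k w = Some u \<Longrightarrow> tensor_eps i w = tensor_eps i u + k"
proof (induction k arbitrary: u)
  case (Suc k)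
  then obtain v where v: "e_pow i k w = Some v" "cr_e i v = Some u"
    by (auto simp: e_pow_Suc bind_eq_Some_conv)
  then show ?case using Suc.IH cr_e_SomeD by fastforce
qed simp

lemma tensor_phi_f_pow: "f_pow i k w = Some u \<Longrightarrow> tensor_phi i w = tensor_phi i u + k"
proof (induction k arbitrary: u)
  case (Suc k)
  then obtain v where v: "f_pow i k w = Some v" "cr_f i v = Some u"
    by (auto simp: f_pow_Suc bind_eq_Some_conv)
  then show ?case using Suc.IH tensor_phi_cr_f by fastforce
qed simp

lemma e_top_eq: "e_pow i (tensor_eps i w) w = Some (e_top i w)"
  using e_pow_eq_None_iff[of i "tensor_eps i w" w] by (auto simp: e_top_def eps_eq)

lemma tensor_eps_e_top: "tensor_eps i (e_top i w) = 0"
  using tensor_eps_e_pow[OF e_top_eq] by simp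

lemma e_top_unique: "e_pow i k w = Some u \<Longrightarrow> tensor_eps i u = 0 \<Longrightarrow> e_top i w = u"
  using tensor_eps_e_pow[of i k w u] e_top_eq[of i w] by simp

lemma f_pow_e_top: "f_pow i (tensor_eps i w) (e_top i w) = Some w"
  using e_pow_imp_f_pow[OF e_top_eq] .

lemma wt_e_pow: "e_pow i k w = Some u \<Longrightarrow> wt u = wt w + int k *\<^sub>Z simple_root i"
proof (induction k arbitrary: u)
  case (Suc k)
  then obtain v where v: "e_pow i k w = Some v" "cr_e i v = Some u"
    by (auto simp: e_pow_Suc bind_eq_Some_conv)
  then show ?case using Suc.IH wt_cr_e[of i v u] by (auto simp: zscale_def algebra_simps prod_eq_iff)
qed (simp add: zscale_def prod_eq_iff)

lemma wt_f_pow: "f_pow i k w = Some u \<Longrightarrow> wt u = wt w - int k *\<^sub>Z simple_root i"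
  using wt_e_pow[OF f_pow_imp_e_pow] by fastforce

lemma tensor_phi_e_pow: "e_pow i k w = Some u \<Longrightarrow> tensor_phi i u = tensor_phi i w + k"
  using tensor_phi_f_pow[OF e_pow_imp_f_pow] .

lemma tensor_phi_e_top: "tensor_phi i (e_top i w) = tensor_phi i w + tensor_eps i w"
  using tensor_phi_e_pow[OF e_top_eq] .

subsection \<open>The reflection \<open>s1\<close>\<close>

lemma f_pow_s1: "f_pow N1 (tensor_phi N1 w) (e_top N1 w) = Some (s1 w)"
proof -
  have "f_pow N1 (tensor_phi N1 w) (e_top N1 w) \<noteq> None"
    by (simp add: f_pow_eq_None_iff tensor_phi_e_top del: not_None_eq tensor_phi.simps)
  then show ?thesis by (auto simp: s1_def phi_eq)
qed

lemma e_top_s1: "e_top N1 (s1 w) = e_top N1 w"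
  using e_top_unique[OF f_pow_imp_e_pow[OF f_pow_s1] tensor_eps_e_top] .

lemma tensor_phi_s1: "tensor_phi N1 (s1 w) = tensor_eps N1 w"
  using tensor_phi_f_pow[OF f_pow_s1[of w]] tensor_phi_e_top[of N1 w] by simp

text \<open>An element and its image lie on the string with the same top, and \<open>s1\<close>
  exchanges the distances \<epsilon>_1 and \<phi>_1 to the two ends.\<close>

lemma s1_s1 [simp]: "s1 (s1 w) = w"
proof -
  have "Some (s1 (s1 w)) = Some w"
    using f_pow_s1[of "s1 w"] f_pow_e_top[of N1 w]
    by (metis e_top_s1 tensor_phi_s1)
  then show ?thesis by simp
qed

lemma wt_s1: "wt (s1 w) = refl1 (wt w)"
proof -
  have "wt (s1 w) = wt w + (int (tensor_eps N1 w) - int (tensor_phi N1 w)) *\<^sub>Z (2, -1)"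
    using wt_f_pow[OF f_pow_s1[of w]] wt_e_pow[OF e_top_eq[of N1 w]]
    by (simp add: zscale_def algebra_simps prod_eq_iff del: tensor_phi.simps)
  then show ?thesis using tensor_phi_nonneg(1)[of w]
    by (cases "wt w") (simp add: zscale_def)
qed

lemma crystal_e_pow: "w \<in> crystal lam \<Longrightarrow> e_pow i k w = Some u \<Longrightarrow> u \<in> crystal lam"
proof (induction k arbitrary: u)
  case (Suc k)
  then show ?case by (auto simp: e_pow_Suc bind_eq_Some_conv intro: crystal.intros)
qed simp

lemma crystal_f_pow: "w \<in> crystal lam \<Longrightarrow> f_pow i k w = Some u \<Longrightarrow> u \<in> crystal lam"
proof (induction k arbitrary: u)
  case (Suc k)
  then show ?case by (auto simp: f_pow_Suc bind_eq_Some_conv intro: crystal.intros)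
qed simp

lemma s1_crystal: "w \<in> crystal lam \<Longrightarrow> s1 w \<in> crystal lam"
  using crystal_f_pow[OF crystal_e_pow[OF _ e_top_eq] f_pow_s1] by blast

subsection \<open>The crystal as a set of pairs of row words\<close>

text \<open>The two rows are the factors of $1^{\lambda_1+\lambda_2}\otimes 2^{\lambda_2}$ after applying
  crystal operators; the letter $1$ never enters the second row.\<close>

definition row_pair :: "nat \<Rightarrow> nat \<Rightarrow> nat \<Rightarrow> nat \<Rightarrow> nat \<Rightarrow> nat \<Rightarrow> nat \<Rightarrow> word" where
  "row_pair x1 x2 x3 x4 y2 y3 y4 =
     replicate x4 L1bar @ replicate x3 L2bar @ replicate x2 L2 @ replicate x1 L1 @
     replicate y4 L1bar @ replicate y3 L2bar @ replicate y2 L2"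

text \<open>Linear description of the component of the highest weight word, with n = \<lambda>_1 +
  \<lambda>_2 and m = \<lambda>_2. The operators preserve it (\<open>row_words_cr_f\<close>,
  \<open>row_words_cr_e\<close>), and conversely every such word climbs to the highest one
  (\<open>str2_row_pair\<close>). A letter 1 left in the first row excludes the letter 1bar in the
  second, whence the alternative.\<close>

definition row_cond :: "nat \<Rightarrow> nat \<Rightarrow> nat \<Rightarrow> nat \<Rightarrow> nat \<Rightarrow> nat \<Rightarrow> nat \<Rightarrow> nat \<Rightarrow> nat \<Rightarrow> bool" where
  "row_cond n m x1 x2 x3 x4 y2 y3 y4 \<longleftrightarrow>
     x1 + x2 + x3 + x4 = n \<and> y2 + y3 + y4 = m \<and> x4 + m \<le> n \<and> (y4 = 0 \<or> x1 = 0) \<and>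
     y2 \<le> x1 + y3 \<and> y2 + y3 \<le> x1 + 2 * x2"

lemma tensor_eps_replicate:
  "letter_e i x = None \<Longrightarrow> letter_f i x = None \<Longrightarrow> tensor_eps i (replicate k x @ w) = tensor_eps i w"
  "letter_e i x = None \<Longrightarrow> letter_f i x = Some y \<Longrightarrow> tensor_eps i (replicate k x @ w) = tensor_eps i w - k"
  "letter_e i x = Some y \<Longrightarrow> letter_f i x = None \<Longrightarrow> tensor_eps i (replicate k x @ w) = k + tensor_eps i w"
  by (induction k) (simp_all add: letter_eps_def letter_phi_def)

lemmas tensor_eps_replicate' = tensor_eps_replicate[where w = "[]", simplified]

lemma append_fun: "(@) (x # v) = (\<lambda>u. x # v @ u)" "(@) [] = (\<lambda>u. u)"
  by (simp_all add: fun_eq_iff)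

lemma cr_f_replicate:
  "letter_f i x = None \<Longrightarrow>
     cr_f i (replicate k x @ w) = map_option (\<lambda>u. replicate k x @ u) (cr_f i w)"
  "letter_e i x = None \<Longrightarrow> letter_f i x = Some y \<Longrightarrow>
     cr_f i (replicate k x @ w) =
       (if tensor_eps i w < k then Some (y # replicate (k - 1) x @ w)
        else map_option (\<lambda>u. replicate k x @ u) (cr_f i w))"
proof -
  show "cr_f i (replicate k x @ w) = map_option (\<lambda>u. replicate k x @ u) (cr_f i w)"
    if "letter_f i x = None"
    using that by (induction k) (auto simp: letter_phi_def option.map_comp option.map_ident append_fun o_def)
  show "cr_f i (replicate k x @ w) =
       (if tensor_eps i w < k then Some (y # replicate (k - 1) x @ w)
        else map_option (\<lambda>u. replicate k x @ u) (cr_f i w))"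
    if "letter_e i x = None" "letter_f i x = Some y"
    using that
    by (induction k)
      (auto simp: letter_phi_def tensor_eps_replicate option.map_comp option.map_ident append_fun o_def)
qed

lemma cr_e_replicate:
  "letter_e i x = None \<Longrightarrow> letter_f i x = None \<Longrightarrow>
     cr_e i (replicate k x @ w) = map_option (\<lambda>u. replicate k x @ u) (cr_e i w)"
  "letter_e i x = None \<Longrightarrow> letter_f i x = Some y \<Longrightarrow>
     cr_e i (replicate k x @ w) =
       (if tensor_eps i w \<le> k then None else map_option (\<lambda>u. replicate k x @ u) (cr_e i w))"
  "letter_e i x = Some y \<Longrightarrow> letter_f i x = None \<Longrightarrow>
     cr_e i (replicate k x @ w) =
       (if tensor_eps i w > 0 then map_option (\<lambda>u. replicate k x @ u) (cr_e i w)
        else if k = 0 then None else Some (replicate (k - 1) x @ y # w))"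
proof -
  show "cr_e i (replicate k x @ w) = map_option (\<lambda>u. replicate k x @ u) (cr_e i w)"
    if "letter_e i x = None" "letter_f i x = None"
    using that
    by (induction k)
      (auto simp: letter_phi_def tensor_eps_replicate option.map_comp option.map_ident append_fun o_def cr_e_eq_None_iff)
  show "cr_e i (replicate k x @ w) =
       (if tensor_eps i w \<le> k then None else map_option (\<lambda>u. replicate k x @ u) (cr_e i w))"
    if "letter_e i x = None" "letter_f i x = Some y"
    using that
    by (induction k)
      (auto simp: letter_phi_def tensor_eps_replicate option.map_comp option.map_ident append_fun o_def cr_e_eq_None_iff)
  show "cr_e i (replicate k x @ w) =
       (if tensor_eps i w > 0 then map_option (\<lambda>u. replicate k x @ u) (cr_e i w)
        else if k = 0 then None else Some (replicate (k - 1) x @ y # w))"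
    if "letter_e i x = Some y" "letter_f i x = None"
  proof (induction k)
    case (Suc k)
    then show ?case using that
      by (cases k) (auto simp: letter_phi_def letter_eps_def tensor_eps_replicate option.map_comp option.map_ident append_fun o_def cr_e_eq_None_iff)
  qed (use that in \<open>auto simp: cr_e_eq_None_iff option.map_ident append_fun\<close>)
qed

lemmas cr_replicate' = cr_f_replicate[where w = "[]", simplified] cr_e_replicate[where w = "[]", simplified]

lemmas row_simps = tensor_eps_replicate tensor_eps_replicate' cr_f_replicate cr_e_replicate
  cr_replicate' replicate_app_Cons_same

lemma tensor_eps_row_pair:
  "tensor_eps N1 (row_pair x1 x2 x3 x4 y2 y3 y4) = x4 + (x2 + (y4 + (y2 - y3) - x1) - x3)"
  "tensor_eps N2 (row_pair x1 x2 x3 x4 y2 y3 y4) = x3 + (y3 - x2)"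
  by (simp_all add: row_pair_def row_simps)

lemma cr_f_row_pair:
  "cr_f N1 (row_pair x1 x2 x3 x4 y2 y3 y4) =
     (if x2 + (y4 + (y2 - y3) - x1) < x3 then Some (row_pair x1 x2 (x3 - 1) (Suc x4) y2 y3 y4)
      else if y4 + (y2 - y3) < x1 then Some (row_pair (x1 - 1) (Suc x2) x3 x4 y2 y3 y4)
      else if y2 < y3 then Some (row_pair x1 x2 x3 x4 y2 (y3 - 1) (Suc y4)) else None)"
  "cr_f N2 (row_pair x1 x2 x3 x4 y2 y3 y4) =
     (if y3 < x2 then Some (row_pair x1 (x2 - 1) (Suc x3) x4 y2 y3 y4)
      else if y2 > 0 then Some (row_pair x1 x2 x3 x4 (y2 - 1) (Suc y3) y4) else None)"
  by (simp_all add: row_pair_def row_simps)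

text \<open>The hypothesis of the first part says that no letter 2 of the second row is available to
  e_1: either these letters are bracketed by the letters 2bar of their own row, or the first row
  absorbs the whole second row. Otherwise e_1 could create a 1 in the second row.\<close>

lemma cr_e_row_pair:
  "y2 \<le> y3 \<or> y4 + (y2 - y3) \<le> x1 + (x3 - x2) \<Longrightarrow>
   cr_e N1 (row_pair x1 x2 x3 x4 y2 y3 y4) =
     (if x2 + (y4 + (y2 - y3) - x1) \<le> x3
      then if x4 = 0 then None else Some (row_pair x1 x2 (Suc x3) (x4 - 1) y2 y3 y4)
      else if y4 + (y2 - y3) \<le> x1 then Some (row_pair (Suc x1) (x2 - 1) x3 x4 y2 y3 y4)
      else if y4 = 0 then None else Some (row_pair x1 x2 x3 x4 y2 (Suc y3) (y4 - 1)))"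
  "cr_e N2 (row_pair x1 x2 x3 x4 y2 y3 y4) =
     (if y3 \<le> x2 then if x3 = 0 then None else Some (row_pair x1 (Suc x2) (x3 - 1) x4 y2 y3 y4)
      else Some (row_pair x1 x2 x3 x4 (Suc y2) (y3 - 1) y4))"
  by (auto simp: row_pair_def row_simps)

text \<open>If y2 > y3, then y2 \<le> x1 + y3 forces x1 > 0, hence y4 = 0, and the surplus y2 - y3
  is at most x1.\<close>

lemma row_cond_bracket:
  "row_cond n m x1 x2 x3 x4 y2 y3 y4 \<Longrightarrow> y2 \<le> y3 \<or> y4 + (y2 - y3) \<le> x1 + (x3 - x2)"
  by (auto simp: row_cond_def)

definition row_words :: "nat \<Rightarrow> nat \<Rightarrow> word set" where
  "row_words n m = {row_pair x1 x2 x3 x4 y2 y3 y4 | x1 x2 x3 x4 y2 y3 y4. row_cond n m x1 x2 x3 x4 y2 y3 y4}"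

lemma row_wordsI: "row_cond n m x1 x2 x3 x4 y2 y3 y4 \<Longrightarrow> row_pair x1 x2 x3 x4 y2 y3 y4 \<in> row_words n m"
  unfolding row_words_def by blast

lemma row_wordsE:
  assumes "w \<in> row_words n m"
  obtains x1 x2 x3 x4 y2 y3 y4 where "w = row_pair x1 x2 x3 x4 y2 y3 y4"
    "row_cond n m x1 x2 x3 x4 y2 y3 y4"
  using assms unfolding row_words_def by blast

lemma row_words_cr_f: "w \<in> row_words n m \<Longrightarrow> cr_f i w = Some u \<Longrightarrow> u \<in> row_words n m"
  by (erule row_wordsE, cases i)
    (auto simp: cr_f_row_pair row_cond_def split: if_splits intro!: row_wordsI)

lemma row_words_cr_e: "w \<in> row_words n m \<Longrightarrow> cr_e i w = Some u \<Longrightarrow> u \<in> row_words n m"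
proof (erule row_wordsE)
  fix x1 x2 x3 x4 y2 y3 y4
  assume *: "w = row_pair x1 x2 x3 x4 y2 y3 y4" "row_cond n m x1 x2 x3 x4 y2 y3 y4" "cr_e i w = Some u"
  show ?thesis using *
    by (cases i) (auto simp: cr_e_row_pair(1)[OF row_cond_bracket[OF *(2)]] cr_e_row_pair(2) row_cond_def
        split: if_splits intro!: row_wordsI)
qed

lemma row_pair_cong:
  "x1 = u1 \<Longrightarrow> x2 = u2 \<Longrightarrow> x3 = u3 \<Longrightarrow> x4 = u4 \<Longrightarrow> y2 = v2 \<Longrightarrow> y3 = v3 \<Longrightarrow> y4 = v4 \<Longrightarrow>
   row_pair x1 x2 x3 x4 y2 y3 y4 = row_pair u1 u2 u3 u4 v2 v3 v4"
  by simp

lemma e_top_None: "tensor_eps i w = 0 \<Longrightarrow> e_top i w = w"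
  by (rule e_top_unique[where k = 0]) simp_all

lemma e_top_step: "cr_e i w = Some u \<Longrightarrow> e_top i w = e_top i u"
  using e_top_eq[of i w] e_top_eq[of i u] cr_e_SomeD[of i w u] by (simp add: e_pow_Suc')

text \<open>While y3 > x2, the operator e_2 acts on the letters 2bar of the second row, afterwards
  on those of the first; the last min y3 x2 of the second row stay bracketed by letters 2 of the
  first.\<close>

lemma e_top_row_pair_N2:
  "e_top N2 (row_pair x1 x2 x3 x4 y2 y3 y4) = row_pair x1 (x2 + x3) 0 x4 (y2 + (y3 - x2)) (min y3 x2) y4"
proof (induction "x3 + (y3 - x2)" arbitrary: x2 x3 y2 y3)
  case 0
  then show ?case by (simp add: e_top_None tensor_eps_row_pair)
next
  case (Suc k)
  show ?case
  proof (cases "y3 \<le> x2")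
    case True
    with Suc(2) obtain x where x: "x3 = Suc x" by (cases x3) auto
    have "e_top N2 (row_pair x1 x2 x3 x4 y2 y3 y4) = e_top N2 (row_pair x1 (Suc x2) x x4 y2 y3 y4)"
      using True x by (intro e_top_step) (simp add: cr_e_row_pair)
    also have "\<dots> = row_pair x1 (Suc x2 + x) 0 x4 (y2 + (y3 - Suc x2)) (min y3 (Suc x2)) y4"
      using Suc(2) True x by (intro Suc(1)) auto
    finally show ?thesis using True x by simp
  next
    case False
    then obtain y where y: "y3 = Suc y" by (cases y3) auto
    have "e_top N2 (row_pair x1 x2 x3 x4 y2 y3 y4) = e_top N2 (row_pair x1 x2 x3 x4 (Suc y2) y y4)"
      using False y by (intro e_top_step) (simp add: cr_e_row_pair)
    also have "\<dots> = row_pair x1 (x2 + x3) 0 x4 (Suc y2 + (y - x2)) (min y x2) y4"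
      using Suc(2) False y by (intro Suc(1)) auto
    also have "\<dots> = row_pair x1 (x2 + x3) 0 x4 (y2 + (y3 - x2)) (min y3 x2) y4"
      using False y by (intro row_pair_cong) auto
    finally show ?thesis .
  qed
qed

lemma e_top_row_pair_N1:
  assumes "y2 \<le> y3 \<or> y4 + (y2 - y3) \<le> x1 + (x3 - x2)"
  shows "e_top N1 (row_pair x1 x2 x3 x4 y2 y3 y4) =
     row_pair (x1 + (x2 - x3)) (min x2 x3) (x3 + x4) 0 y2
       (y3 + (y4 + (y2 - y3) - (x1 + (x3 - x2)))) (y4 - (y4 + (y2 - y3) - (x1 + (x3 - x2))))"
    (is "_ = ?R x1 x2 x3 x4 y2 y3 y4")
  using assms
\<comment> \<open>The measure is \<epsilon>_1, so each of the three cases is a single application of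
  e_1.\<close>
proof (induction "x4 + (x2 + (y4 + (y2 - y3) - x1) - x3)" arbitrary: x1 x2 x3 x4 y2 y3 y4)
  case 0
  then show ?case by (auto simp: e_top_None tensor_eps_row_pair min_def)
next
  case (Suc k)
  note e = cr_e_row_pair(1)[OF Suc(3), of x4]
  consider (x4) "x2 + (y4 + (y2 - y3) - x1) \<le> x3" "x4 > 0"
    | (x2) "x2 + (y4 + (y2 - y3) - x1) > x3" "y4 + (y2 - y3) \<le> x1"
    | (y4) "x2 + (y4 + (y2 - y3) - x1) > x3" "y4 + (y2 - y3) > x1" "y4 > 0" "y2 \<le> y3"
    using Suc(2,3) by fastforce
  then show ?case
  proof cases
    case x4
    have "e_top N1 (row_pair x1 x2 x3 x4 y2 y3 y4) = e_top N1 (row_pair x1 x2 (Suc x3) (x4 - 1) y2 y3 y4)"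
      using x4 e by (intro e_top_step) auto
    also have "\<dots> = ?R x1 x2 (Suc x3) (x4 - 1) y2 y3 y4"
      by (rule Suc(1)) (use x4 Suc(2,3) in auto)
    also have "\<dots> = ?R x1 x2 x3 x4 y2 y3 y4"
      using x4 Suc(2,3) by (intro row_pair_cong) auto
    finally show ?thesis .
  next
    case x2
    have "e_top N1 (row_pair x1 x2 x3 x4 y2 y3 y4) = e_top N1 (row_pair (Suc x1) (x2 - 1) x3 x4 y2 y3 y4)"
      using x2 e by (intro e_top_step) auto
    also have "\<dots> = ?R (Suc x1) (x2 - 1) x3 x4 y2 y3 y4"
      by (rule Suc(1)) (use x2 Suc(2,3) in auto)
    also have "\<dots> = ?R x1 x2 x3 x4 y2 y3 y4"
      using x2 Suc(2,3) by (intro row_pair_cong) auto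
    finally show ?thesis .
  next
    case y4
    have "e_top N1 (row_pair x1 x2 x3 x4 y2 y3 y4) = e_top N1 (row_pair x1 x2 x3 x4 y2 (Suc y3) (y4 - 1))"
      using y4 e by (intro e_top_step) auto
    also have "\<dots> = ?R x1 x2 x3 x4 y2 (Suc y3) (y4 - 1)"
      by (rule Suc(1)) (use y4 Suc(2,3) in auto)
    also have "\<dots> = ?R x1 x2 x3 x4 y2 y3 y4"
      using y4 Suc(2,3) by (intro row_pair_cong) auto
    finally show ?thesis .
  qed
qed

text \<open>The closed forms of \<open>e_top\<close> are composed along 2, 1, 2, 1. Since 2121 is a
  reduced word of the longest Weyl group element, the climb must end at the highest weight word; the
  second claim checks this directly and thereby connects every word with \<open>row_cond\<close> to
  it.\<close>

lemma str2_row_pair: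
  assumes "row_cond n m x1 x2 x3 x4 y2 y3 y4"
  defines "w \<equiv> row_pair x1 x2 x3 x4 y2 y3 y4"
  shows "str2 w = (x3 + (y3 - x2), x2 + x3 + x4 + y4, x4 + y4 + min y3 x2, x4)"
    and "e_top N1 (e_top N2 (e_top N1 (e_top N2 w))) = row_pair n 0 0 0 m 0 0"
proof -
  have 1: "e_top N2 w = row_pair x1 (x2 + x3) 0 x4 (y2 + (y3 - x2)) (min y3 x2) y4"
    by (simp add: w_def e_top_row_pair_N2)
  have b: "y4 + (y2 + (y3 - x2) - min y3 x2) - x1 = y4"
    using assms(1) by (auto simp: row_cond_def)
  have b': "y4 + (y2 + (y3 - x2) - min y3 x2) \<le> x1 \<or> y2 + (y3 - x2) \<le> min y3 x2"
    using assms(1) by (auto simp: row_cond_def)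
  have 2: "e_top N1 (e_top N2 w) =
      row_pair (x1 + x2 + x3) 0 x4 0 (y2 + (y3 - x2)) (min y3 x2 + y4) 0"
    unfolding 1 by (subst e_top_row_pair_N1) (use b b' in \<open>auto simp: add.assoc\<close>)
  have 3: "e_top N2 (e_top N1 (e_top N2 w)) = row_pair (x1 + x2 + x3) x4 0 0 m 0 0"
    unfolding 2 e_top_row_pair_N2 using assms(1) by (intro row_pair_cong) (auto simp: row_cond_def)
  have 4: "tensor_eps N1 (row_pair (x1 + x2 + x3) x4 0 0 m 0 0) = x4"
    using assms(1) by (auto simp: tensor_eps_row_pair row_cond_def)
  show "e_top N1 (e_top N2 (e_top N1 (e_top N2 w))) = row_pair n 0 0 0 m 0 0"
    unfolding 3 by (subst e_top_row_pair_N1) (use assms(1) in \<open>auto simp: row_cond_def\<close>)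
  have "tensor_eps N1 (e_top N2 w) = x2 + x3 + x4 + y4"
    unfolding 1 tensor_eps_row_pair b by simp
  moreover have "tensor_eps N2 (e_top N1 (e_top N2 w)) = x4 + y4 + min y3 x2"
    unfolding 2 tensor_eps_row_pair by simp
  moreover have "tensor_eps N2 w = x3 + (y3 - x2)" by (simp add: w_def tensor_eps_row_pair)
  ultimately show "str2 w = (x3 + (y3 - x2), x2 + x3 + x4 + y4, x4 + y4 + min y3 x2, x4)"
    using 3 4 by (simp add: str2_def Let_def eps_eq)
qed

section \<open>The crystal and its string polytope\<close>

lemma highest_word_eq:
  "highest_word lam = row_pair (nat (fst lam + snd lam)) 0 0 0 (nat (snd lam)) 0 0"
  by (simp add: highest_word_def row_pair_def)

lemma crystal_not_dominant: "\<not> dominant lam \<Longrightarrow> crystal lam = {}"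
proof -
  have "w \<in> crystal lam \<Longrightarrow> dominant lam" for w by (induction rule: crystal.induct)
  then show "\<not> dominant lam \<Longrightarrow> crystal lam = {}" by blast
qed

lemma crystal_dominant: "w \<in> crystal lam \<Longrightarrow> dominant lam"
  using crystal_not_dominant by blast

lemma crystal_subset_row_words:
  "crystal lam \<subseteq> row_words (nat (fst lam + snd lam)) (nat (snd lam))"
proof
  fix w assume "w \<in> crystal lam"
  then show "w \<in> row_words (nat (fst lam + snd lam)) (nat (snd lam))"
  proof (induction rule: crystal.induct)
    case 1
    then show ?case
      by (auto simp: highest_word_eq row_cond_def dominant_def nat_add_distrib intro!: row_wordsI)
  qed (auto intro: row_words_cr_f row_words_cr_e)
qed

lemma crystalE:
  assumes "w \<in> crystal lam"
  obtains n m x1 x2 x3 x4 y2 y3 y4 where "w = row_pair x1 x2 x3 x4 y2 y3 y4"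
    "row_cond n m x1 x2 x3 x4 y2 y3 y4" "lam = (int n - int m, int m)" "m \<le> n"
proof -
  have d: "dominant lam" using assms by (rule crystal_dominant)
  obtain x1 x2 x3 x4 y2 y3 y4 where *: "w = row_pair x1 x2 x3 x4 y2 y3 y4"
    "row_cond (nat (fst lam + snd lam)) (nat (snd lam)) x1 x2 x3 x4 y2 y3 y4"
    using crystal_subset_row_words assms by (blast elim: row_wordsE)
  show thesis by (rule that[OF *]) (use d in \<open>auto simp: dominant_def prod_eq_iff\<close>)
qed

lemma e_top_crystal:
  assumes "w \<in> crystal lam"
  shows "e_top N1 (e_top N2 (e_top N1 (e_top N2 w))) = highest_word lam"
proof -
  obtain n m x1 x2 x3 x4 y2 y3 y4 where *: "w = row_pair x1 x2 x3 x4 y2 y3 y4"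
    "row_cond n m x1 x2 x3 x4 y2 y3 y4" "lam = (int n - int m, int m)" "m \<le> n"
    using assms by (rule crystalE)
  show ?thesis using str2_row_pair(2)[OF *(2)] *(1,3) by (simp add: highest_word_eq)
qed

lemma str2_eq: "str2 w = (tensor_eps N2 w, tensor_eps N1 (e_top N2 w),
    tensor_eps N2 (e_top N1 (e_top N2 w)), tensor_eps N1 (e_top N2 (e_top N1 (e_top N2 w))))"
  by (simp add: str2_def Let_def eps_eq)

lemma e_top_inj: "e_top i v = e_top i w \<Longrightarrow> tensor_eps i v = tensor_eps i w \<Longrightarrow> v = w"
  by (metis f_pow_e_top option.inject)

text \<open>Both climbs end at the highest weight word, and the string tells how far to descend at
  each stage; \<open>e_top_inj\<close> undoes the four stages one after another.\<close>

lemma inj_on_str2: "inj_on str2 (crystal lam)"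
proof (rule inj_onI)
  fix v w assume "v \<in> crystal lam" "w \<in> crystal lam" "str2 v = str2 w"
  moreover from this have "e_top N1 (e_top N2 (e_top N1 (e_top N2 v))) =
      e_top N1 (e_top N2 (e_top N1 (e_top N2 w)))" by (simp add: e_top_crystal)
  ultimately show "v = w" by (auto simp: str2_eq dest!: e_top_inj)
qed

lemma str2_eq_iff: "v \<in> crystal lam \<Longrightarrow> w \<in> crystal lam \<Longrightarrow> str2 v = str2 w \<longleftrightarrow> v = w"
  using inj_on_str2 by (metis inj_onD)

lemma crystal_e_top_iff: "e_top i w \<in> crystal lam \<longleftrightarrow> w \<in> crystal lam"
  using crystal_e_pow[OF _ e_top_eq] crystal_f_pow[OF _ f_pow_e_top] by blast

text \<open>Littelmann's string polytope for the word 2121. The chain d \<le> c \<le> b is the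
  string cone. The other bounds say that in the descent from the top by f_1^d, f_2^c, f_1^b, f_2^a
  each exponent is at most the pairing of the weight reached so far with the simple coroot.\<close>

definition strings :: "weight \<Rightarrow> (nat \<times> nat \<times> nat \<times> nat) set" where
  "strings lam = {(a, b, c, d). d \<le> c \<and> c \<le> b \<and> int d \<le> fst lam \<and> int c \<le> snd lam + int d \<and>
     int b \<le> fst lam + 2 * int c - 2 * int d \<and> int a \<le> snd lam + int b - 2 * int c + int d}"

lemma str2_crystal_subset: "w \<in> crystal lam \<Longrightarrow> str2 w \<in> strings lam"
proof (erule crystalE)
  fix n m x1 x2 x3 x4 y2 y3 y4
  assume *: "w = row_pair x1 x2 x3 x4 y2 y3 y4"
    "row_cond n m x1 x2 x3 x4 y2 y3 y4" "lam = (int n - int m, int m)" "m \<le> n"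
  show "str2 w \<in> strings lam"
    unfolding *(1,3) str2_row_pair[OF *(2)] using *(2)
    by (cases "y3 \<le> x2") (auto simp: strings_def row_cond_def min_def)
qed

lemma ex_crystal_string:
  assumes "s \<in> strings lam"
  shows "\<exists>w \<in> crystal lam. str2 w = s"
proof -
  obtain a b c d where s: "s = (a, b, c, d)" by (cases s)
  have st: "d \<le> c" "c \<le> b" "int d \<le> fst lam" "int c \<le> snd lam + int d"
    "int b \<le> fst lam + 2 * int c - 2 * int d" "int a \<le> snd lam + int b - 2 * int c + int d"
    using assms by (simp_all add: s strings_def)
  define m where "m = nat (snd lam)"
  define n where "n = nat (fst lam + snd lam)"
  have nm: "snd lam = int m" "fst lam = int n - int m"
    using st by (simp_all add: m_def n_def)
  obtain c' where c': "c = d + c'" using st(1) le_Suc_ex by blast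
  obtain b' where b': "b = c + b'" using st(2) le_Suc_ex by blast
  have c: "d + m \<le> n" "c' \<le> m" "b' + m + d \<le> n + c'" "a + c' \<le> m + b'"
    using st(3-6) by (simp_all add: nm b' c')
  note c' = c' b'
  have lam: "lam = (int n - int m, int m)" "m \<le> n" using nm c(1) by (auto simp: prod_eq_iff)
  have dom: "dominant lam" using lam by (auto simp: dominant_def)
  \<comment> \<open>The formulas of \<open>str2_row_pair\<close> are solved for the rows. As b = n -
    x1 + y4 with x1 = 0 or y4 = 0, one gets n - x1 = min b n. In truncated subtraction a = x3 + (y3
    - x2) and b - c = x3 + (x2 - y3), so x3 = min a (b - c).\<close>
  define be where "be = min b n"
  define a1 where "a1 = min a b'"
  let ?x1 = "n - be" and ?x2 = "be - d - a1" and ?x4 = d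
  let ?y2 = "m - c' - (a - a1)" and ?y3 = "c' - (b - be) + (a - a1)" and ?y4 = "b - be"
  consider "b \<le> n" "a \<le> b'" "be = b" "a1 = a" | "n < b" "a \<le> b'" "be = n" "a1 = a"
    | "b \<le> n" "b' < a" "be = b" "a1 = b'" | "n < b" "b' < a" "be = n" "a1 = b'"
    unfolding be_def a1_def by linarith
  note cases = this
  have cond: "row_cond n m ?x1 ?x2 a1 ?x4 ?y2 ?y3 ?y4"
    using cases by cases (use c in \<open>simp_all add: c' row_cond_def, (intro conjI; linarith)+\<close>)
  define w where "w = row_pair ?x1 ?x2 a1 ?x4 ?y2 ?y3 ?y4"
  have "str2 w = s"
    unfolding w_def str2_row_pair(1)[OF cond] s
    using cases by cases (use c in \<open>simp_all add: c'\<close>)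
  moreover have "e_top N1 (e_top N2 (e_top N1 (e_top N2 w))) = highest_word lam"
    unfolding w_def str2_row_pair(2)[OF cond] by (simp add: highest_word_eq n_def m_def)
  then have "w \<in> crystal lam"
    by (metis crystal.intros(1) crystal_e_top_iff dom)
  ultimately show ?thesis by blast
qed

lemma wt_highest_word: "dominant lam \<Longrightarrow> wt (highest_word lam) = lam"
  by (cases lam) (simp add: highest_word_def zscale_def dominant_def)

lemma wt_e_top: "wt (e_top i w) = wt w + int (tensor_eps i w) *\<^sub>Z simple_root i"
  using wt_e_pow[OF e_top_eq] .

lemma wt_crystal:
  assumes "w \<in> crystal lam" "str2 w = (a, b, c, d)"
  shows "wt w = lam - (int b + int d) *\<^sub>Z (2, -1) - (int a + int c) *\<^sub>Z (-2, 2)"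
proof -
  have "wt (highest_word lam) = wt w + int a *\<^sub>Z simple_root N2 + int b *\<^sub>Z simple_root N1
      + int c *\<^sub>Z simple_root N2 + int d *\<^sub>Z simple_root N1"
    using assms(2) unfolding e_top_crystal[OF assms(1), symmetric] wt_e_top str2_eq by simp
  then show ?thesis
    using wt_highest_word[OF crystal_dominant[OF assms(1)]]
    by (simp add: zscale_def prod_eq_iff algebra_simps)
qed

text \<open>Singles out the strings in the image of $\Phi$, see \<open>Phi_image_iff\<close>.\<close>

definition inner_string :: "weight \<Rightarrow> nat \<times> nat \<times> nat \<times> nat \<Rightarrow> bool" where
  "inner_string lam s = (case s of (a, b, c, d) \<Rightarrow>
     0 < d \<and> int d < fst lam \<and> int b < fst lam + 2 * int c - 2 * int d)"

lemma inner_string_row_pair: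
  assumes "row_cond n m x1 x2 x3 x4 y2 y3 y4" "lam = (int n - int m, int m)"
  shows "inner_string lam (str2 (row_pair x1 x2 x3 x4 y2 y3 y4)) \<longleftrightarrow>
     0 < x4 \<and> x4 + m < n \<and> y2 + y3 < x1 + 2 * min y3 x2"
proof -
  have "n = x1 + x2 + x3 + x4" "m = y2 + y3 + y4" using assms(1) by (auto simp: row_cond_def)
  then show ?thesis unfolding str2_row_pair(1)[OF assms(1)] inner_string_def assms(2) prod.case fst_conv
    by (intro conj_cong) (linarith+, (cases "y3 \<le> x2"; simp add: min_def; linarith))
qed

text \<open>The x4 letters 1bar at the left end all count for \<epsilon>_1, and the other two
  inequalities leave a letter on which f_1 acts. With \<open>inner_string_cr_f\<close> it follows
  that the elements in the image of \<Phi> form, in each 1-string, either nothing or everything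
  except the two ends.\<close>

lemma inner_string_eps_phi:
  assumes "w \<in> crystal lam" "inner_string lam (str2 w)"
  shows "0 < tensor_eps N1 w" "0 < tensor_phi N1 w"
proof -
  obtain n m x1 x2 x3 x4 y2 y3 y4 where *: "w = row_pair x1 x2 x3 x4 y2 y3 y4"
    "row_cond n m x1 x2 x3 x4 y2 y3 y4" "lam = (int n - int m, int m)" "m \<le> n"
    using assms(1) by (rule crystalE)
  have i: "0 < x4 \<and> x4 + m < n \<and> y2 + y3 < x1 + 2 * min y3 x2"
    using assms(2) unfolding *(1) inner_string_row_pair[OF *(2,3)] .
  show "0 < tensor_eps N1 w" using i by (simp add: *(1) tensor_eps_row_pair)
  have "cr_f N1 w \<noteq> None"
    using i *(2) unfolding *(1) cr_f_row_pair row_cond_def by auto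
  then show "0 < tensor_phi N1 w" by (simp only: cr_f_eq_None_iff neq0_conv)
qed

text \<open>The cases A, B, C are the positions where f_1 can act. The two positivity hypotheses
  place both elements strictly inside their 1-string; in each case they settle the boundary values
  of the inequalities from \<open>inner_string_row_pair\<close>.\<close>

lemma inner_string_cr_f:
  assumes "w \<in> crystal lam" "cr_f N1 w = Some u" "0 < tensor_eps N1 w" "0 < tensor_phi N1 u"
  shows "inner_string lam (str2 u) \<longleftrightarrow> inner_string lam (str2 w)"
proof -
  obtain n m x1 x2 x3 x4 y2 y3 y4 where *: "w = row_pair x1 x2 x3 x4 y2 y3 y4"
    "row_cond n m x1 x2 x3 x4 y2 y3 y4" "lam = (int n - int m, int m)" "m \<le> n"
    using assms(1) by (rule crystalE)
  have u: "cr_f N1 u \<noteq> None" using assms(4) by (simp only: cr_f_eq_None_iff neq0_conv)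
  have e: "0 < x4 + (x2 + (y4 + (y2 - y3) - x1) - x3)"
    using assms(3) by (simp add: *(1) tensor_eps_row_pair)
  note i = inner_string_row_pair[OF _ *(3)] and c = *(2)
  from assms(2) consider
    (A) "x2 + (y4 + (y2 - y3) - x1) < x3" "u = row_pair x1 x2 (x3 - 1) (Suc x4) y2 y3 y4"
  | (B) "x3 \<le> x2 + (y4 + (y2 - y3) - x1)" "y4 + (y2 - y3) < x1"
      "u = row_pair (x1 - 1) (Suc x2) x3 x4 y2 y3 y4"
  | (C) "x3 \<le> x2 + (y4 + (y2 - y3) - x1)" "x1 \<le> y4 + (y2 - y3)" "y2 < y3"
      "u = row_pair x1 x2 x3 x4 y2 (y3 - 1) (Suc y4)"
    by (auto simp: *(1) cr_f_row_pair split: if_splits)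
  then show ?thesis
  proof cases
    case A
    have c': "row_cond n m x1 x2 (x3 - 1) (Suc x4) y2 y3 y4"
      using A(1) c unfolding row_cond_def by (elim conjE, intro conjI) linarith+
    have x4: "0 < x4" using e A(1) by linarith
    have x3: "x2 < x3" "x1 = 0 \<Longrightarrow> x2 + y4 < x3" using A(1) by linarith+
    have "Suc x4 + m < n" if "y2 + y3 < x1 + 2 * min y3 x2"
    proof (cases "x1 = 0")
      case True
      then show ?thesis using that x3(2) c by (cases "y3 \<le> x2") (simp_all add: row_cond_def)
    next
      case False
      then show ?thesis using that x3(1) c by (cases "y3 \<le> x2") (simp_all add: row_cond_def)
    qed
    then show ?thesis using x4 unfolding A(2) *(1) i[OF c'] i[OF c] by auto
  next
    case B
    then obtain z where z: "x1 = Suc z" by (cases x1) auto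
    have y4: "y4 = 0" using z c by (simp add: row_cond_def)
    have x3: "x3 \<le> x2" using B(1,2) by linarith
    have y2: "y2 < x1 + y3" using B(2) by linarith
    have c': "row_cond n m (x1 - 1) (Suc x2) x3 x4 y2 y3 y4"
      using y2 c y4 z by (simp add: row_cond_def)
    have "\<not> Suc x2 < x3" using x3 by simp
    then have "y2 < y3 \<or> y2 - y3 < z"
      using u unfolding B(3) cr_f_row_pair y4 z using x3 by (auto split: if_splits)
    then have y2': "y2 < z + y3 \<or> y2 < y3" by linarith
    have "y2 + y3 < z + 2 * min y3 (Suc x2) \<longleftrightarrow> y2 + y3 < Suc z + 2 * min y3 x2" if "x4 + m < n"
    proof (cases "y3 \<le> x2")
      case True
      then show ?thesis using y2 y2' z by (simp add: min_def) linarith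
    next
      case False
      then show ?thesis using that c y4 z x3 by (simp add: min_def row_cond_def)
    qed
    then show ?thesis unfolding B(3) *(1) i[OF c'] i[OF c] using z by auto
  next
    case C
    then obtain z where z: "y3 = Suc z" by (cases y3) auto
    have y4: "x1 \<le> y4" using C(2,3) by linarith
    have x1: "x1 = 0" using y4 c by (auto simp: row_cond_def)
    have x3: "x3 \<le> x2 + y4" using C(1,3) by linarith
    have c': "row_cond n m x1 x2 x3 x4 y2 (y3 - 1) (Suc y4)"
      using C(3) c x1 z by (simp add: row_cond_def)
    have y2: "y2 < z"
      using u C(3) x3 unfolding C(4) cr_f_row_pair x1 z by (auto split: if_splits)
    have "y2 + z < 2 * min z x2 \<longleftrightarrow> y2 + y3 < 2 * min y3 x2" if "x4 + m < n"
    proof (cases "y3 \<le> x2")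
      case True
      then show ?thesis using y2 z by (simp add: min_def)
    next
      case False
      then show ?thesis using that c x1 z x3 by (simp add: min_def row_cond_def)
    qed
    then show ?thesis unfolding C(4) *(1) i[OF c'] i[OF c] using z x1 by auto
  qed
qed

text \<open>The element just below the top \<open>w\<close> serves as common reference point, so any
  two positions inside a 1-string can be compared.\<close>

lemma inner_string_f_pow:
  assumes "w \<in> crystal lam" "tensor_eps N1 w = 0" "f_pow N1 (Suc k) w = Some u" "0 < tensor_phi N1 u"
  shows "inner_string lam (str2 u) \<longleftrightarrow> inner_string lam (str2 (the (cr_f N1 w)))"
  using assms(3,4)
proof (induction k arbitrary: u)
  case 0
  then show ?case by (simp add: f_pow_Suc)
next
  case (Suc k)
  then obtain v where v: "f_pow N1 (Suc k) w = Some v" "cr_f N1 v = Some u"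
    by (auto simp: f_pow_Suc[of N1 "Suc k"] bind_eq_Some_conv)
  have "0 < tensor_eps N1 v"
    using tensor_eps_e_pow[OF f_pow_imp_e_pow[OF v(1)]] assms(2) by simp
  then have "inner_string lam (str2 u) \<longleftrightarrow> inner_string lam (str2 v)"
    using inner_string_cr_f[OF crystal_f_pow[OF assms(1) v(1)] v(2)] Suc(3) by blast
  also have "\<dots> \<longleftrightarrow> inner_string lam (str2 (the (cr_f N1 w)))"
    using Suc.IH[OF v(1)] tensor_phi_cr_f[OF v(2)] by simp
  finally show ?case .
qed

text \<open>The property fails at the ends of a 1-string and is constant inside, hence survives
  reversal; one implication suffices because \<open>s1\<close> is an involution. This is why
  \<open>s1\<close>, and with it \<open>Psibar\<close>, acts on preatoms.\<close>

lemma inner_string_s1: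
  assumes "w \<in> crystal lam"
  shows "inner_string lam (str2 (s1 w)) \<longleftrightarrow> inner_string lam (str2 w)"
proof -
  have "inner_string lam (str2 (s1 w))" if w: "w \<in> crystal lam" and i: "inner_string lam (str2 w)" for w
  proof -
    obtain j k where jk: "tensor_eps N1 w = Suc j" "tensor_phi N1 w = Suc k"
      using inner_string_eps_phi[OF w i] by (metis gr0_implies_Suc)
    have h: "e_top N1 w \<in> crystal lam" using w by (simp add: crystal_e_top_iff)
    show ?thesis
      using inner_string_f_pow[OF h tensor_eps_e_top, of j w] f_pow_e_top[of N1 w]
        inner_string_f_pow[OF h tensor_eps_e_top, of k "s1 w"] f_pow_s1[of w] i jk
      by (simp add: tensor_phi_s1 del: tensor_phi.simps)
  qed
  from this[OF assms] this[OF s1_crystal[OF assms]] show ?thesis by auto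
qed

subsection \<open>The dominance order as a lattice octagon\<close>

text \<open>In the orthonormal basis u, v with \<varpi>_1 = u and \<varpi>_2 = u + v, a weight has
  the coordinates \<open>fst + snd\<close> and \<open>snd\<close>, and W consists of the signed
  permutations, whence the symmetric form. The roots \<open>A2\<close> and \<open>A12\<close> are 2v
  and 2u (axis directions), \<open>A1\<close> and \<open>A21\<close> are u - v and u + v
  (diagonals).\<close>

definition octagon :: "weight \<Rightarrow> weight \<Rightarrow> bool" where
  "octagon lam \<mu> \<longleftrightarrow> \<bar>fst \<mu> + snd \<mu>\<bar> \<le> fst lam + snd lam \<and> \<bar>snd \<mu>\<bar> \<le> fst lam + snd lam \<and>
     \<bar>fst \<mu> + snd \<mu>\<bar> + \<bar>snd \<mu>\<bar> \<le> fst lam + 2 * snd lam"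

definition real_octagon :: "weight \<Rightarrow> (real \<times> real) set" where
  "real_octagon lam = {(p, q). \<bar>p + q\<bar> \<le> of_int (fst lam + snd lam) \<and> \<bar>q\<bar> \<le> of_int (fst lam + snd lam) \<and>
     \<bar>p + q\<bar> + \<bar>q\<bar> \<le> of_int (fst lam + 2 * snd lam)}"

lemma abs_convex_comb:
  fixes x y u v :: real
  assumes "0 \<le> u" "0 \<le> v"
  shows "\<bar>u * x + v * y\<bar> \<le> u * \<bar>x\<bar> + v * \<bar>y\<bar>"
  using abs_triangle_ineq[of "u * x" "v * y"] assms by (simp add: abs_mult)

lemma convex_real_octagon: "convex (real_octagon lam)"
proof (rule convexI)
  fix x y :: "real \<times> real" and u v :: real
  assume *: "x \<in> real_octagon lam" "y \<in> real_octagon lam" "0 \<le> u" "0 \<le> v" "u + v = 1"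
  obtain p q r s where xy: "x = (p, q)" "y = (r, s)" by (cases x, cases y)
  have m: "u * a + v * b \<le> c" if "a \<le> c" "b \<le> c" for a b c :: real
    using convex_bound_le[OF that *(3-5)] .
  have 1: "\<bar>u * (p + q) + v * (r + s)\<bar> \<le> u * \<bar>p + q\<bar> + v * \<bar>r + s\<bar>"
    and 2: "\<bar>u * q + v * s\<bar> \<le> u * \<bar>q\<bar> + v * \<bar>s\<bar>"
    using *(3,4) by (auto intro: abs_convex_comb)
  have e: "u * p + v * r + (u * q + v * s) = u * (p + q) + v * (r + s)" by (simp add: algebra_simps)
  have f: "u * \<bar>p + q\<bar> + v * \<bar>r + s\<bar> + (u * \<bar>q\<bar> + v * \<bar>s\<bar>) = u * (\<bar>p + q\<bar> + \<bar>q\<bar>) + v * (\<bar>r + s\<bar> + \<bar>s\<bar>)"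
    by (simp add: algebra_simps)
  from *(1,2) have 3: "u * \<bar>p + q\<bar> + v * \<bar>r + s\<bar> \<le> of_int (fst lam + snd lam)"
    "u * \<bar>q\<bar> + v * \<bar>s\<bar> \<le> of_int (fst lam + snd lam)"
    "u * (\<bar>p + q\<bar> + \<bar>q\<bar>) + v * (\<bar>r + s\<bar> + \<bar>s\<bar>) \<le> of_int (fst lam + 2 * snd lam)"
    by (auto intro!: m simp: xy real_octagon_def)
  have "\<bar>u * (p + q) + v * (r + s)\<bar> \<le> of_int (fst lam + snd lam)"
    "\<bar>u * q + v * s\<bar> \<le> of_int (fst lam + snd lam)"
    "\<bar>u * (p + q) + v * (r + s)\<bar> + \<bar>u * q + v * s\<bar> \<le> of_int (fst lam + 2 * snd lam)"
    using 1 2 3 f by linarith+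
  then show "u *\<^sub>R x + v *\<^sub>R y \<in> real_octagon lam"
    unfolding xy real_octagon_def by (simp add: e)
qed

lemma weyl_orbit_octagon:
  assumes "dominant lam" "\<mu> \<in> weyl_orbit lam"
  shows "octagon lam \<mu>"
  using assms(2)
proof induction
  case 1
  then show ?case using assms(1) by (auto simp: octagon_def dominant_def)
next
  case (2 \<mu>)
  then show ?case by (cases \<mu> rule: prod.exhaust) (auto simp: octagon_def)
next
  case (3 \<mu>)
  then show ?case by (cases \<mu> rule: prod.exhaust) (auto simp: octagon_def)
qed

lemma to_plane_octagon: "to_plane \<mu> \<in> real_octagon lam \<longleftrightarrow> octagon lam \<mu>"
proof (cases \<mu>)
  case (Pair x y)
  have "\<bar>real_of_int x + real_of_int y\<bar> = real_of_int \<bar>x + y\<bar>" "\<bar>real_of_int y\<bar> = real_of_int \<bar>y\<bar>" by auto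
  then show ?thesis unfolding Pair real_octagon_def octagon_def
    by (auto simp del: of_int_add of_int_abs of_int_mult simp flip: of_int_add of_int_mult)
qed

lemma convex_horizontal:
  fixes H :: "(real \<times> real) set"
  assumes "convex H" "(p, r) \<in> H" "(q, r) \<in> H" "p \<le> s" "s \<le> q"
  shows "(s, r) \<in> H"
proof -
  have "s \<in> closed_segment p q" using assms(4,5) by (simp add: closed_segment_eq_real_ivl)
  then obtain u where u: "0 \<le> u" "u \<le> 1" "s = (1 - u) * p + u * q"
    by (auto simp: closed_segment_def)
  have "(1 - u) *\<^sub>R (p, r) + u *\<^sub>R (q, r) = (s, r)" using u(3) by (simp add: algebra_simps)
  then show ?thesis using convexD_alt[OF assms(1-3) u(1,2)] by simp
qed

text \<open>The second coordinate serves as parameter because the sides that bound a horizontal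
  slice of the octagon have the form p = c q + e with c equal to -1, -2 or 0.\<close>

lemma convex_slanted:
  fixes H :: "(real \<times> real) set"
  assumes "convex H" "(c * r + e, r) \<in> H" "(c * s + e, s) \<in> H" "r \<le> t" "t \<le> s"
  shows "(c * t + e, t) \<in> H"
proof -
  have "t \<in> closed_segment r s" using assms(4,5) by (simp add: closed_segment_eq_real_ivl)
  then obtain u where u: "0 \<le> u" "u \<le> 1" "t = (1 - u) * r + u * s"
    by (auto simp: closed_segment_def)
  have "(1 - u) *\<^sub>R (c * r + e, r) + u *\<^sub>R (c * s + e, s) = (c * t + e, t)"
    unfolding u(3) by (simp add: algebra_simps)
  then show ?thesis using convexD_alt[OF assms(1-3) u(1,2)] by simp
qed

lemma weyl_orbit_points:
  fixes l1 l2 :: int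
  shows "(l1, l2) \<in> weyl_orbit (l1, l2)" "(- l1, l1 + l2) \<in> weyl_orbit (l1, l2)"
    "(l1 + 2 * l2, - l2) \<in> weyl_orbit (l1, l2)" "(- l1 - 2 * l2, l1 + l2) \<in> weyl_orbit (l1, l2)"
    "(l1 + 2 * l2, - l1 - l2) \<in> weyl_orbit (l1, l2)" "(- l1 - 2 * l2, l2) \<in> weyl_orbit (l1, l2)"
    "(l1, - l1 - l2) \<in> weyl_orbit (l1, l2)" "(- l1, - l2) \<in> weyl_orbit (l1, l2)"
proof -
  note i = weyl_orbit.intros(2,3)[of _ "(l1, l2)"]
  show 1: "(l1, l2) \<in> weyl_orbit (l1, l2)" by (rule weyl_orbit.intros)
  show 2: "(- l1, l1 + l2) \<in> weyl_orbit (l1, l2)" using i(1)[OF 1] by (simp add: algebra_simps)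
  show 3: "(l1 + 2 * l2, - l2) \<in> weyl_orbit (l1, l2)" using i(2)[OF 1] by (simp add: algebra_simps)
  show 4: "(- l1 - 2 * l2, l1 + l2) \<in> weyl_orbit (l1, l2)" using i(1)[OF 3] by (simp add: algebra_simps)
  show 5: "(l1 + 2 * l2, - l1 - l2) \<in> weyl_orbit (l1, l2)" using i(2)[OF 2] by (simp add: algebra_simps)
  show 6: "(- l1 - 2 * l2, l2) \<in> weyl_orbit (l1, l2)" using i(1)[OF 5] by (simp add: algebra_simps)
  show 7: "(l1, - l1 - l2) \<in> weyl_orbit (l1, l2)" using i(2)[OF 4] by (simp add: algebra_simps)
  show 8: "(- l1, - l2) \<in> weyl_orbit (l1, l2)" using i(1)[OF 7] by (simp add: algebra_simps)
qed

text \<open>The horizontal line through \<mu> meets the boundary in two sides of the octagon, and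
  each side is a segment between two orbit points, hence inside the hull. Which sides are met
  changes at the heights -b and b.\<close>

lemma octagon_hull:
  assumes "dominant lam" "octagon lam \<mu>"
  shows "to_plane \<mu> \<in> convex hull (to_plane ` weyl_orbit lam)"
proof -
  obtain l1 l2 x y where lm: "lam = (l1, l2)" "\<mu> = (x, y)" by (cases lam, cases \<mu>)
  define H where "H = convex hull (to_plane ` weyl_orbit lam)"
  define a b r s where ab: "a = real_of_int l1" "b = real_of_int l2" "r = real_of_int x" "s = real_of_int y"
  have pos: "0 \<le> a" "0 \<le> b" using assms(1) by (auto simp: dominant_def lm ab)
  have o: "\<bar>r + s\<bar> \<le> a + b" "\<bar>s\<bar> \<le> a + b" "\<bar>r + s\<bar> + \<bar>s\<bar> \<le> a + 2 * b"
    using assms(2) unfolding to_plane_octagon[symmetric] by (simp_all add: real_octagon_def lm ab)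
  have H: "convex H" by (simp add: H_def)
  have sub: "to_plane v \<in> H" if "v \<in> weyl_orbit (l1, l2)" for v
    unfolding H_def lm by (rule hull_inc) (use that in blast)
  note pts = weyl_orbit_points[of l1 l2, THEN sub, simplified, folded ab]
  have "(r, s) \<in> H"
  proof -
    consider "- b \<le> s" "s \<le> b" | "b \<le> s" | "s \<le> - b" by linarith
    then show ?thesis
    proof cases
      case 1
      have h: "((- 1) * s + (a + b), s) \<in> H" "((- 1) * s + (- a - b), s) \<in> H"
        using convex_slanted[OF H, of "- 1" "- b" "a + b" b s]
          convex_slanted[OF H, of "- 1" "- b" "- a - b" b s] pts 1 by (simp_all add: algebra_simps)
      show ?thesis by (rule convex_horizontal[OF H h(2,1)]) (use o in linarith)+
    next
      case 2
      have h: "((- 2) * s + (a + 2 * b), s) \<in> H" "(0 * s + (- a - 2 * b), s) \<in> H"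
        using convex_slanted[OF H, of "- 2" b "a + 2 * b" "a + b" s]
          convex_slanted[OF H, of 0 b "- a - 2 * b" "a + b" s] pts 2 o by (simp_all add: algebra_simps)
      show ?thesis by (rule convex_horizontal[OF H h(2,1)]) (use o 2 pos in linarith)+
    next
      case 3
      have h: "(0 * s + (a + 2 * b), s) \<in> H" "((- 2) * s + (- a - 2 * b), s) \<in> H"
        using convex_slanted[OF H, of "- 2" "- a - b" "- a - 2 * b" "- b" s]
          convex_slanted[OF H, of 0 "- a - b" "a + 2 * b" "- b" s] pts 3 o by (simp_all add: algebra_simps)
      show ?thesis by (rule convex_horizontal[OF H h(2,1)]) (use o 3 pos in linarith)+
    qed
  qed
  then show ?thesis by (simp add: H_def lm ab)
qed

lemma root_lattice_iff: "\<mu> \<in> root_lattice \<longleftrightarrow> even (fst \<mu>)"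
proof
  assume "even (fst \<mu>)"
  then obtain k where k: "fst \<mu> = 2 * k" by blast
  have "\<mu> = (2 * k + snd \<mu>) *\<^sub>Z pos_root A1 + (k + snd \<mu>) *\<^sub>Z pos_root A2"
    using k by (simp add: zscale_def prod_eq_iff)
  then show "\<mu> \<in> root_lattice" unfolding root_lattice_def by blast
qed (auto simp: root_lattice_def zscale_def)

lemma weight_le_iff:
  "\<mu> \<preceq> lam \<longleftrightarrow> dominant lam \<and> octagon lam \<mu> \<and> even (fst \<mu> - fst lam)"
proof -
  have "convex hull (to_plane ` weyl_orbit lam) \<subseteq> real_octagon lam" if "dominant lam"
    by (rule hull_minimal)
      (use weyl_orbit_octagon[OF that] in \<open>simp_all add: convex_real_octagon image_subset_iff to_plane_octagon\<close>)
  then have "to_plane \<mu> \<in> convex hull (to_plane ` weyl_orbit lam) \<longleftrightarrow> octagon lam \<mu>" if "dominant lam"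
    using octagon_hull[OF that, of \<mu>] to_plane_octagon[of \<mu> lam] that by blast
  then show ?thesis unfolding weight_le_def root_lattice_iff fst_diff by blast
qed

subsection \<open>Labels\<close>

text \<open>The largest M for which M\<delta> - \<beta>^\<vee> is among \<gamma>_1..\<gamma>_m, and
  0 if there is none, as always for \<open>A1\<close>. The two families with indices 4M-3 and 4M-1
  merge into one: the label K\<delta> - \<alpha>_21^\<vee> has index 2K-1.\<close>

fun level_bound :: "nat \<Rightarrow> posroot \<Rightarrow> int" where
  "level_bound m A1 = 0"
| "level_bound m A2 = int (m div 4)"
| "level_bound m A12 = int ((m + 2) div 4)"
| "level_bound m A21 = int ((m + 1) div 2)"

fun gamma_index :: "posroot \<Rightarrow> int \<Rightarrow> nat" where
  "gamma_index A1 M = 0"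
| "gamma_index A2 M = nat (4 * M)"
| "gamma_index A12 M = nat (4 * M - 2)"
| "gamma_index A21 M = nat (2 * M - 1)"

lemma level_bound_nonneg: "0 \<le> level_bound m \<beta>"
  by (cases \<beta>) auto

lemma gamma_root_neq_A1 [simp]: "gamma_root m \<noteq> A1"
  by (simp add: gamma_root_def)

lemma gamma_root_level:
  assumes "1 \<le> m"
  shows "1 \<le> gamma_level m" "gamma_index (gamma_root m) (gamma_level m) = m"
    "gamma_level m = level_bound m (gamma_root m)"
proof -
  have mm: "m mod 4 = 0 \<or> m mod 4 = 1 \<or> m mod 4 = 2 \<or> m mod 4 = 3" by presburger
  have "1 \<le> gamma_level m \<and> gamma_index (gamma_root m) (gamma_level m) = m \<and>
    gamma_level m = level_bound m (gamma_root m)"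
    using mm
  proof (elim disjE)
    assume r: "m mod 4 = 0"
    have g: "gamma_root m = A2" "gamma_level m = int ((m + 3) div 4)"
      unfolding gamma_root_def gamma_level_def Let_def r by simp_all
    obtain q where m: "m = 4 * q + 0" using r by (metis div_mult_mod_eq mult.commute)
    have d: "4 * int ((m + 3) div 4) = int m" "1 \<le> int ((m + 3) div 4)" "int ((m + 3) div 4) = int (m div 4)"
      using assms unfolding m by presburger+
    have "4 * int ((m + 3) div 4) = int m" using d(1) by arith
    then have "gamma_index (gamma_root m) (gamma_level m) = m" unfolding g gamma_index.simps by (simp only: nat_int)
    moreover have "1 \<le> gamma_level m" "gamma_level m = level_bound m (gamma_root m)"
      unfolding g level_bound.simps using d by linarith+
    ultimately show ?thesis by blast
  next
    assume r: "m mod 4 = 1"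
    have g: "gamma_root m = A21" "gamma_level m = 2 * int ((m + 3) div 4) - 1"
      unfolding gamma_root_def gamma_level_def Let_def r by simp_all
    obtain q where m: "m = 4 * q + 1" using r by (metis div_mult_mod_eq mult.commute)
    have d: "4 * int ((m + 3) div 4) = int m + 3" "1 \<le> int ((m + 3) div 4)" "2 * int ((m + 3) div 4) = int ((m + 1) div 2) + 1"
      unfolding m by presburger+
    have "2 * (2 * int ((m + 3) div 4) - 1) - 1 = int m" using d(1) by arith
    then have "gamma_index (gamma_root m) (gamma_level m) = m" unfolding g gamma_index.simps by (simp only: nat_int)
    moreover have "1 \<le> gamma_level m" "gamma_level m = level_bound m (gamma_root m)"
      unfolding g level_bound.simps using d by linarith+
    ultimately show ?thesis by blast
  next
    assume r: "m mod 4 = 2"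
    have g: "gamma_root m = A12" "gamma_level m = int ((m + 3) div 4)"
      unfolding gamma_root_def gamma_level_def Let_def r by simp_all
    obtain q where m: "m = 4 * q + 2" using r by (metis div_mult_mod_eq mult.commute)
    have d: "4 * int ((m + 3) div 4) = int m + 2" "1 \<le> int ((m + 3) div 4)" "int ((m + 3) div 4) = int ((m + 2) div 4)"
      unfolding m by presburger+
    have "4 * int ((m + 3) div 4) - 2 = int m" using d(1) by arith
    then have "gamma_index (gamma_root m) (gamma_level m) = m" unfolding g gamma_index.simps by (simp only: nat_int)
    moreover have "1 \<le> gamma_level m" "gamma_level m = level_bound m (gamma_root m)"
      unfolding g level_bound.simps using d by linarith+
    ultimately show ?thesis by blast
  next
    assume r: "m mod 4 = 3"
    have g: "gamma_root m = A21" "gamma_level m = 2 * int ((m + 3) div 4)"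
      unfolding gamma_root_def gamma_level_def Let_def r by simp_all
    obtain q where m: "m = 4 * q + 3" using r by (metis div_mult_mod_eq mult.commute)
    have d: "4 * int ((m + 3) div 4) = int m + 1" "1 \<le> int ((m + 3) div 4)" "2 * int ((m + 3) div 4) = int ((m + 1) div 2)"
      unfolding m by presburger+
    have "2 * (2 * int ((m + 3) div 4)) - 1 = int m" using d(1) by arith
    then have "gamma_index (gamma_root m) (gamma_level m) = m" unfolding g gamma_index.simps by (simp only: nat_int)
    moreover have "1 \<le> gamma_level m" "gamma_level m = level_bound m (gamma_root m)"
      unfolding g level_bound.simps using d by linarith+
    ultimately show ?thesis by blast
  qed
  then show "1 \<le> gamma_level m" "gamma_index (gamma_root m) (gamma_level m) = m"
    "gamma_level m = level_bound m (gamma_root m)" by auto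
qed

lemma gamma_index:
  assumes "\<beta> \<noteq> A1" "1 \<le> M"
  shows "1 \<le> gamma_index \<beta> M" "gamma_root (gamma_index \<beta> M) = \<beta>" "gamma_level (gamma_index \<beta> M) = M"
    "gamma_index \<beta> M \<le> m \<longleftrightarrow> M \<le> level_bound m \<beta>"
proof -
  define j where "j = nat (M - 1)"
  have j: "M = int j + 1" using assms(2) by (simp add: j_def)
  have "1 \<le> gamma_index \<beta> M \<and> gamma_root (gamma_index \<beta> M) = \<beta> \<and> gamma_level (gamma_index \<beta> M) = M \<and>
    (gamma_index \<beta> M \<le> m \<longleftrightarrow> M \<le> level_bound m \<beta>)"
  proof (cases \<beta>)
    case A1
    then show ?thesis using assms by simp
  next
    case A2
    have "gamma_index \<beta> M = 4 * j + 4" using A2 j by simp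
    moreover have "4 * j + 4 \<le> m \<longleftrightarrow> int j + 1 \<le> int (m div 4)" by presburger
    ultimately show ?thesis using A2 j by (simp add: gamma_root_def gamma_level_def)
  next
    case A12
    have "gamma_index \<beta> M = 4 * j + 2" using A12 j by simp
    moreover have "4 * j + 2 \<le> m \<longleftrightarrow> int j + 1 \<le> int ((m + 2) div 4)"
      "(4 * j + 2) mod 4 = 2" "(4 * j + 5) div 4 = j + 1" by presburger+
    ultimately show ?thesis using A12 j by (simp add: gamma_root_def gamma_level_def Let_def add.commute)
  next
    case A21
    have i: "gamma_index \<beta> M = 2 * j + 1" using A21 j by simp
    have le: "2 * j + 1 \<le> m \<longleftrightarrow> int j + 1 \<le> int ((m + 1) div 2)" by presburger
    have "(2 * j + 1) mod 4 \<noteq> 0" "(2 * j + 1) mod 4 \<noteq> 2" by presburger+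
    then have "gamma_root (2 * j + 1) = A21" by (simp only: gamma_root_def if_False)
    moreover have "gamma_level (2 * j + 1) = int j + 1"
      unfolding gamma_level_def Let_def by presburger
    ultimately show ?thesis using A21 j i le by simp
  qed
  then show "1 \<le> gamma_index \<beta> M" "gamma_root (gamma_index \<beta> M) = \<beta>" "gamma_level (gamma_index \<beta> M) = M"
    "gamma_index \<beta> M \<le> m \<longleftrightarrow> M \<le> level_bound m \<beta>" by auto
qed

lemma coroot_inj: "coroot \<beta> = coroot \<beta>' \<Longrightarrow> \<beta> = \<beta>'"
  by (cases \<beta>; cases \<beta>') auto

lemma coroot_neq_minus: "coroot \<beta> \<noteq> - coroot \<beta>'"
  by (cases \<beta>; cases \<beta>') auto

lemma gamma_eq_iff:
  assumes "1 \<le> i"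
  shows "gamma i = (- coroot \<beta>, M) \<longleftrightarrow> \<beta> \<noteq> A1 \<and> 1 \<le> M \<and> i = gamma_index \<beta> M"
proof
  assume "gamma i = (- coroot \<beta>, M)"
  then have "gamma_root i = \<beta>" "gamma_level i = M" by (auto simp: gamma_def dest: coroot_inj)
  then show "\<beta> \<noteq> A1 \<and> 1 \<le> M \<and> i = gamma_index \<beta> M"
    using gamma_root_level[OF assms] gamma_root_neq_A1 by metis
next
  assume "\<beta> \<noteq> A1 \<and> 1 \<le> M \<and> i = gamma_index \<beta> M"
  then show "gamma i = (- coroot \<beta>, M)" by (simp add: gamma_def gamma_index)
qed

lemma gamma_image_iff:
  "(- coroot \<beta>, M) \<in> gamma ` {1..m} \<longleftrightarrow> 1 \<le> M \<and> M \<le> level_bound m \<beta>"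
proof
  assume "(- coroot \<beta>, M) \<in> gamma ` {1..m}"
  then obtain i where i: "1 \<le> i" "i \<le> m" "gamma i = (- coroot \<beta>, M)" by force
  then show "1 \<le> M \<and> M \<le> level_bound m \<beta>" using gamma_eq_iff[OF i(1)] gamma_index(4) by metis
next
  assume M: "1 \<le> M \<and> M \<le> level_bound m \<beta>"
  then have b: "\<beta> \<noteq> A1" by (cases \<beta>) auto
  have "gamma (gamma_index \<beta> M) = (- coroot \<beta>, M)" using gamma_eq_iff gamma_index(1) b M by blast
  then show "(- coroot \<beta>, M) \<in> gamma ` {1..m}"
    using gamma_index(1)[OF b] gamma_index(4)[OF b, of M m] M by (metis atLeastAtMost_iff image_eqI)
qed

lemma coroot_notin_gamma: "(coroot \<beta>, j) \<notin> gamma ` {1..m}"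
  by (auto simp: gamma_def coroot_neq_minus)

subsection \<open>Edges at a vertex\<close>

text \<open>The argument j will be \<langle>\<mu>, \<beta>^\<vee>\<rangle> - k, the value of
  \<beta>^\<vee> at the midpoint of the edge between \<mu> and \<mu> - k\<beta>. Computed from
  either end it is the same.\<close>

definition edge_label :: "posroot \<Rightarrow> int \<Rightarrow> aff_coroot" where
  "edge_label \<beta> j = (if j < 0 then (- coroot \<beta>, - j) else (coroot \<beta>, j))"

lemma edge_label_gamma_iff: "edge_label \<beta> j \<in> gamma ` {1..m} \<longleftrightarrow> j < 0 \<and> - level_bound m \<beta> \<le> j"
proof (cases "j < 0")
  case True
  then show ?thesis unfolding edge_label_def if_P[OF True] gamma_image_iff by auto
next
  case False
  then show ?thesis unfolding edge_label_def if_not_P[OF False] by (simp only: coroot_notin_gamma simp_thms)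
qed

lemma pairing_diff: "pairing (\<mu> - k *\<^sub>Z pos_root \<beta>) (coroot \<beta>) = pairing \<mu> (coroot \<beta>) - 2 * k"
  by (cases \<beta>) (auto simp: pairing_def zscale_def algebra_simps)

lemma bruhat_in_iff:
  assumes "\<mu> \<preceq> lam"
  shows "(x, \<mu>, l) \<in> bruhat_edges lam \<longleftrightarrow> (\<exists>\<beta> k. k \<noteq> 0 \<and> x = \<mu> - k *\<^sub>Z pos_root \<beta> \<and> x \<preceq> lam \<and>
     l = edge_label \<beta> (pairing \<mu> (coroot \<beta>) - k) \<and> (0 < k \<longleftrightarrow> 0 \<le> pairing \<mu> (coroot \<beta>) - k))"
    (is "?L \<longleftrightarrow> ?R")
proof
  assume ?L
  then consider k \<beta> where "1 \<le> k" "x \<preceq> lam" "\<mu> = x - k *\<^sub>Z pos_root \<beta>" "pairing x (coroot \<beta>) - k < 0"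
      "l = (- coroot \<beta>, \<bar>pairing x (coroot \<beta>) - k\<bar>)"
    | k \<beta> where "1 \<le> k" "x = \<mu> - k *\<^sub>Z pos_root \<beta>" "x \<preceq> lam" "pairing \<mu> (coroot \<beta>) - k \<ge> 0"
      "l = (coroot \<beta>, pairing \<mu> (coroot \<beta>) - k)"
    unfolding bruhat_edges_def by blast
  then show ?R
  proof cases
    case 1
    have "x = \<mu> - (- k) *\<^sub>Z pos_root \<beta>" using 1(3) by (simp add: zscale_def prod_eq_iff)
    moreover have "pairing \<mu> (coroot \<beta>) = pairing x (coroot \<beta>) - 2 * k" unfolding 1(3) by (rule pairing_diff)
    ultimately show ?thesis using 1 by (intro exI[of _ \<beta>] exI[of _ "- k"]) (simp add: edge_label_def)
  next
    case 2
    then show ?thesis by (intro exI[of _ \<beta>] exI[of _ k]) (simp add: edge_label_def)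
  qed
next
  assume ?R
  then obtain \<beta> k where k: "k \<noteq> 0" "x = \<mu> - k *\<^sub>Z pos_root \<beta>" "x \<preceq> lam"
     "l = edge_label \<beta> (pairing \<mu> (coroot \<beta>) - k)" "0 < k \<longleftrightarrow> 0 \<le> pairing \<mu> (coroot \<beta>) - k" by blast
  show ?L
  proof (cases "0 < k")
    case True
    have "(\<mu> - k *\<^sub>Z pos_root \<beta>, \<mu>, (coroot \<beta>, pairing \<mu> (coroot \<beta>) - k)) \<in> bruhat_edges lam"
      unfolding bruhat_edges_def
      by (rule UnI2, rule CollectI, intro exI[of _ \<mu>] exI[of _ k] exI[of _ \<beta>]) (use k True assms in auto)
    then show ?thesis using k True by (simp add: edge_label_def)
  next
    case False
    have mu: "\<mu> = x - (- k) *\<^sub>Z pos_root \<beta>" using k(2) by (simp add: zscale_def prod_eq_iff)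
    have p: "pairing x (coroot \<beta>) = pairing \<mu> (coroot \<beta>) - 2 * k" unfolding k(2) by (rule pairing_diff)
    have "(x, x - (- k) *\<^sub>Z pos_root \<beta>, (- coroot \<beta>, \<bar>pairing x (coroot \<beta>) - (- k)\<bar>)) \<in> bruhat_edges lam"
      unfolding bruhat_edges_def
      by (rule UnI1, rule CollectI, intro exI[of _ x] exI[of _ "- k"] exI[of _ \<beta>]) (use k False assms mu p in auto)
    moreover have "l = (- coroot \<beta>, \<bar>pairing x (coroot \<beta>) - (- k)\<bar>)"
      using k(4,5) False p by (simp add: edge_label_def)
    ultimately show ?thesis using mu by metis
  qed
qed

lemma bruhat_out_iff:
  assumes "\<mu> \<preceq> lam"
  shows "(\<mu>, x, l) \<in> bruhat_edges lam \<longleftrightarrow> (\<exists>\<beta> k. k \<noteq> 0 \<and> x = \<mu> - k *\<^sub>Z pos_root \<beta> \<and> x \<preceq> lam \<and>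
     l = edge_label \<beta> (pairing \<mu> (coroot \<beta>) - k) \<and> (0 < k \<longleftrightarrow> pairing \<mu> (coroot \<beta>) - k < 0))"
    (is "?L \<longleftrightarrow> ?R")
proof
  assume ?L
  then consider k \<beta> where "1 \<le> k" "x \<preceq> lam" "x = \<mu> - k *\<^sub>Z pos_root \<beta>" "pairing \<mu> (coroot \<beta>) - k < 0"
      "l = (- coroot \<beta>, \<bar>pairing \<mu> (coroot \<beta>) - k\<bar>)"
    | k \<beta> where "1 \<le> k" "\<mu> = x - k *\<^sub>Z pos_root \<beta>" "x \<preceq> lam" "pairing x (coroot \<beta>) - k \<ge> 0"
      "l = (coroot \<beta>, pairing x (coroot \<beta>) - k)"
    unfolding bruhat_edges_def by blast
  then show ?R
  proof cases
    case 1
    then show ?thesis by (intro exI[of _ \<beta>] exI[of _ k]) (simp add: edge_label_def)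
  next
    case 2
    have "x = \<mu> - (- k) *\<^sub>Z pos_root \<beta>" using 2(2) by (simp add: zscale_def prod_eq_iff)
    moreover have "pairing \<mu> (coroot \<beta>) = pairing x (coroot \<beta>) - 2 * k" unfolding 2(2) by (rule pairing_diff)
    ultimately show ?thesis using 2 by (intro exI[of _ \<beta>] exI[of _ "- k"]) (simp add: edge_label_def)
  qed
next
  assume ?R
  then obtain \<beta> k where k: "k \<noteq> 0" "x = \<mu> - k *\<^sub>Z pos_root \<beta>" "x \<preceq> lam"
     "l = edge_label \<beta> (pairing \<mu> (coroot \<beta>) - k)" "0 < k \<longleftrightarrow> pairing \<mu> (coroot \<beta>) - k < 0" by blast
  show ?L
  proof (cases "0 < k")
    case True
    have "(\<mu>, \<mu> - k *\<^sub>Z pos_root \<beta>, (- coroot \<beta>, \<bar>pairing \<mu> (coroot \<beta>) - k\<bar>)) \<in> bruhat_edges lam"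
      unfolding bruhat_edges_def
      by (rule UnI1, rule CollectI, intro exI[of _ \<mu>] exI[of _ k] exI[of _ \<beta>]) (use k True assms in auto)
    then show ?thesis using k True by (simp add: edge_label_def)
  next
    case False
    have mu: "\<mu> = x - (- k) *\<^sub>Z pos_root \<beta>" using k(2) by (simp add: zscale_def prod_eq_iff)
    have p: "pairing x (coroot \<beta>) = pairing \<mu> (coroot \<beta>) - 2 * k" unfolding k(2) by (rule pairing_diff)
    have "(x - (- k) *\<^sub>Z pos_root \<beta>, x, (coroot \<beta>, pairing x (coroot \<beta>) - (- k))) \<in> bruhat_edges lam"
      unfolding bruhat_edges_def
      by (rule UnI2, rule CollectI, intro exI[of _ x] exI[of _ "- k"] exI[of _ \<beta>]) (use k False assms mu p in auto)
    moreover have "l = (coroot \<beta>, pairing x (coroot \<beta>) - (- k))"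
      using k(4,5) False p by (simp add: edge_label_def)
    ultimately show ?thesis using mu by metis
  qed
qed

lemma bruhat_edgesD: "(x, y, l) \<in> bruhat_edges lam \<Longrightarrow> x \<preceq> lam \<and> y \<preceq> lam"
  by (auto simp: bruhat_edges_def)

text \<open>In the untwisted graph the direction of an edge depends on the sign of the midpoint
  value. Reversing the edges with labels \<gamma>_1..\<gamma>_m moves this threshold from 0 to minus
  \<open>level_bound\<close>.\<close>

definition in_steps :: "nat \<Rightarrow> weight \<Rightarrow> weight \<Rightarrow> posroot \<Rightarrow> int set" where
  "in_steps m \<mu> lam \<beta> = {k. k \<noteq> 0 \<and> \<mu> - k *\<^sub>Z pos_root \<beta> \<preceq> lam \<and>
     (0 < k \<longleftrightarrow> - level_bound m \<beta> \<le> pairing \<mu> (coroot \<beta>) - k)}"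

lemma twisted_in_iff:
  assumes "\<mu> \<preceq> lam"
  shows "(x, \<mu>, l) \<in> twisted_edges m lam \<longleftrightarrow> (\<exists>\<beta> k. k \<in> in_steps m \<mu> lam \<beta> \<and>
     x = \<mu> - k *\<^sub>Z pos_root \<beta> \<and> l = edge_label \<beta> (pairing \<mu> (coroot \<beta>) - k))"
proof -
  have "(x, \<mu>, l) \<in> twisted_edges m lam \<longleftrightarrow> (x, \<mu>, l) \<in> bruhat_edges lam \<and> l \<notin> gamma ` {1..m} \<or>
      (\<mu>, x, l) \<in> bruhat_edges lam \<and> l \<in> gamma ` {1..m}"
    unfolding twisted_edges_def by (simp only: Un_iff mem_Collect_eq prod.inject conj_assoc) simp
  also have "\<dots> \<longleftrightarrow> (\<exists>\<beta> k. k \<noteq> 0 \<and> x = \<mu> - k *\<^sub>Z pos_root \<beta> \<and> x \<preceq> lam \<and>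
     l = edge_label \<beta> (pairing \<mu> (coroot \<beta>) - k) \<and>
     ((0 < k \<longleftrightarrow> 0 \<le> pairing \<mu> (coroot \<beta>) - k) \<and> edge_label \<beta> (pairing \<mu> (coroot \<beta>) - k) \<notin> gamma ` {1..m} \<or>
      (0 < k \<longleftrightarrow> pairing \<mu> (coroot \<beta>) - k < 0) \<and> edge_label \<beta> (pairing \<mu> (coroot \<beta>) - k) \<in> gamma ` {1..m}))"
    unfolding bruhat_in_iff[OF assms] bruhat_out_iff[OF assms]
  proof (rule iffI, goal_cases)
    case 1
    then show ?case
    proof (elim disjE conjE exE, goal_cases)
      case (1 \<beta> k)
      then show ?case by (intro exI[of _ \<beta>] exI[of _ k]) simp
    next
      case (2 \<beta> k)
      then show ?case by (intro exI[of _ \<beta>] exI[of _ k]) simp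
    qed
  next
    case 2
    then obtain \<beta> k where "k \<noteq> 0" "x = \<mu> - k *\<^sub>Z pos_root \<beta>" "x \<preceq> lam"
      "l = edge_label \<beta> (pairing \<mu> (coroot \<beta>) - k)"
      "(0 < k \<longleftrightarrow> 0 \<le> pairing \<mu> (coroot \<beta>) - k) \<and> l \<notin> gamma ` {1..m} \<or>
       (0 < k \<longleftrightarrow> pairing \<mu> (coroot \<beta>) - k < 0) \<and> l \<in> gamma ` {1..m}"
      by (elim exE conjE) (simp only:)
    then show ?case
      by (elim disjE conjE) ((rule disjI1, blast), (rule disjI2, blast))
  qed
  also have "\<dots> \<longleftrightarrow> (\<exists>\<beta> k. k \<in> in_steps m \<mu> lam \<beta> \<and>
     x = \<mu> - k *\<^sub>Z pos_root \<beta> \<and> l = edge_label \<beta> (pairing \<mu> (coroot \<beta>) - k))"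
  proof -
    \<comment> \<open>The reversed labels are those with midpoint value from minus
      \<open>level_bound\<close> to -1, which is the interval between the old and the new
      threshold.\<close>
    have e: "((0 < k \<longleftrightarrow> 0 \<le> j) \<and> edge_label \<beta> j \<notin> gamma ` {1..m} \<or>
      (0 < k \<longleftrightarrow> j < 0) \<and> edge_label \<beta> j \<in> gamma ` {1..m}) \<longleftrightarrow> (0 < k \<longleftrightarrow> - level_bound m \<beta> \<le> j)"
      for \<beta> and j k :: int
      unfolding edge_label_gamma_iff using level_bound_nonneg[of m \<beta>] by linarith
    show ?thesis unfolding e in_steps_def mem_Collect_eq by (intro iff_exI) auto
  qed
  finally show ?thesis .
qed

lemma pos_root_scale_inj:
  "k *\<^sub>Z pos_root \<beta> = k' *\<^sub>Z pos_root \<beta>' \<Longrightarrow> k \<noteq> 0 \<Longrightarrow> \<beta> = \<beta>' \<and> k = k'"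
  by (cases \<beta>; cases \<beta>') (auto simp: zscale_def)

lemma octagon_finite: "finite {\<mu>. \<mu> \<preceq> lam}"
proof (rule finite_subset)
  let ?A = "fst lam + snd lam"
  show "{\<mu>. \<mu> \<preceq> lam} \<subseteq> {- 2 * ?A..2 * ?A} \<times> {- ?A..?A}"
    by (auto simp: weight_le_iff octagon_def)
qed simp

lemma finite_in_steps: "finite (in_steps m \<mu> lam \<beta>)"
proof (rule inj_on_finite)
  show "inj_on (\<lambda>k. \<mu> - k *\<^sub>Z pos_root \<beta>) (in_steps m \<mu> lam \<beta>)"
    by (rule inj_onI) (use pos_root_scale_inj in \<open>auto simp: in_steps_def\<close>)
  show "(\<lambda>k. \<mu> - k *\<^sub>Z pos_root \<beta>) ` in_steps m \<mu> lam \<beta> \<subseteq> {\<mu>. \<mu> \<preceq> lam}"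
    by (auto simp: in_steps_def)
qed (rule octagon_finite)

lemma ell_eq_card:
  assumes "\<mu> \<preceq> lam"
  shows "ell m \<mu> lam = (\<Sum>\<beta> \<in> {A1, A2, A12, A21}. card (in_steps m \<mu> lam \<beta>))"
proof -
  let ?e = "\<lambda>(\<beta>, k). (\<mu> - k *\<^sub>Z pos_root \<beta>, \<mu>, edge_label \<beta> (pairing \<mu> (coroot \<beta>) - k))"
  let ?S = "SIGMA \<beta> : {A1, A2, A12, A21}. in_steps m \<mu> lam \<beta>"
  have all: "\<beta> \<in> {A1, A2, A12, A21}" for \<beta> by (cases \<beta>) auto
  have "{(x, y, l) \<in> twisted_edges m lam. y = \<mu>} = ?e ` ?S"
  proof (intro set_eqI iffI)
    fix t assume "t \<in> {(x, y, l) \<in> twisted_edges m lam. y = \<mu>}"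
    then obtain x l where t: "t = (x, \<mu>, l)" "(x, \<mu>, l) \<in> twisted_edges m lam" by blast
    then obtain \<beta> k where "k \<in> in_steps m \<mu> lam \<beta>" "x = \<mu> - k *\<^sub>Z pos_root \<beta>"
      "l = edge_label \<beta> (pairing \<mu> (coroot \<beta>) - k)" unfolding twisted_in_iff[OF assms] by blast
    then show "t \<in> ?e ` ?S" using all t(1) by (intro image_eqI[of _ _ "(\<beta>, k)"]) auto
  next
    fix t assume "t \<in> ?e ` ?S"
    then show "t \<in> {(x, y, l) \<in> twisted_edges m lam. y = \<mu>}"
      using twisted_in_iff[OF assms] by fastforce
  qed
  moreover have "inj_on ?e ?S"
  proof (rule inj_onI)
    fix s t assume *: "s \<in> ?S" "t \<in> ?S" "?e s = ?e t"
    obtain \<beta> k where s: "s = (\<beta>, k)" by (cases s)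
    obtain \<beta>' k' where t: "t = (\<beta>', k')" by (cases t)
    have "k *\<^sub>Z pos_root \<beta> = k' *\<^sub>Z pos_root \<beta>'" using *(3) by (simp add: s t)
    moreover have "k \<noteq> 0" using *(1) by (simp add: s in_steps_def)
    ultimately show "s = t" using pos_root_scale_inj s t by blast
  qed
  ultimately have "ell m \<mu> lam = card ?S" by (simp add: ell_def card_image)
  also have "\<dots> = (\<Sum>\<beta> \<in> {A1, A2, A12, A21}. card (in_steps m \<mu> lam \<beta>))"
    by (rule card_SigmaI) (auto simp: finite_in_steps)
  finally show ?thesis .
qed

section \<open>Closed formula for the number of incoming edges\<close>

text \<open>The steps on one root line, for pairing q at \<mu>, pairings on the line bounded by L
  and threshold -M. The summands belong to k > 0 and k < 0; in each \<open>min\<close> one bound is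
  the end of the line and the other the threshold.\<close>

definition string_count :: "int \<Rightarrow> int \<Rightarrow> int \<Rightarrow> int" where
  "string_count q L M = max 0 (min ((q + L) div 2) (q + M)) + max 0 (min ((L - q) div 2) (- q - M - 1))"

text \<open>On a line in an axis direction the parity of the pairing is fixed by the root lattice,
  and the \<open>mod\<close> term lowers \<lambda>_1 + \<lambda>_2 to the parity that occurs. For
  \<bar>z\<bar> > \<lambda>_2 an oblique side ends the line, and its bound already has the right
  parity.\<close>

definition axis_length :: "weight \<Rightarrow> int \<Rightarrow> int" where
  "axis_length lam z = (if \<bar>z\<bar> \<le> snd lam then fst lam + snd lam - (snd lam - z) mod 2
     else fst lam + 2 * snd lam - \<bar>z\<bar>)"

fun string_length :: "weight \<Rightarrow> weight \<Rightarrow> posroot \<Rightarrow> int" where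
  "string_length lam \<mu> A1 = min (fst lam + 2 * snd lam) (2 * (fst lam + snd lam) - \<bar>fst \<mu> + 2 * snd \<mu>\<bar>)"
| "string_length lam \<mu> A2 = axis_length lam (fst \<mu> + snd \<mu>)"
| "string_length lam \<mu> A12 = axis_length lam (snd \<mu>)"
| "string_length lam \<mu> A21 = min (fst lam + 2 * snd lam) (2 * (fst lam + snd lam) - \<bar>fst \<mu>\<bar>)"

lemma string_weight_le:
  assumes "\<mu> \<preceq> lam"
  shows "\<mu> - k *\<^sub>Z pos_root \<beta> \<preceq> lam \<longleftrightarrow> \<bar>pairing \<mu> (coroot \<beta>) - 2 * k\<bar> \<le> string_length lam \<mu> \<beta>"
proof -
  obtain l1 l2 where lam: "lam = (l1, l2)" by (cases lam)
  obtain p y where mu: "\<mu> = (p, y)" by (cases \<mu>)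
  have a: "0 \<le> l1" "0 \<le> l2" "\<bar>p + y\<bar> \<le> l1 + l2" "\<bar>y\<bar> \<le> l1 + l2" "\<bar>p + y\<bar> + \<bar>y\<bar> \<le> l1 + 2 * l2"
    "even (p - l1)"
    using assms by (auto simp: weight_le_iff octagon_def dominant_def lam mu)
  have axis: "\<bar>v\<bar> \<le> l1 + l2 \<and> \<bar>z\<bar> + \<bar>v\<bar> \<le> l1 + 2 * l2 \<longleftrightarrow> \<bar>v\<bar> \<le> axis_length (l1, l2) z"
    if "even (z + v - l1)" for z v
  proof (cases "\<bar>z\<bar> \<le> l2")
    case True
    have "\<bar>v\<bar> \<le> l1 + l2 \<longleftrightarrow> \<bar>v\<bar> \<le> l1 + l2 - (l2 - z) mod 2" using that by presburger
    then show ?thesis using True by (auto simp: axis_length_def)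
  next
    case False
    then show ?thesis by (auto simp: axis_length_def)
  qed
  \<comment> \<open>The bounds on the coordinates are rewritten in terms of u + v, which is constant
    on a diagonal line, and u - v, which varies. For \<open>A21\<close> the second coordinate enters
    with the opposite sign.\<close>
  have diag: "\<bar>u\<bar> \<le> l1 + l2 \<and> \<bar>v\<bar> \<le> l1 + l2 \<and> \<bar>u\<bar> + \<bar>v\<bar> \<le> l1 + 2 * l2 \<longleftrightarrow>
      \<bar>u - v\<bar> \<le> min (l1 + 2 * l2) (2 * (l1 + l2) - \<bar>u + v\<bar>)" if "\<bar>u + v\<bar> \<le> l1 + 2 * l2" for u v
    using that unfolding min.bounded_iff
    by (cases "0 \<le> u"; cases "0 \<le> v"; cases "u \<le> v"; cases "0 \<le> u + v"; auto)
  show ?thesis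
  proof (cases \<beta>)
    case A1
    then show ?thesis using a diag[of "p + y - k" "y + k"]
      by (simp add: weight_le_iff octagon_def dominant_def lam mu zscale_def pairing_def algebra_simps)
  next
    case A2
    then show ?thesis using a axis[of "p + y" "y - 2 * k"]
      by (simp add: weight_le_iff octagon_def dominant_def lam mu zscale_def pairing_def algebra_simps)
  next
    case A12
    then show ?thesis using a axis[of y "p + y - 2 * k"]
      by (simp add: weight_le_iff octagon_def dominant_def lam mu zscale_def pairing_def algebra_simps)
  next
    case A21
    then show ?thesis using a diag[of "p + y - k" "k - y"] abs_minus_commute[of y k]
      by (simp add: weight_le_iff octagon_def dominant_def lam mu zscale_def pairing_def algebra_simps)
  qed
qed

lemma card_in_steps:
  assumes "\<mu> \<preceq> lam"
  shows "int (card (in_steps m \<mu> lam \<beta>)) =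
    string_count (pairing \<mu> (coroot \<beta>)) (string_length lam \<mu> \<beta>) (level_bound m \<beta>)"
proof -
  define q L M where "q = pairing \<mu> (coroot \<beta>)" and "L = string_length lam \<mu> \<beta>" and "M = level_bound m \<beta>"
  have "\<mu> - 0 *\<^sub>Z pos_root \<beta> = \<mu>" by (simp add: zscale_def prod_eq_iff)
  then have L: "\<bar>q\<bar> \<le> L" using string_weight_le[OF assms, of 0 \<beta>] assms by (simp add: q_def L_def)
  have "in_steps m \<mu> lam \<beta> = {k. k \<noteq> 0 \<and> \<bar>q - 2 * k\<bar> \<le> L \<and> (0 < k \<longleftrightarrow> - M \<le> q - k)}"
    unfolding in_steps_def string_weight_le[OF assms] q_def L_def M_def ..
  also have "\<dots> = {1..min ((q + L) div 2) (q + M)} \<union> {- min ((L - q) div 2) (- q - M - 1)..-1}"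
    using L by (auto simp: set_eq_iff)
  finally have "in_steps m \<mu> lam \<beta> = {1..min ((q + L) div 2) (q + M)} \<union> {- min ((L - q) div 2) (- q - M - 1)..-1}" .
  moreover have "card ({1..min ((q + L) div 2) (q + M)} \<union> {- min ((L - q) div 2) (- q - M - 1)..-1}) =
     card {1..min ((q + L) div 2) (q + M)} + card {- min ((L - q) div 2) (- q - M - 1)..-1}"
    by (rule card_Un_disjoint) auto
  ultimately show ?thesis
    unfolding string_count_def q_def[symmetric] L_def[symmetric] M_def[symmetric] by (simp add: max_def)
qed

lemma ell_formula:
  assumes "\<mu> \<preceq> lam"
  shows "int (ell m \<mu> lam) = (\<Sum>\<beta> \<in> {A1, A2, A12, A21}.
    string_count (pairing \<mu> (coroot \<beta>)) (string_length lam \<mu> \<beta>) (level_bound m \<beta>))"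
  unfolding ell_eq_card[OF assms] of_nat_sum card_in_steps[OF assms] ..

section \<open>Integer identities behind swappability and elevation\<close>

text \<open>The letters are those of \<open>ell_axis_edge\<close>: e and its upper half h come from
  the sides at distance \<lambda>_1 + \<lambda>_2, R comes from the oblique sides, and R' = R - min
  k M, R'' = R - k. The conjunction on the right becomes \<open>ns_cond\<close>.\<close>

lemma swap_core:
  fixes e h R R' R'' c :: int
  assumes "2 * h = e \<or> 2 * h = e + 1" "R' < R" "R'' < R" "R' = R'' \<or> R' \<le> 0 \<and> R'' \<le> 0" "c = 0 \<or> c = 1"
  shows "max 0 (max (e - c) (R - c)) + max 0 (max (h - c) (R' - c)) =
      max 0 (max (e - c) (R'' - c)) + max 0 (max (h - c) (R - c)) \<longleftrightarrow>
    \<not> (2 \<le> e \<and> e + 2 \<le> 2 * R \<and> R'' + 1 \<le> e)"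
  using assms by (smt (verit))

text \<open>The numbers e - 1, 2R - e - 1 and e - R'' are the amounts of lowering at which the three
  inequalities of \<open>swap_core\<close> first fail; d is their minimum. The shifts by d on the
  left belong to \<lambda> - d\<varpi>_2. All four maxima simplify until max h' (R' + d) = min e R
  remains, and each candidate for d gives this for a different reason.\<close>

lemma elevation_core:
  fixes e h h' R R' R'' c d :: int
  assumes "2 * h = e \<or> 2 * h = e + 1" "2 * h' = e + d \<or> 2 * h' = e + d + 1"
    "d = min (min (e - 1) (2 * R - e - 1)) (e - R'')" "R' + d < R" "R'' + d < R"
    "R' = R'' \<or> R' \<le> 0 \<and> R'' \<le> 0" "c = 0 \<or> c = 1" "1 \<le> d"
  shows "max 0 (max (e + d - c) (R + d - c)) + max 0 (max (h' - c) (R' + d - c)) =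
      max 0 (max (e - c) (R'' - c)) + max 0 (max (h - c) (R - c)) + d"
proof -
  have d: "d \<le> e - 1" "d \<le> 2 * R - e - 1" "d \<le> e - R''"
    and d': "d = e - 1 \<or> d = 2 * R - e - 1 \<or> d = e - R''"
    using assms(3) by (auto simp: min_def)
  have 1: "max 0 (max (e - c) (R'' - c)) = e - c" using d assms(7,8) by linarith
  have 2: "max 0 (max (h - c) (R - c)) = R - c" using d assms(1,7,8) by linarith
  have 3: "max 0 (max (e + d - c) (R + d - c)) = max e R + d - c" using d assms(7,8) by linarith
  have 4: "max 0 (max (h' - c) (R' + d - c)) = max h' (R' + d) - c" using d assms(2,7,8) by linarith
  have "max h' (R' + d) = min e R"
    using d'
  proof (elim disjE)
    assume c: "d = e - 1"
    have "h' = e" using assms(2) c by presburger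
    moreover have "R' + d \<le> e" using assms(6) d(1,3) by linarith
    moreover have "e \<le> R" using d(2) c by linarith
    ultimately show ?thesis by simp
  next
    assume c: "d = 2 * R - e - 1"
    have "h' = R" using assms(2) c by presburger
    moreover have "R \<le> e" using d(1) c by linarith
    ultimately show ?thesis using assms(4) by simp
  next
    assume c: "d = e - R''"
    have "R' = R''" using assms(6) c d(1) by linarith
    moreover have "h' \<le> e" using assms(2) d(1) by linarith
    moreover have "e \<le> R" using assms(5) c by linarith
    ultimately show ?thesis using c by simp
  qed
  then show ?thesis unfolding 1 2 3 4 by linarith
qed

text \<open>Number of untwisted edges on one root line that end at a weight with pairing q. It does
  not depend on the length of the line, see \<open>string_count_zero\<close>.\<close>

definition gcount :: "int \<Rightarrow> int" where
  "gcount q = (if 0 \<le> q then q else - q - 1)"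

text \<open>Moving the threshold by M counts as if the pairing were q + M on an unbounded line, less
  what lies beyond the end. Only positive steps can pass the end: if q + M < 0, then - q - M - 1 is
  at most (L - q) div 2.\<close>

lemma string_count_eq:
  assumes "\<bar>q\<bar> \<le> L" "0 \<le> M" "even (q + L)"
  shows "string_count q L M = gcount (q + M) - max 0 ((q + 2 * M - L) div 2)"
proof -
  obtain u where u: "q + L = 2 * u" using assms(3) by (elim evenE)
  then have L: "L = 2 * u - q" by simp
  have d: "(q + L) div 2 = u" "(L - q) div 2 = u - q" "(q + 2 * M - L) div 2 = q + M - u"
    unfolding L by presburger+
  show ?thesis unfolding string_count_def gcount_def d using assms(1,2) u by (auto simp: max_def min_def)
qed

lemma string_count_zero:
  assumes "\<bar>q\<bar> \<le> L" "even (q + L)"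
  shows "string_count q L 0 = gcount q"
proof -
  have "(q - L) div 2 \<le> 0" using assms(1) by linarith
  then show ?thesis using string_count_eq[OF assms(1) _ assms(2), of 0] by simp
qed

text \<open>The part of an axis line that \<open>string_count_eq\<close> cuts off, for r = q + 2M
  and constant coordinate z. The \<open>+ 1\<close> stands for the parity correction in
  \<open>axis_length\<close>.\<close>

definition axis_excess :: "weight \<Rightarrow> int \<Rightarrow> int \<Rightarrow> int" where
  "axis_excess lam r z = max 0 (max ((r - fst lam - snd lam + 1) div 2) ((r - fst lam - 2 * snd lam + \<bar>z\<bar>) div 2))"

definition diag_excess :: "weight \<Rightarrow> int \<Rightarrow> int \<Rightarrow> int" where
  "diag_excess lam r d = max 0 (max ((r - fst lam - 2 * snd lam) div 2) ((r - 2 * (fst lam + snd lam) + \<bar>d\<bar>) div 2))"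

lemma axis_length_excess:
  assumes "even (r + z - fst lam)"
  shows "max 0 ((r - axis_length lam z) div 2) = axis_excess lam r z" "even (r + axis_length lam z)"
proof -
  obtain l1 l2 where lam: "lam = (l1, l2)" by (cases lam)
  have p: "even (r + z - l1)" using assms by (simp add: lam)
  show "even (r + axis_length lam z)"
  proof (cases "\<bar>z\<bar> \<le> l2")
    case True
    then show ?thesis using p unfolding axis_length_def lam fst_conv snd_conv if_P[OF True] by presburger
  next
    case False
    then show ?thesis using p unfolding axis_length_def lam fst_conv snd_conv if_not_P[OF False] by presburger
  qed
  show "max 0 ((r - axis_length lam z) div 2) = axis_excess lam r z"
  proof (cases "\<bar>z\<bar> \<le> l2")
    case True
    have 1: "(r - (l1 + l2 - (l2 - z) mod 2)) div 2 = (r - l1 - l2 + 1) div 2" using p by presburger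
    have 2: "(r - l1 - 2 * l2 + \<bar>z\<bar>) div 2 \<le> (r - l1 - l2 + 1) div 2" using True by (intro zdiv_mono1) auto
    show ?thesis unfolding axis_length_def axis_excess_def lam fst_conv snd_conv if_P[OF True] 1
      using 2 by (simp add: max_absorb1)
  next
    case False
    have 1: "(r - (l1 + 2 * l2 - \<bar>z\<bar>)) div 2 = (r - l1 - 2 * l2 + \<bar>z\<bar>) div 2" by (simp add: algebra_simps)
    have 2: "(r - l1 - l2 + 1) div 2 \<le> (r - l1 - 2 * l2 + \<bar>z\<bar>) div 2" using False by (intro zdiv_mono1) auto
    show ?thesis unfolding axis_length_def axis_excess_def lam fst_conv snd_conv if_not_P[OF False] 1
      using 2 by (simp add: max_absorb2)
  qed
qed

lemma diag_length_excess:
  assumes "even (r - fst lam)" "even (d - fst lam)"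
  shows "max 0 ((r - min (fst lam + 2 * snd lam) (2 * (fst lam + snd lam) - \<bar>d\<bar>)) div 2) = diag_excess lam r d"
    "even (r + min (fst lam + 2 * snd lam) (2 * (fst lam + snd lam) - \<bar>d\<bar>))"
proof -
  obtain l1 l2 where lam: "lam = (l1, l2)" by (cases lam)
  show "even (r + min (fst lam + 2 * snd lam) (2 * (fst lam + snd lam) - \<bar>d\<bar>))"
    using assms unfolding lam fst_conv snd_conv min_def by presburger
  let ?a = "r - l1 - 2 * l2" and ?b = "r - 2 * (l1 + l2) + \<bar>d\<bar>"
  have "r - min (l1 + 2 * l2) (2 * (l1 + l2) - \<bar>d\<bar>) = max ?a ?b" by linarith
  moreover have "max ?a ?b div 2 = max (?a div 2) (?b div 2)"
    by (simp add: max_def zdiv_mono1 antisym)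
  ultimately show "max 0 ((r - min (fst lam + 2 * snd lam) (2 * (fst lam + snd lam) - \<bar>d\<bar>)) div 2) = diag_excess lam r d"
    by (simp add: diag_excess_def lam)
qed

text \<open>Each root line contributes one \<open>gcount\<close> and one excess. No \<gamma> has the
  root \<open>A1\<close>, so on that line the threshold stays at 0 and nothing is cut off.\<close>

lemma ell_explicit:
  assumes "\<mu> \<preceq> lam"
  defines "x \<equiv> fst \<mu> + snd \<mu>" and "y \<equiv> snd \<mu>"
  shows "int (ell m \<mu> lam) = gcount (x - y) + gcount (y + level_bound m A2) + gcount (x + level_bound m A12)
      + gcount (x + y + level_bound m A21) - axis_excess lam (y + 2 * level_bound m A2) x
      - axis_excess lam (x + 2 * level_bound m A12) y - diag_excess lam (x + y + 2 * level_bound m A21) (x - y)"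
proof -
  obtain l1 l2 where lam: "lam = (l1, l2)" by (cases lam)
  have mu: "\<mu> = (x - y, y)" by (simp add: x_def y_def)
  have a: "0 \<le> l1" "0 \<le> l2" "\<bar>x\<bar> \<le> l1 + l2" "\<bar>y\<bar> \<le> l1 + l2" "\<bar>x\<bar> + \<bar>y\<bar> \<le> l1 + 2 * l2"
    "even (x - y - l1)"
    using assms(1) by (auto simp: weight_le_iff octagon_def dominant_def lam mu)
  have p: "\<bar>pairing \<mu> (coroot \<beta>)\<bar> \<le> string_length lam \<mu> \<beta>" for \<beta>
    using string_weight_le[OF assms(1), of 0 \<beta>] assms(1) by (simp add: zscale_def zero_prod_def[symmetric])
  have pr: "pairing \<mu> (coroot A1) = x - y" "pairing \<mu> (coroot A2) = y" "pairing \<mu> (coroot A12) = x"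
    "pairing \<mu> (coroot A21) = x + y" by (simp_all add: pairing_def mu)
  have ev: "even (y + x - l1)" "even (x + y - l1)" using a(6) by presburger+
  have f: "fst \<mu> = x - y" "fst \<mu> + snd \<mu> = x" "snd \<mu> = y" "fst \<mu> + 2 * snd \<mu> = x + y" by (simp_all add: mu)
  have 2: "string_count y (axis_length lam x) M = gcount (y + M) - axis_excess lam (y + 2 * M) x" if "0 \<le> M" for M
    using string_count_eq[OF _ that, of y "axis_length lam x"] p[of A2] pr(2)
      axis_length_excess[of "y + 2 * M" x lam] axis_length_excess(2)[of y x lam] ev f lam by simp
  have 12: "string_count x (axis_length lam y) M = gcount (x + M) - axis_excess lam (x + 2 * M) y" if "0 \<le> M" for M
    using string_count_eq[OF _ that, of x "axis_length lam y"] p[of A12] pr(3)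
      axis_length_excess[of "x + 2 * M" y lam] axis_length_excess(2)[of x y lam] ev f lam by simp
  have 21: "string_count (x + y) (string_length lam \<mu> A21) M =
      gcount (x + y + M) - diag_excess lam (x + y + 2 * M) (x - y)" if "0 \<le> M" for M
  proof -
    have sl: "string_length lam \<mu> A21 = min (fst lam + 2 * snd lam) (2 * (fst lam + snd lam) - \<bar>x - y\<bar>)"
      unfolding string_length.simps f(1) ..
    have e: "even (x + y - fst lam)" "even (x + y + 2 * M - fst lam)" "even (x - y - fst lam)"
      using ev a(6) by (simp_all add: lam)
    have "\<bar>x + y\<bar> \<le> string_length lam \<mu> A21" using p[of A21] unfolding pr(4) .
    moreover have "even (x + y + string_length lam \<mu> A21)"
      unfolding sl by (rule diag_length_excess(2)[OF e(1,3)])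
    moreover have "max 0 ((x + y + 2 * M - string_length lam \<mu> A21) div 2) = diag_excess lam (x + y + 2 * M) (x - y)"
      unfolding sl by (rule diag_length_excess(1)[OF e(2,3)])
    ultimately show ?thesis using string_count_eq[OF _ that] by metis
  qed
  have 1: "string_count (x - y) (string_length lam \<mu> A1) 0 = gcount (x - y)"
  proof -
    have "\<bar>x - y\<bar> \<le> string_length lam \<mu> A1" using p[of A1] unfolding pr(1) .
    moreover have sl: "string_length lam \<mu> A1 = min (fst lam + 2 * snd lam) (2 * (fst lam + snd lam) - \<bar>x + y\<bar>)"
      unfolding string_length.simps f(4) ..
    moreover have "even (x - y + string_length lam \<mu> A1)"
      unfolding sl by (rule diag_length_excess(2)) (use ev a(6) lam in simp_all)
    ultimately show ?thesis using string_count_zero by blast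
  qed
  have sum4: "sum F {A1, A2, A12, A21} = F A1 + (F A2 + (F A12 + F A21))" for F :: "posroot \<Rightarrow> int"
    by simp
  have sl2: "string_length lam \<mu> A2 = axis_length lam x" by (simp only: string_length.simps f(2))
  have sl12: "string_length lam \<mu> A12 = axis_length lam y" by (simp only: string_length.simps f(3))
  show ?thesis
    unfolding ell_formula[OF assms(1)] sum4 pr level_bound.simps(1) 1 sl2 sl12 2[OF level_bound_nonneg[of m A2]]
      12[OF level_bound_nonneg[of m A12]] 21[OF level_bound_nonneg[of m A21]] by linarith
qed

text \<open>This symmetry matches the contributions of a root line at the two ends of an
  edge.\<close>

lemma gcount_flip: "gcount (- q - 1) = gcount q"
  by (simp add: gcount_def)

subsection \<open>Edges labelled by the roots \<open>A2\<close> and \<open>A12\<close>\<close>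

text \<open>For an axis direction, the coordinate that is constant along the line; the pairing with
  the coroot is the other coordinate.\<close>

fun cross :: "posroot \<Rightarrow> weight \<Rightarrow> int" where
  "cross A2 \<mu> = fst \<mu> + snd \<mu>"
| "cross A12 \<mu> = snd \<mu>"
| "cross _ \<mu> = 0"

text \<open>In the sequence \<gamma> the label M\<delta> - \<alpha>_12^\<vee> precedes M\<delta> -
  \<alpha>_2^\<vee>. Just before and at the label M\<delta> - \<beta>^\<vee>, the other axis
  direction has level M - c and \<open>A21\<close> has level 2M - c, so the constant c lets one
  computation serve both directions.\<close>

definition root_shift :: "posroot \<Rightarrow> int" where
  "root_shift \<beta> = (if \<beta> = A2 then 0 else 1)"

text \<open>\<open>ell_explicit\<close> in the coordinates (z, w) adapted to \<beta>, for m just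
  before the label M\<delta> - \<beta>^\<vee> (b = M - 1) or at it (b = M).\<close>

definition ell_axis :: "weight \<Rightarrow> int \<Rightarrow> int \<Rightarrow> int \<Rightarrow> int \<Rightarrow> int \<Rightarrow> int" where
  "ell_axis lam c M b z w = gcount (z - w - c) + gcount (z + M - c) + gcount (z + w + 2 * M - c) + gcount (w + b)
     - axis_excess lam (w + 2 * b) z - axis_excess lam (z + 2 * M - 2 * c) w
     - diag_excess lam (z + w + 4 * M - 2 * c) (z - w)"

lemma diag_excess_minus: "diag_excess lam r (- d) = diag_excess lam r d"
  by (simp add: diag_excess_def)

lemma ell_eq_ell_axis:
  assumes "\<mu> \<preceq> lam" "\<beta> = A2 \<or> \<beta> = A12" "1 \<le> M"
  defines "w \<equiv> pairing \<mu> (coroot \<beta>)" and "z \<equiv> cross \<beta> \<mu>" and "c \<equiv> root_shift \<beta>"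
  shows "int (ell (gamma_index \<beta> M - 1) \<mu> lam) = ell_axis lam c M (M - 1) z w"
    "int (ell (gamma_index \<beta> M) \<mu> lam) = ell_axis lam c M M z w"
proof -
  define j where "j = nat (M - 1)"
  have j: "M = int j + 1" using assms(3) by (simp add: j_def)
  define x y where "x = fst \<mu> + snd \<mu>" and "y = snd \<mu>"
  note E = ell_explicit[OF assms(1), folded x_def y_def]
  have "int (ell (gamma_index \<beta> M - 1) \<mu> lam) = ell_axis lam c M (M - 1) z w \<and>
    int (ell (gamma_index \<beta> M) \<mu> lam) = ell_axis lam c M M z w"
    using assms(2)
  proof
    assume b: "\<beta> = A2"
    have wz: "w = y" "z = x" "c = 0" by (simp_all add: w_def z_def c_def b root_shift_def pairing_def x_def y_def)
    have i: "gamma_index \<beta> M = 4 * j + 4" using b j by simp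
    have l: "level_bound (4 * j + 4 - 1) A2 = M - 1" "level_bound (4 * j + 4 - 1) A12 = M"
      "level_bound (4 * j + 4 - 1) A21 = 2 * M" "level_bound (4 * j + 4) A2 = M" "level_bound (4 * j + 4) A12 = M"
      "level_bound (4 * j + 4) A21 = 2 * M"
      unfolding level_bound.simps j by presburger+
    show ?thesis unfolding i E l wz ell_axis_def by (simp add: algebra_simps)
  next
    assume b: "\<beta> = A12"
    have wz: "w = x" "z = y" "c = 1" by (simp_all add: w_def z_def c_def b root_shift_def pairing_def x_def y_def)
    have i: "gamma_index \<beta> M = 4 * j + 2" using b j by simp
    have l: "level_bound (4 * j + 2 - 1) A2 = M - 1" "level_bound (4 * j + 2 - 1) A12 = M - 1"
      "level_bound (4 * j + 2 - 1) A21 = 2 * M - 1" "level_bound (4 * j + 2) A2 = M - 1" "level_bound (4 * j + 2) A12 = M"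
      "level_bound (4 * j + 2) A21 = 2 * M - 1"
      unfolding level_bound.simps j by presburger+
    \<comment> \<open>For \<open>A12\<close> the roles of the coordinates are exchanged, so the line
      of \<open>A1\<close> appears with pairing y - x; the shift c = 1 turns it back.\<close>
    have g: "gcount (y - x - 1) = gcount (x - y)" using gcount_flip[of "x - y"] by simp
    have d: "diag_excess lam r (y - x) = diag_excess lam r (x - y)" for r
      using diag_excess_minus[of lam r "x - y"] by simp
    show ?thesis unfolding i E l wz ell_axis_def g d by (simp add: algebra_simps)
  qed
  then show "int (ell (gamma_index \<beta> M - 1) \<mu> lam) = ell_axis lam c M (M - 1) z w"
    "int (ell (gamma_index \<beta> M) \<mu> lam) = ell_axis lam c M M z w" by auto
qed

lemma half_shift:
  fixes r c :: int
  shows "(r - 2 * c) div 2 = r div 2 - c"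
  by simp

text \<open>The absolute value produces a second term k + M - (l1 + l2) - c. It is at most 0 under
  the first alternative of the hypothesis and dominated by the first term under the other.\<close>

lemma diag_excess_form:
  assumes "even (z + k + M - l1)" "k + M \<le> l1 + l2 \<or> k \<le> z + M" "0 \<le> c"
  shows "diag_excess (l1, l2) (z + k + 3 * M - 2 * c) (z - k + M) =
    max 0 (max (z + 2 * M - (l1 + l2) - c) ((z + k + 3 * M - (l1 + 2 * l2)) div 2 - c))"
proof -
  let ?B = "(z + k + 3 * M - (l1 + 2 * l2)) div 2 - c"
  have 1: "(z + k + 3 * M - 2 * c - l1 - 2 * l2) div 2 = ?B" by presburger
  have 2: "(z + k + 3 * M - 2 * c - 2 * (l1 + l2) + \<bar>z - k + M\<bar>) div 2 =
      max (z + 2 * M - (l1 + l2) - c) (k + M - (l1 + l2) - c)"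
  proof -
    have "z + k + 3 * M - 2 * c - 2 * (l1 + l2) + \<bar>z - k + M\<bar> =
        2 * max (z + 2 * M - (l1 + l2) - c) (k + M - (l1 + l2) - c)"
      by (cases "k \<le> z + M") (simp_all add: max_def abs_if)
    then show ?thesis by simp
  qed
  show ?thesis unfolding diag_excess_def fst_conv snd_conv 1 2 using assms(2,3) by linarith
qed

lemma axis_excess_form:
  "axis_excess (l1, l2) (r - 2 * c) v =
    max 0 (max ((r - (l1 + l2) + 1) div 2 - c) ((r - (l1 + 2 * l2) + \<bar>v\<bar>) div 2 - c))"
proof -
  have x: "r - 2 * c - l1 - l2 + 1 = r - (l1 + l2) + 1 - 2 * c"
    "r - 2 * c - l1 - 2 * l2 + \<bar>v\<bar> = r - (l1 + 2 * l2) + \<bar>v\<bar> - 2 * c" by simp_all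
  show ?thesis unfolding axis_excess_def fst_conv snd_conv x half_shift ..
qed

text \<open>Non-swappability of an edge in an axis direction with step k, level M and constant
  coordinate z. In the letters of \<open>swap_core\<close> the inequalities are, in this order, e +
  2 \<le> 2R, R - k + 1 \<le> e and 2 \<le> e.\<close>

definition ns_cond :: "weight \<Rightarrow> int \<Rightarrow> int \<Rightarrow> int \<Rightarrow> bool" where
  "ns_cond lam z k M \<longleftrightarrow> snd lam + 2 \<le> M + k \<and> fst lam + 2 \<le> z + M + k \<and> fst lam + snd lam + 2 \<le> z + 2 * M"

definition axis_octagon :: "int \<Rightarrow> int \<Rightarrow> int \<Rightarrow> int \<Rightarrow> bool" where
  "axis_octagon l1 l2 z v \<longleftrightarrow> \<bar>z\<bar> \<le> l1 + l2 \<and> \<bar>v\<bar> \<le> l1 + l2 \<and> \<bar>z\<bar> + \<bar>v\<bar> \<le> l1 + 2 * l2 \<and> even (z + v - l1)"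

lemma weight_le_axis:
  assumes "\<beta> = A2 \<or> \<beta> = A12"
  shows "\<mu> \<preceq> (l1, l2) \<longleftrightarrow> 0 \<le> l1 \<and> 0 \<le> l2 \<and> axis_octagon l1 l2 (cross \<beta> \<mu>) (pairing \<mu> (coroot \<beta>))"
  using assms
proof
  assume "\<beta> = A2"
  moreover have "even (fst \<mu> - l1) \<longleftrightarrow> even (fst \<mu> + snd \<mu> + snd \<mu> - l1)" by presburger
  ultimately show ?thesis
    by (simp add: weight_le_iff octagon_def dominant_def axis_octagon_def pairing_def; blast)
next
  assume "\<beta> = A12"
  moreover have "even (fst \<mu> - l1) \<longleftrightarrow> even (snd \<mu> + (fst \<mu> + snd \<mu>) - l1)" by presburger
  ultimately show ?thesis
    by (simp add: weight_le_iff octagon_def dominant_def axis_octagon_def pairing_def add.commute; blast)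
qed

lemma axis_edge_ineqs:
  assumes "axis_octagon l1 l2 z (k - M)" "axis_octagon l1 l2 z (- (k + M))" "1 \<le> k" "1 \<le> M" "0 \<le> l1" "0 \<le> l2"
  shows "k + M \<le> l1 + l2" "z + k + M \<le> l1 + 2 * l2" "k + M - z \<le> l1 + 2 * l2" "z \<le> l1 + l2" "- z \<le> l1 + l2"
    "even (z + k + M - l1)"
proof -
  note o = assms(2)[unfolded axis_octagon_def]
  show "k + M \<le> l1 + l2" "z + k + M \<le> l1 + 2 * l2" "k + M - z \<le> l1 + 2 * l2" "z \<le> l1 + l2" "- z \<le> l1 + l2"
    using o by linarith+
  show "even (z + k + M - l1)" using o by presburger
qed

text \<open>The edge takes w = k - M to -(k + M) and thereby exchanges the shifted pairings on the
  lines of \<open>A1\<close> and \<open>A21\<close>, so G is common to both ends. On the line of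
  \<beta> nothing is cut off, because both ends of the edge lie in the octagon. One diagonal and one
  axis excess remain at each end.\<close>

lemma ell_axis_edge:
  assumes o: "axis_octagon l1 l2 z (k - M)" "axis_octagon l1 l2 z (- (k + M))"
    and kM: "1 \<le> k" "1 \<le> M" "0 \<le> l1" "0 \<le> l2" and c: "c = 0 \<or> c = 1"
  defines "e \<equiv> z + 2 * M - (l1 + l2)" and "h \<equiv> (z + 2 * M - (l1 + l2) + 1) div 2"
    and "R \<equiv> (z + k + 3 * M - (l1 + 2 * l2)) div 2"
    and "G \<equiv> gcount (z + M - k - c) + gcount (z + M - c) + gcount (z + k + M - c)"
  shows "ell_axis (l1, l2) c M (M - 1) z (k - M) =
      G + k - 1 - max 0 (max (e - c) (R - c)) - max 0 (max (h - c) (R - min k M - c))"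
    "ell_axis (l1, l2) c M (M - 1) z (- (k + M)) =
      G + k - max 0 (max (e - c) (R - k - c)) - max 0 (max (h - c) (R - c))"
    "ell_axis (l1, l2) c M M z (- (k + M)) =
      G + k - 1 - max 0 (max (e - c) (R - k - c)) - max 0 (max (h - c) (R - c))"
proof -
  note i = axis_edge_ineqs[OF o kM]
  have g: "gcount (k - 1) = k - 1" "gcount (- k - 1) = k" "gcount (- k) = k - 1" "gcount k = k"
    using kM by (simp_all add: gcount_def)
  have d1: "diag_excess (l1, l2) (z + (k - M) + 4 * M - 2 * c) (z - (k - M)) = max 0 (max (e - c) (R - c))"
  proof -
    have x: "z + (k - M) + 4 * M - 2 * c = z + k + 3 * M - 2 * c" "z - (k - M) = z - k + M" by simp_all
    show ?thesis unfolding e_def R_def x by (rule diag_excess_form) (use i c in auto)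
  qed
  have d2: "diag_excess (l1, l2) (z + - (k + M) + 4 * M - 2 * c) (z - - (k + M)) = max 0 (max (e - c) (R - k - c))"
  proof -
    have rk: "(z + - k + 3 * M - (l1 + 2 * l2)) div 2 = R - k" unfolding R_def by presburger
    have ev: "even (z + - k + M - l1)" using i(6) by presburger
    have le: "- k + M \<le> l1 + l2" using i(1) kM by linarith
    have x: "z + - (k + M) + 4 * M - 2 * c = z + - k + 3 * M - 2 * c" "z - - (k + M) = z - - k + M" by simp_all
    show ?thesis unfolding e_def x rk[symmetric] by (rule diag_excess_form[OF ev]) (use le c in auto)
  qed
  have a1: "axis_excess (l1, l2) (z + 2 * M - 2 * c) (k - M) = max 0 (max (h - c) (R - min k M - c))"
  proof -
    have n: "z + 2 * M - (l1 + 2 * l2) + \<bar>k - M\<bar> = (z + k + 3 * M - (l1 + 2 * l2)) - 2 * min k M"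
      by (simp add: min_def abs_if)
    have "(z + 2 * M - (l1 + 2 * l2) + \<bar>k - M\<bar>) div 2 = R - min k M"
      unfolding R_def n by (rule half_shift)
    then show ?thesis unfolding axis_excess_form h_def by simp
  qed
  have a2: "axis_excess (l1, l2) (z + 2 * M - 2 * c) (- (k + M)) = max 0 (max (h - c) (R - c))"
  proof -
    have "(z + 2 * M - (l1 + 2 * l2) + \<bar>- (k + M)\<bar>) div 2 = R"
    proof -
      have "z + 2 * M - (l1 + 2 * l2) + \<bar>- (k + M)\<bar> = z + k + 3 * M - (l1 + 2 * l2)" using kM by simp
      then show ?thesis by (simp only: R_def)
    qed
    then show ?thesis unfolding axis_excess_form h_def by simp
  qed
  have b: "axis_excess (l1, l2) r z = 0" if "r \<le> k + M - 2" for r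
  proof -
    have "(r - l1 - l2 + 1) div 2 \<le> 0" using that i(1) by linarith
    moreover have "(r - l1 - 2 * l2 + \<bar>z\<bar>) div 2 \<le> 0" using that i(2,3) by linarith
    ultimately show ?thesis by (simp add: axis_excess_def)
  qed
  have b1: "axis_excess (l1, l2) (k - M + 2 * (M - 1)) z = 0" by (rule b) (use kM in simp)
  have b2: "axis_excess (l1, l2) (- (k + M) + 2 * (M - 1)) z = 0" by (rule b) (use kM in simp)
  have b3: "axis_excess (l1, l2) (- (k + M) + 2 * M) z = 0" by (rule b) (use kM in simp)
  define P1 P2 P3 P4 where "P1 = max 0 (max (e - c) (R - c))" and "P2 = max 0 (max (h - c) (R - min k M - c))"
    and "P3 = max 0 (max (e - c) (R - k - c))" and "P4 = max 0 (max (h - c) (R - c))"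
  note P = P1_def[symmetric] P2_def[symmetric] P3_def[symmetric] P4_def[symmetric]
  have s: "z - (k - M) - c = z + M - k - c" "z + (k - M) + 2 * M - c = z + k + M - c" "k - M + (M - 1) = k - 1"
    "z - - (k + M) - c = z + k + M - c" "z + - (k + M) + 2 * M - c = z + M - k - c" "- (k + M) + (M - 1) = - k - 1"
    "- (k + M) + M = - k" by simp_all
  show "ell_axis (l1, l2) c M (M - 1) z (k - M) =
      G + k - 1 - max 0 (max (e - c) (R - c)) - max 0 (max (h - c) (R - min k M - c))"
    "ell_axis (l1, l2) c M (M - 1) z (- (k + M)) =
      G + k - max 0 (max (e - c) (R - k - c)) - max 0 (max (h - c) (R - c))"
    "ell_axis (l1, l2) c M M z (- (k + M)) =
      G + k - 1 - max 0 (max (e - c) (R - k - c)) - max 0 (max (h - c) (R - c))"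
    unfolding ell_axis_def d1 d2 a1 a2 b1 b2 b3 s g G_def P by linarith+
qed

lemma ell_axis_swap_iff:
  assumes o: "axis_octagon l1 l2 z (k - M)" "axis_octagon l1 l2 z (- (k + M))"
    and kM: "1 \<le> k" "1 \<le> M" "0 \<le> l1" "0 \<le> l2" and c: "c = 0 \<or> c = 1"
  shows "ell_axis (l1, l2) c M (M - 1) z (k - M) = ell_axis (l1, l2) c M (M - 1) z (- (k + M)) - 1 \<longleftrightarrow>
    \<not> ns_cond (l1, l2) z k M"
proof -
  define e h R where "e = z + 2 * M - (l1 + l2)" and "h = (z + 2 * M - (l1 + l2) + 1) div 2"
    and "R = (z + k + 3 * M - (l1 + 2 * l2)) div 2"
  note i = axis_edge_ineqs[OF o kM]
  have h: "2 * h = e \<or> 2 * h = e + 1" unfolding h_def e_def by presburger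
  have R: "2 * R = z + k + 3 * M - (l1 + 2 * l2)" unfolding R_def using i(6) by presburger
  \<comment> \<open>For k > M the oblique side gives R \<le> M, so both terms are at most 0 and
    disappear in the maxima.\<close>
  have or: "R - min k M = R - k \<or> R - min k M \<le> 0 \<and> R - k \<le> 0"
  proof (cases "k \<le> M")
    case False
    then have "R \<le> M" using R i(2) by linarith
    then show ?thesis using False by simp
  qed simp
  have "ns_cond (l1, l2) z k M \<longleftrightarrow> 2 \<le> e \<and> e + 2 \<le> 2 * R \<and> R - k + 1 \<le> e"
    unfolding ns_cond_def fst_conv snd_conv R e_def using R by presburger
  moreover have "min k M > 0" using kM by simp
  ultimately show ?thesis
  proof -
    define P1 P2 P3 P4 where "P1 = max 0 (max (e - c) (R - c))" and "P2 = max 0 (max (h - c) (R - min k M - c))"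
      and "P3 = max 0 (max (e - c) (R - k - c))" and "P4 = max 0 (max (h - c) (R - c))"
    note P = P1_def[symmetric] P2_def[symmetric] P3_def[symmetric] P4_def[symmetric]
    assume *: "ns_cond (l1, l2) z k M \<longleftrightarrow> 2 \<le> e \<and> e + 2 \<le> 2 * R \<and> R - k + 1 \<le> e" "min k M > 0"
    have "P1 + P2 = P3 + P4 \<longleftrightarrow> \<not> ns_cond (l1, l2) z k M"
      unfolding *(1) P1_def P2_def P3_def P4_def by (rule swap_core[OF h _ _ or c]) (use *(2) kM(1) in simp_all)
    then show ?thesis
      unfolding ell_axis_edge[OF o kM c, folded e_def h_def R_def] P by linarith
  qed
qed

subsection \<open>Edges labelled by the root \<open>A21\<close>\<close>

text \<open>An edge in direction \<open>A21\<close> takes (p, q) to (- q - K, - p - K). Because of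
  2l \<le> K the sides at distance \<lambda>_1 + \<lambda>_2 cut off nothing, and the oblique terms
  agree for q \<le> 0 and are both at most 0 otherwise.\<close>

lemma axis_excess_reflect:
  assumes o: "axis_octagon l1 l2 q p" "axis_octagon l1 l2 (- p - K) (- q - K)" and "1 \<le> p + q + K" "2 * l \<le> K" "1 \<le> K"
  shows "axis_excess (l1, l2) (p + 2 * l) q = axis_excess (l1, l2) (- q - K + 2 * l) (- p - K)"
proof -
  have b: "p + K \<le> l1 + l2" "- q \<le> l1 + l2 + K" "- q \<le> l1 + l2" "p + q + 2 * K \<le> l1 + 2 * l2"
    "\<bar>p + K\<bar> = \<bar>- p - K\<bar>" "p - q \<le> l1 + 2 * l2"
    using o unfolding axis_octagon_def by linarith+
  have 1: "(p + 2 * l - l1 - l2 + 1) div 2 \<le> 0" using b assms(4) by linarith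
  have 2: "(- q - K + 2 * l - l1 - l2 + 1) div 2 \<le> 0" using b assms(4) by linarith
  have "(p + 2 * l - l1 - 2 * l2 + \<bar>q\<bar>) div 2 = (- q - K + 2 * l - l1 - 2 * l2 + \<bar>- p - K\<bar>) div 2 \<or>
    (p + 2 * l - l1 - 2 * l2 + \<bar>q\<bar>) div 2 \<le> 0 \<and> (- q - K + 2 * l - l1 - 2 * l2 + \<bar>- p - K\<bar>) div 2 \<le> 0"
  proof (cases "q \<le> 0")
    case True
    then have "\<bar>q\<bar> = - q" "\<bar>- p - K\<bar> = p + K" using assms(3) by simp_all
    then have "p + 2 * l - l1 - 2 * l2 + \<bar>q\<bar> = - q - K + 2 * l - l1 - 2 * l2 + \<bar>- p - K\<bar>" by simp
    then show ?thesis by presburger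
  next
    case False
    then have "p + 2 * l - l1 - 2 * l2 + \<bar>q\<bar> \<le> 0" "- q - K + 2 * l - l1 - 2 * l2 + \<bar>- p - K\<bar> \<le> 0"
      using assms(3-5) b by linarith+
    then show ?thesis by linarith
  qed
  moreover have m: "max 0 (max a b) = max 0 b" if "a \<le> 0" for a b :: int
    using that by simp
  have n: "max 0 b = max 0 b'" if "b = b' \<or> b \<le> 0 \<and> b' \<le> 0" for b b' :: int
    using that by auto
  ultimately show ?thesis unfolding axis_excess_def fst_conv snd_conv m[OF 1] m[OF 2] by (intro n)
qed

lemma ell_explicit_at:
  assumes "\<mu> \<preceq> lam" "x = fst \<mu> + snd \<mu>" "y = snd \<mu>"
  shows "int (ell m \<mu> lam) = gcount (x - y) + gcount (y + level_bound m A2) + gcount (x + level_bound m A12)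
      + gcount (x + y + level_bound m A21) - axis_excess lam (y + 2 * level_bound m A2) x
      - axis_excess lam (x + 2 * level_bound m A12) y - diag_excess lam (x + y + 2 * level_bound m A21) (x - y)"
  unfolding assms(2,3) by (rule ell_explicit[OF assms(1)])

text \<open>No cut-off survives the comparison: the diagonal terms vanish and the axis terms agree.
  The levels l of \<open>A2\<close> and l' of \<open>A12\<close> satisfy l + l' = K - 1, so
  \<open>gcount_flip\<close> matches the axis lines. Edges in direction \<open>A21\<close> are
  therefore always swappable.\<close>

lemma ell_A21_edge:
  assumes "\<mu> \<preceq> lam" "\<mu> - k *\<^sub>Z pos_root A21 \<preceq> lam" "1 \<le> k" "K = k - pairing \<mu> (coroot A21)" "1 \<le> K"
  shows "int (ell (gamma_index A21 K - 1) \<mu> lam) = int (ell (gamma_index A21 K - 1) (\<mu> - k *\<^sub>Z pos_root A21) lam) - 1"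
    "int (ell (gamma_index A21 K) (\<mu> - k *\<^sub>Z pos_root A21) lam) = int (ell (gamma_index A21 K) \<mu> lam) - 1"
proof -
  obtain l1 l2 where lam: "lam = (l1, l2)" by (cases lam)
  define x y where "x = fst \<mu> + snd \<mu>" and "y = snd \<mu>"
  have mu: "\<mu> = (x - y, y)" by (simp add: x_def y_def)
  have K: "k = x + y + K" using assms(4) by (simp add: pairing_def mu)
  let ?t = "\<mu> - k *\<^sub>Z pos_root A21"
  have t: "fst ?t + snd ?t = - y - K" "snd ?t = - x - K" by (simp_all add: mu zscale_def K)
  note E = ell_explicit_at[OF assms(1) x_def y_def]
  note F = ell_explicit_at[OF assms(2) t[symmetric]]
  have o: "axis_octagon l1 l2 x y" "axis_octagon l1 l2 y x"
    using assms(1) by (auto simp: weight_le_iff octagon_def axis_octagon_def lam mu algebra_simps)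
  have o': "axis_octagon l1 l2 (- y - K) (- x - K)" "axis_octagon l1 l2 (- x - K) (- y - K)"
    using assms(2) unfolding weight_le_iff octagon_def lam t axis_octagon_def fst_conv snd_conv
    by (auto simp: mu zscale_def K)
  define j where "j = nat (K - 1)"
  have j: "K = int j + 1" using assms(5) by (simp add: j_def)
  have i: "gamma_index A21 K = 2 * j + 1" using j by simp
  define l l' where "l = int (j div 2)" and "l' = int ((j + 1) div 2)"
  have lb: "level_bound (2 * j + 1 - 1) A2 = l" "level_bound (2 * j + 1 - 1) A12 = l'"
    "level_bound (2 * j + 1 - 1) A21 = K - 1" "level_bound (2 * j + 1) A2 = l" "level_bound (2 * j + 1) A12 = l'"
    "level_bound (2 * j + 1) A21 = K"
    unfolding level_bound.simps j l_def l'_def by presburger+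
  have ll: "l + l' = K - 1" "2 * l \<le> K" "2 * l' \<le> K" unfolding l_def l'_def j by presburger+
  have s: "1 \<le> y + x + K" "1 \<le> x + y + K" using K assms(3) by simp_all
  have ax: "axis_excess lam (- x - K + 2 * l) (- y - K) = axis_excess lam (y + 2 * l) x"
    "axis_excess lam (- y - K + 2 * l') (- x - K) = axis_excess lam (x + 2 * l') y"
    unfolding lam using axis_excess_reflect[OF o(1) o'(1) s(1) ll(2) assms(5)]
      axis_excess_reflect[OF o(2) o'(2) s(2) ll(3) assms(5)] by simp_all
  have b: "x + y + 2 * K \<le> l1 + 2 * l2" "- x - y \<le> l1 + 2 * l2" "- x \<le> l1 + l2" "- y \<le> l1 + l2"
     "x + K \<le> l1 + l2" "y + K \<le> l1 + l2"
    using o o' unfolding axis_octagon_def by linarith+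
  have dz: "diag_excess lam r d = 0" if "r \<le> l1 + 2 * l2" "r + d \<le> 2 * l1 + 2 * l2" "r - d \<le> 2 * l1 + 2 * l2" for r d
  proof -
    have "(r - l1 - 2 * l2) div 2 \<le> 0" using that(1) by linarith
    moreover have "(r - 2 * (l1 + l2) + \<bar>d\<bar>) div 2 \<le> 0"
    proof -
      have "r - 2 * (l1 + l2) + \<bar>d\<bar> \<le> 0" using that(2,3) by (simp add: abs_if)
      then show ?thesis by linarith
    qed
    ultimately show ?thesis by (simp add: diag_excess_def lam)
  qed
  have d: "diag_excess lam (x + y + 2 * (K - 1)) (x - y) = 0" "diag_excess lam (x + y + 2 * K) (x - y) = 0"
    "diag_excess lam (- y - K + (- x - K) + 2 * (K - 1)) (- y - K - (- x - K)) = 0"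
    "diag_excess lam (- y - K + (- x - K) + 2 * K) (- y - K - (- x - K)) = 0"
    using b assms(5) by (intro dz; simp)+
  have l': "l' = K - 1 - l" using ll(1) by simp
  have g: "gcount (- y - K - (- x - K)) = gcount (x - y)" "gcount (- x - K + l) = gcount (x + l')"
    "gcount (- y - K + l') = gcount (y + l)" "gcount (x + y + (K - 1)) = k - 1"
    "gcount (- y - K + (- x - K) + (K - 1)) = k" "gcount (x + y + K) = k" "gcount (- y - K + (- x - K) + K) = k - 1"
  proof -
    have "- x - K + l = - (x + l') - 1" "- y - K + l' = - (y + l) - 1" unfolding l' by simp_all
    then show "gcount (- x - K + l) = gcount (x + l')" "gcount (- y - K + l') = gcount (y + l)"
      by (simp_all only: gcount_flip)
    show "gcount (- y - K - (- x - K)) = gcount (x - y)" by simp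
    show "gcount (x + y + (K - 1)) = k - 1" "gcount (- y - K + (- x - K) + (K - 1)) = k"
      "gcount (x + y + K) = k" "gcount (- y - K + (- x - K) + K) = k - 1"
      using assms(3) unfolding gcount_def K by auto
  qed
  show "int (ell (gamma_index A21 K - 1) \<mu> lam) = int (ell (gamma_index A21 K - 1) ?t lam) - 1"
    unfolding i E F lb d g ax by linarith
  show "int (ell (gamma_index A21 K) ?t lam) = int (ell (gamma_index A21 K) \<mu> lam) - 1"
    unfolding i E F lb d g ax by linarith
qed

subsection \<open>Preatoms\<close>

lemma the_crystal_string:
  assumes "s \<in> strings lam"
  shows "(THE U. U \<in> crystal lam \<and> str2 U = s) \<in> crystal lam"
    "str2 (THE U. U \<in> crystal lam \<and> str2 U = s) = s"
proof -
  have "\<exists>!U. U \<in> crystal lam \<and> str2 U = s"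
    using ex_crystal_string[OF assms] str2_eq_iff by blast
  from theI'[OF this] show "(THE U. U \<in> crystal lam \<and> str2 U = s) \<in> crystal lam"
    "str2 (THE U. U \<in> crystal lam \<and> str2 U = s) = s" by auto
qed

lemma Phi:
  assumes "w \<in> crystal lam"
  shows "Phi lam w \<in> crystal (lam + 2 *\<^sub>Z varpi1)" "str2 (Phi lam w) = str2 w + (0, 1, 1, 1)"
    "wt (Phi lam w) = wt w"
proof -
  obtain a b c d where s: "str2 w = (a, b, c, d)" by (cases "str2 w")
  have "str2 w + (0, 1, 1, 1) \<in> strings (lam + 2 *\<^sub>Z varpi1)"
    using str2_crystal_subset[OF assms] by (simp add: s strings_def zscale_def)
  from the_crystal_string[OF this] show
    *: "Phi lam w \<in> crystal (lam + 2 *\<^sub>Z varpi1)" "str2 (Phi lam w) = str2 w + (0, 1, 1, 1)"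
    by (simp_all add: Phi_def)
  show "wt (Phi lam w) = wt w"
    using wt_crystal[OF *(1), of a "Suc b" "Suc c" "Suc d"] wt_crystal[OF assms s] *(2)
    by (simp add: s zscale_def prod_eq_iff)
qed

text \<open>Subtracting (0, 1, 1, 1) while passing to \<lambda> - 2\<varpi>_1 leaves the
  inequalities of \<open>strings\<close> as they are, except d \<ge> 0, d \<le> \<lambda>_1 and the
  bound on b. Each of these becomes strict, which is \<open>inner_string\<close>.\<close>

lemma Phi_image_iff:
  assumes "w \<in> crystal lam"
  shows "w \<in> Phi (lam - 2 *\<^sub>Z varpi1) ` crystal (lam - 2 *\<^sub>Z varpi1) \<longleftrightarrow> inner_string lam (str2 w)"
proof
  assume "w \<in> Phi (lam - 2 *\<^sub>Z varpi1) ` crystal (lam - 2 *\<^sub>Z varpi1)"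
  then obtain v where v: "v \<in> crystal (lam - 2 *\<^sub>Z varpi1)" "w = Phi (lam - 2 *\<^sub>Z varpi1) v" by blast
  obtain a b c d where s: "str2 v = (a, b, c, d)" by (cases "str2 v")
  show "inner_string lam (str2 w)"
    using str2_crystal_subset[OF v(1)] Phi(2)[OF v(1)]
    by (simp add: v(2) s strings_def inner_string_def zscale_def)
next
  assume i: "inner_string lam (str2 w)"
  obtain a b c d where s: "str2 w = (a, b, c, d)" by (cases "str2 w")
  have st: "(a, b - 1, c - 1, d - 1) \<in> strings (lam - 2 *\<^sub>Z varpi1)"
    and pos: "0 < d" "d \<le> c" "c \<le> b"
    using str2_crystal_subset[OF assms] i
    by (auto simp: s strings_def inner_string_def zscale_def of_nat_diff)
  obtain v where v: "v \<in> crystal (lam - 2 *\<^sub>Z varpi1)" "str2 v = (a, b - 1, c - 1, d - 1)"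
    using ex_crystal_string[OF st] by blast
  have "Phi (lam - 2 *\<^sub>Z varpi1) v = w"
    using Phi(1,2)[OF v(1)] assms pos by (subst str2_eq_iff[symmetric]) (simp_all add: v(2) s)
  then show "w \<in> Phi (lam - 2 *\<^sub>Z varpi1) ` crystal (lam - 2 *\<^sub>Z varpi1)" using v(1) by blast
qed

lemma preatom_iff: "w \<in> preatom \<kappa> \<longleftrightarrow> w \<in> crystal \<kappa> \<and> \<not> inner_string \<kappa> (str2 w)"
proof (cases "fst \<kappa> \<ge> 2")
  case True
  then show ?thesis using Phi_image_iff[of w \<kappa>] by (simp add: preatom_def) blast
next
  case False
  then have "\<not> inner_string \<kappa> (str2 w)" by (auto simp: inner_string_def split: prod.splits)
  then show ?thesis using False by (simp add: preatom_def)
qed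

lemma preatom_crystal: "w \<in> preatom \<kappa> \<Longrightarrow> w \<in> crystal \<kappa>"
  by (simp add: preatom_iff)

lemma s1_preatom: "w \<in> preatom \<kappa> \<Longrightarrow> s1 w \<in> preatom \<kappa>"
  by (simp add: preatom_iff s1_crystal inner_string_s1)

lemma inj_on_Phi: "inj_on (Phi lam) (crystal lam)"
proof (rule inj_onI)
  fix v w assume *: "v \<in> crystal lam" "w \<in> crystal lam" "Phi lam v = Phi lam w"
  then have "str2 v + (0, 1, 1, 1) = str2 w + (0, 1, 1, 1)" by (metis Phi(2))
  then have "str2 v = str2 w" by (cases "str2 v"; cases "str2 w") simp
  then show "v = w" using * str2_eq_iff by blast
qed

lemma zscale_simps [simp]: "fst (k *\<^sub>Z v) = k * fst v" "snd (k *\<^sub>Z v) = k * snd v"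
  by (simp_all add: zscale_def)

lemma Phi_pow:
  assumes "w \<in> crystal lam"
  shows "Phi_pow p lam w \<in> crystal (lam + (2 * int p) *\<^sub>Z varpi1)" "wt (Phi_pow p lam w) = wt w"
proof -
  have "Phi_pow p lam w \<in> crystal (lam + (2 * int p) *\<^sub>Z varpi1) \<and> wt (Phi_pow p lam w) = wt w"
  proof (induction p)
    case 0
    have "lam + (2 * int 0) *\<^sub>Z varpi1 = lam" by (simp add: prod_eq_iff)
    with assms show ?case by (simp only: Phi_pow.simps)
  next
    case (Suc p)
    have e: "lam + (2 * int p) *\<^sub>Z varpi1 + 2 *\<^sub>Z varpi1 = lam + (2 * int (Suc p)) *\<^sub>Z varpi1"
      by (simp add: prod_eq_iff)
    show ?case using Phi[of "Phi_pow p lam w" "lam + (2 * int p) *\<^sub>Z varpi1"] Suc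
      unfolding e Phi_pow.simps by simp
  qed
  then show "Phi_pow p lam w \<in> crystal (lam + (2 * int p) *\<^sub>Z varpi1)" "wt (Phi_pow p lam w) = wt w"
    by auto
qed

lemma inj_on_Phi_pow: "inj_on (Phi_pow p lam) (crystal lam)"
proof (induction p)
  case (Suc p)
  show ?case
  proof (rule inj_onI)
    fix v w assume *: "v \<in> crystal lam" "w \<in> crystal lam" "Phi_pow (Suc p) lam v = Phi_pow (Suc p) lam w"
    then have "Phi_pow p lam v = Phi_pow p lam w"
      using inj_onD[OF inj_on_Phi _ Phi_pow(1) Phi_pow(1)] by simp
    then show "v = w" using inj_onD[OF Suc _ *(1,2)] by simp
  qed
qed simp

lemma Phi_pow_add:
  "Phi_pow (p + q) lam w = Phi_pow p (lam + (2 * int q) *\<^sub>Z varpi1) (Phi_pow q lam w)"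
proof (induction p)
  case (Suc p)
  have e: "lam + (2 * int q) *\<^sub>Z varpi1 + (2 * int p) *\<^sub>Z varpi1 = lam + (2 * int (p + q)) *\<^sub>Z varpi1"
    by (simp add: prod_eq_iff)
  show ?case by (simp only: add_Suc Phi_pow.simps Suc e)
qed simp

text \<open>If the element were in the image of a higher power, cancelling the injective map
  \<Phi>^p would put w itself into the image of \<Phi>.\<close>

lemma pat_eq:
  assumes w: "w \<in> preatom \<kappa>"
  shows "pat (\<kappa> + (2 * int p) *\<^sub>Z varpi1) (Phi_pow p \<kappa> w) = p"
proof -
  let ?lam = "\<kappa> + (2 * int p) *\<^sub>Z varpi1"
  let ?K = "\<lambda>q. ?lam - (2 * int q) *\<^sub>Z varpi1"
  let ?A = "{q. Phi_pow p \<kappa> w \<in> Phi_pow q (?K q) ` crystal (?K q)}"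
  have "?K p = \<kappa>" by (simp add: prod_eq_iff)
  then have p: "p \<in> ?A" using w preatom_crystal by auto
  have "q \<le> p" if "q \<in> ?A" for q
  proof (rule ccontr)
    assume "\<not> q \<le> p"
    then obtain r where r: "q = p + Suc r" by (metis not_le less_imp_Suc_add add_Suc_right)
    from that obtain v where v: "v \<in> crystal (?K q)" "Phi_pow p \<kappa> w = Phi_pow q (?K q) v" by blast
    have K: "?K q + (2 * int (Suc r)) *\<^sub>Z varpi1 = \<kappa>" by (simp add: r prod_eq_iff)
    have "Phi_pow q (?K q) v = Phi_pow p \<kappa> (Phi_pow (Suc r) (?K q) v)"
      using Phi_pow_add[of p "Suc r" "?K q" v] unfolding K r[symmetric] .
    moreover have "Phi_pow (Suc r) (?K q) v \<in> crystal \<kappa>"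
      using Phi_pow(1)[OF v(1), of "Suc r"] by (simp only: K)
    ultimately have "w = Phi_pow (Suc r) (?K q) v"
      using v(2) inj_on_Phi_pow preatom_crystal[OF w] by (metis inj_onD)
    moreover have K': "?K q + (2 * int r) *\<^sub>Z varpi1 = \<kappa> - 2 *\<^sub>Z varpi1" by (simp add: r prod_eq_iff)
    ultimately have "w \<in> Phi (\<kappa> - 2 *\<^sub>Z varpi1) ` crystal (\<kappa> - 2 *\<^sub>Z varpi1)"
      using Phi_pow(1)[OF v(1), of r] by (auto simp only: Phi_pow.simps K')
    then show False using w Phi_image_iff[of w \<kappa>] by (simp add: preatom_iff)
  qed
  moreover have "finite ?A" by (rule finite_subset[of _ "{..p}"]) (use calculation in auto)
  ultimately show ?thesis unfolding pat_def using p by (intro Max_eqI) blast+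
qed

subsection \<open>Atoms\<close>

definition preatom_strings :: "weight \<Rightarrow> (nat \<times> nat \<times> nat \<times> nat) set" where
  "preatom_strings \<kappa> = {s \<in> strings \<kappa>. \<not> inner_string \<kappa> s}"

lemma preatom_strings_iff:
  "(a, b, c, d) \<in> preatom_strings \<kappa> \<longleftrightarrow> (a, b, c, d) \<in> strings \<kappa> \<and>
     (d = 0 \<or> int d = fst \<kappa> \<or> int b = fst \<kappa> + 2 * int c - 2 * int d)"
  by (auto simp: preatom_strings_def strings_def inner_string_def)

lemma str2_preatom: "w \<in> preatom \<kappa> \<Longrightarrow> str2 w \<in> preatom_strings \<kappa>"
  by (simp add: preatom_strings_def preatom_iff str2_crystal_subset)

lemma ex_preatom_string: "s \<in> preatom_strings \<kappa> \<Longrightarrow> \<exists>w \<in> preatom \<kappa>. str2 w = s"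
  using ex_crystal_string by (fastforce simp: preatom_strings_def preatom_iff)

lemma str2_eq_iff_preatom: "v \<in> preatom \<kappa> \<Longrightarrow> w \<in> preatom \<kappa> \<Longrightarrow> str2 v = str2 w \<longleftrightarrow> v = w"
  by (simp add: preatom_crystal str2_eq_iff[of v \<kappa> w])

lemma the_preatom_string:
  assumes "s \<in> preatom_strings \<kappa>"
  shows "(THE U. U \<in> preatom \<kappa> \<and> str2 U = s) \<in> preatom \<kappa>"
    "str2 (THE U. U \<in> preatom \<kappa> \<and> str2 U = s) = s"
proof -
  have "\<exists>!U. U \<in> preatom \<kappa> \<and> str2 U = s"
    using ex_preatom_string[OF assms] str2_eq_iff_preatom by blast
  from theI'[OF this] show "(THE U. U \<in> preatom \<kappa> \<and> str2 U = s) \<in> preatom \<kappa>"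
    "str2 (THE U. U \<in> preatom \<kappa> \<and> str2 U = s) = s" by auto
qed

fun psi_string :: "weight \<Rightarrow> nat \<times> nat \<times> nat \<times> nat \<Rightarrow> nat \<times> nat \<times> nat \<times> nat" where
  "psi_string \<kappa> (a, b, c, d) =
     (if int d \<in> {0, fst \<kappa>} then (a, b + 1, c + 1, d) else (a, b, c + 1, d + 1))"

lemma psi_string_preatom:
  "s \<in> preatom_strings \<kappa> \<Longrightarrow> psi_string \<kappa> s \<in> preatom_strings (\<kappa> + varpi2)"
  by (cases s) (auto simp: preatom_strings_iff strings_def)

text \<open>Only a string with d = \<kappa>_1 could come from both branches. There the second branch
  attains the upper bound for b and the first stays below it.\<close>

lemma inj_on_psi_string: "inj_on (psi_string \<kappa>) (preatom_strings \<kappa>)"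
  by (rule inj_onI) (auto simp: preatom_strings_iff strings_def split: if_splits)

lemma Psi:
  assumes "w \<in> preatom \<kappa>"
  shows "Psi \<kappa> w \<in> preatom (\<kappa> + varpi2)" "str2 (Psi \<kappa> w) = psi_string \<kappa> (str2 w)"
    "wt (Psi \<kappa> w) = wt w"
proof -
  obtain a b c d where s: "str2 w = (a, b, c, d)" by (cases "str2 w")
  have "psi_string \<kappa> (str2 w) \<in> preatom_strings (\<kappa> + varpi2)"
    using str2_preatom[OF assms] by (rule psi_string_preatom)
  from the_preatom_string[OF this] show
    *: "Psi \<kappa> w \<in> preatom (\<kappa> + varpi2)" "str2 (Psi \<kappa> w) = psi_string \<kappa> (str2 w)"
    by (simp_all add: Psi_def s)
  obtain a' b' c' d' where s': "str2 (Psi \<kappa> w) = (a', b', c', d')" by (cases "str2 (Psi \<kappa> w)")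
  show "wt (Psi \<kappa> w) = wt w"
    using wt_crystal[OF preatom_crystal[OF *(1)] s'] wt_crystal[OF preatom_crystal[OF assms] s] *(2) s'
    by (auto simp: s prod_eq_iff split: if_splits)
qed

lemma inj_on_Psi: "inj_on (Psi \<kappa>) (preatom \<kappa>)"
proof (rule inj_onI)
  fix v w assume *: "v \<in> preatom \<kappa>" "w \<in> preatom \<kappa>" "Psi \<kappa> v = Psi \<kappa> w"
  then have "psi_string \<kappa> (str2 v) = psi_string \<kappa> (str2 w)" by (metis Psi(2))
  then have "str2 v = str2 w" using * str2_preatom inj_on_psi_string by (metis inj_onD)
  then show "v = w" using * str2_eq_iff_preatom by blast
qed

lemma fst_refl1 [simp]: "fst (refl1 \<mu>) = - fst \<mu>"
  by (cases \<mu>) simp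

lemma refl1_refl1 [simp]: "refl1 (refl1 \<mu>) = \<mu>"
  by (cases \<mu>) simp

lemma Psibar:
  assumes "w \<in> preatom \<kappa>"
  shows "Psibar \<kappa> w \<in> preatom (\<kappa> + varpi2)" "wt (Psibar \<kappa> w) = wt w"
  using Psi[OF assms] Psi[OF s1_preatom[OF assms]] by (simp_all add: Psibar_def s1_preatom wt_s1)

lemma inj_on_Psibar: "inj_on (Psibar \<kappa>) (preatom \<kappa>)"
proof (rule inj_onI)
  fix v w assume *: "v \<in> preatom \<kappa>" "w \<in> preatom \<kappa>" "Psibar \<kappa> v = Psibar \<kappa> w"
  then have wt: "wt v = wt w" by (metis Psibar(2))
  show "v = w"
  proof (cases "fst (wt v) \<le> 0")
    case True
    then show ?thesis using * wt inj_onD[OF inj_on_Psi _ *(1,2)] by (simp add: Psibar_def)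
  next
    case False
    then have "Psi \<kappa> (s1 v) = Psi \<kappa> (s1 w)" using * wt by (simp add: Psibar_def) (metis s1_s1)
    then have "s1 v = s1 w" using * s1_preatom inj_on_Psi by (metis inj_onD)
    then show ?thesis by (metis s1_s1)
  qed
qed

lemma Psibar_pow:
  assumes "w \<in> preatom \<kappa>"
  shows "Psibar_pow a \<kappa> w \<in> preatom (\<kappa> + int a *\<^sub>Z varpi2)" "wt (Psibar_pow a \<kappa> w) = wt w"
proof -
  have "Psibar_pow a \<kappa> w \<in> preatom (\<kappa> + int a *\<^sub>Z varpi2) \<and> wt (Psibar_pow a \<kappa> w) = wt w"
  proof (induction a)
    case 0
    have "\<kappa> + int 0 *\<^sub>Z varpi2 = \<kappa>" by (simp add: prod_eq_iff)
    with assms show ?case by (simp only: Psibar_pow.simps)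
  next
    case (Suc a)
    have e: "\<kappa> + int a *\<^sub>Z varpi2 + varpi2 = \<kappa> + int (Suc a) *\<^sub>Z varpi2"
      by (simp add: prod_eq_iff)
    show ?case using Psibar[of "Psibar_pow a \<kappa> w" "\<kappa> + int a *\<^sub>Z varpi2"] Suc
      unfolding e Psibar_pow.simps by simp
  qed
  then show "Psibar_pow a \<kappa> w \<in> preatom (\<kappa> + int a *\<^sub>Z varpi2)" "wt (Psibar_pow a \<kappa> w) = wt w"
    by auto
qed

lemma inj_on_Psibar_pow: "inj_on (Psibar_pow a \<kappa>) (preatom \<kappa>)"
proof (induction a)
  case (Suc a)
  show ?case
  proof (rule inj_onI)
    fix v w assume *: "v \<in> preatom \<kappa>" "w \<in> preatom \<kappa>" "Psibar_pow (Suc a) \<kappa> v = Psibar_pow (Suc a) \<kappa> w"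
    then have "Psibar_pow a \<kappa> v = Psibar_pow a \<kappa> w"
      using inj_onD[OF inj_on_Psibar _ Psibar_pow(1) Psibar_pow(1)] by simp
    then show "v = w" using inj_onD[OF Suc _ *(1,2)] by simp
  qed
qed simp

lemma Psibar_pow_add:
  "Psibar_pow (a + b) \<kappa> w = Psibar_pow a (\<kappa> + int b *\<^sub>Z varpi2) (Psibar_pow b \<kappa> w)"
proof (induction a)
  case (Suc a)
  have e: "\<kappa> + int b *\<^sub>Z varpi2 + int a *\<^sub>Z varpi2 = \<kappa> + int (a + b) *\<^sub>Z varpi2"
    by (simp add: prod_eq_iff)
  show ?case by (simp only: add_Suc Psibar_pow.simps Suc e)
qed simp

text \<open>Makes one formula, \<open>atom_alt\<close>, out of the two cases of
  \<open>atom\<close>.\<close>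

definition atom_step :: "weight \<Rightarrow> nat" where
  "atom_step \<kappa> = (if fst \<kappa> > 0 then 1 else 2)"

lemma atom_alt:
  "atom \<kappa> = preatom \<kappa> - Psibar_pow (atom_step \<kappa>) (\<kappa> - int (atom_step \<kappa>) *\<^sub>Z varpi2)
     ` preatom (\<kappa> - int (atom_step \<kappa>) *\<^sub>Z varpi2)"
proof -
  have e: "int 1 *\<^sub>Z varpi2 = varpi2" "\<kappa> - varpi2 + int 0 *\<^sub>Z varpi2 = \<kappa> - varpi2"
    by (simp_all add: zscale_def prod_eq_iff)
  have "Psibar_pow 1 (\<kappa> - varpi2) = Psibar (\<kappa> - varpi2)"
    unfolding One_nat_def by (rule ext) (simp only: Psibar_pow.simps e)
  then show ?thesis using e(1) by (simp add: atom_def atom_step_def)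
qed

text \<open>The cancellation argument of \<open>pat_eq\<close> again. An admissible exponent above a
  exceeds it by at least \<open>atom_step\<close>, by parity if \<kappa>_1 = 0, so w would lie in
  the image that is removed from the atom.\<close>

lemma atomic_number_preatom_eq:
  assumes w: "w \<in> atom (\<kappa> - int a *\<^sub>Z varpi2)" and a: "atom_exponent \<kappa> a" and dom: "dominant \<kappa>"
  shows "atomic_number_preatom \<kappa> (Psibar_pow a (\<kappa> - int a *\<^sub>Z varpi2) w) = a"
proof -
  let ?K = "\<lambda>b. \<kappa> - int b *\<^sub>Z varpi2"
  let ?W = "Psibar_pow a (?K a) w"
  let ?A = "{b. atom_exponent \<kappa> b \<and> ?W \<in> Psibar_pow b (?K b) ` preatom (?K b)}"
  define t where "t = atom_step \<kappa>"
  have t: "atom_step (?K a) = t" "0 < t" by (simp_all add: t_def atom_step_def)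
  have wp: "w \<in> preatom (?K a)" using w by (simp add: atom_alt)
  have aA: "a \<in> ?A" using a wp by auto
  have "b \<le> a" if "b \<in> ?A" for b
  proof (rule ccontr)
    assume "\<not> b \<le> a"
    from that have b: "atom_exponent \<kappa> b" by blast
    have "\<exists>r. b = a + (t + r)"
    proof (cases "fst \<kappa> > 0")
      case True
      then show ?thesis using \<open>\<not> b \<le> a\<close> by (intro exI[of _ "b - a - 1"]) (simp add: t_def atom_step_def)
    next
      case False
      then have "even a" "even b" using a b dom by (auto simp: atom_exponent_def dominant_def)
      then have "b \<ge> a + 2" using \<open>\<not> b \<le> a\<close> by presburger
      then show ?thesis using False by (intro exI[of _ "b - a - 2"]) (simp add: t_def atom_step_def)
    qed
    then obtain r where r: "b = a + (t + r)" by blast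
    from that obtain v where v: "v \<in> preatom (?K b)" "?W = Psibar_pow b (?K b) v" by blast
    have K: "?K b + int (t + r) *\<^sub>Z varpi2 = ?K a" "?K b + int r *\<^sub>Z varpi2 = ?K a - int t *\<^sub>Z varpi2"
      by (simp_all add: r prod_eq_iff)
    have "Psibar_pow b (?K b) v = Psibar_pow a (?K a) (Psibar_pow (t + r) (?K b) v)"
      using Psibar_pow_add[of a "t + r" "?K b" v] unfolding K r[symmetric] .
    moreover have "Psibar_pow (t + r) (?K b) v \<in> preatom (?K a)"
      using Psibar_pow(1)[OF v(1), of "t + r"] by (simp only: K)
    ultimately have "w = Psibar_pow (t + r) (?K b) v"
      using v(2) inj_on_Psibar_pow wp by (metis inj_onD)
    also have "\<dots> = Psibar_pow t (?K a - int t *\<^sub>Z varpi2) (Psibar_pow r (?K b) v)"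
      using Psibar_pow_add[of t r "?K b" v] by (simp only: K)
    finally have "w \<in> Psibar_pow t (?K a - int t *\<^sub>Z varpi2) ` preatom (?K a - int t *\<^sub>Z varpi2)"
      using Psibar_pow(1)[OF v(1), of r] by (simp only: K) blast
    then show False using w by (simp add: atom_alt t)
  qed
  moreover have "finite ?A" by (rule finite_subset[of _ "{..a}"]) (use calculation in auto)
  ultimately show ?thesis unfolding atomic_number_preatom_def using aA by (intro Max_eqI) blast+
qed

section \<open>Atoms as sets of strings\<close>

lemma psi_string_power_fst: "fst \<kappa> = fst \<nu> \<Longrightarrow> psi_string \<kappa> = psi_string \<nu>"
  by (rule ext) auto

lemma str2_Psibar_pow:
  assumes "w \<in> preatom \<kappa>" "fst (wt w) \<le> 0"
  shows "str2 (Psibar_pow a \<kappa> w) = (psi_string \<kappa> ^^ a) (str2 w)"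
proof (induction a)
  case (Suc a)
  have "str2 (Psibar_pow (Suc a) \<kappa> w) = psi_string (\<kappa> + int a *\<^sub>Z varpi2) (str2 (Psibar_pow a \<kappa> w))"
    using assms Psibar_pow[OF assms(1), of a] Psi(2) by (simp add: Psibar_def)
  also have "psi_string (\<kappa> + int a *\<^sub>Z varpi2) = psi_string \<kappa>" by (rule psi_string_power_fst) simp
  finally show ?case using Suc by simp
qed simp

definition atom_strings :: "weight \<Rightarrow> (nat \<times> nat \<times> nat \<times> nat) set" where
  "atom_strings \<kappa> = preatom_strings \<kappa> -
     (psi_string \<kappa> ^^ atom_step \<kappa>) ` preatom_strings (\<kappa> - int (atom_step \<kappa>) *\<^sub>Z varpi2)"

fun string_wt :: "weight \<Rightarrow> nat \<times> nat \<times> nat \<times> nat \<Rightarrow> weight" where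
  "string_wt lam (a, b, c, d) = lam - (int b + int d) *\<^sub>Z (2, -1) - (int a + int c) *\<^sub>Z (-2, 2)"

lemma wt_crystal_string: "w \<in> crystal lam \<Longrightarrow> wt w = string_wt lam (str2 w)"
  by (cases "str2 w") (simp add: wt_crystal)

lemma string_wt_psi_string: "string_wt (\<kappa> + varpi2) (psi_string \<nu> s) = string_wt \<kappa> s"
  by (induction s rule: prod_induct4) (simp add: prod_eq_iff)

lemma string_wt_zero: "string_wt (\<kappa> + 0 *\<^sub>Z varpi2) s = string_wt \<kappa> s"
  by (induction s rule: prod_induct4) (simp add: prod_eq_iff)

text \<open>\<open>Psibar\<close> preserves weights, so every possible preimage has nonpositive
  first coordinate as well. There \<open>Psibar\<close> is \<open>Psi\<close>, and strings decide
  membership in the image.\<close>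

lemma atom_iff_string:
  assumes "fst (wt w) \<le> 0"
  shows "w \<in> atom \<kappa> \<longleftrightarrow> w \<in> preatom \<kappa> \<and> str2 w \<in> atom_strings \<kappa>"
proof -
  define t K where "t = atom_step \<kappa>" and "K = \<kappa> - int t *\<^sub>Z varpi2"
  have K: "K + int t *\<^sub>Z varpi2 = \<kappa>" by (simp add: K_def)
  have psi: "psi_string K = psi_string \<kappa>" by (rule psi_string_power_fst) (simp add: K_def)
  have "w \<in> Psibar_pow t K ` preatom K \<longleftrightarrow> str2 w \<in> (psi_string \<kappa> ^^ t) ` preatom_strings K"
    if w: "w \<in> preatom \<kappa>"
  proof
    assume "w \<in> Psibar_pow t K ` preatom K"
    then obtain v where v: "v \<in> preatom K" "w = Psibar_pow t K v" by blast
    then have "fst (wt v) \<le> 0" using assms Psibar_pow(2) by simp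
    from str2_Psibar_pow[OF v(1) this, of t] show "str2 w \<in> (psi_string \<kappa> ^^ t) ` preatom_strings K"
      using v str2_preatom by (simp add: psi)
  next
    assume "str2 w \<in> (psi_string \<kappa> ^^ t) ` preatom_strings K"
    then obtain s where s: "s \<in> preatom_strings K" "str2 w = (psi_string \<kappa> ^^ t) s" by blast
    then obtain v where v: "v \<in> preatom K" "str2 v = s" using ex_preatom_string by blast
    have wtv: "wt v = wt w"
    proof -
      have "string_wt (K + int n *\<^sub>Z varpi2) ((psi_string \<kappa> ^^ n) s) = string_wt K s" for n
      proof (induction n)
        case (Suc n)
        have e: "K + int (Suc n) *\<^sub>Z varpi2 = K + int n *\<^sub>Z varpi2 + varpi2" by (simp add: prod_eq_iff)
        show ?case unfolding e funpow.simps comp_apply string_wt_psi_string by (rule Suc)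
      qed (simp add: string_wt_zero)
      from this[of t] show ?thesis
        using wt_crystal_string[OF preatom_crystal[OF v(1)]] wt_crystal_string[OF preatom_crystal[OF w]] v(2) s(2)
        by (simp add: K)
    qed
    then have "str2 (Psibar_pow t K v) = str2 w"
      using str2_Psibar_pow[OF v(1), of t] assms s(2) v(2) by (simp add: psi)
    then have "Psibar_pow t K v = w"
      using Psibar_pow(1)[OF v(1), of t] w str2_eq_iff_preatom unfolding K by blast
    then show "w \<in> Psibar_pow t K ` preatom K" using v(1) by blast
  qed
  then show ?thesis
    unfolding atom_alt atom_strings_def t_def[symmetric] K_def[symmetric] using str2_preatom by blast
qed

text \<open>Off the wall the two branches of \<open>Psibar\<close> are conjugate under
  \<open>s1\<close> by definition.\<close>

lemma s1_Psibar:
  assumes "fst (wt w) \<noteq> 0"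
  shows "Psibar \<kappa> (s1 w) = s1 (Psibar \<kappa> w)"
  using assms by (auto simp: Psibar_def wt_s1)

lemma s1_Psibar_pow:
  assumes "w \<in> preatom \<kappa>" "fst (wt w) \<noteq> 0"
  shows "Psibar_pow a \<kappa> (s1 w) = s1 (Psibar_pow a \<kappa> w)"
  using assms by (induction a) (auto simp: s1_Psibar Psibar_pow(2))

lemma s1_atom:
  assumes "w \<in> atom \<kappa>" "fst (wt w) \<noteq> 0"
  shows "s1 w \<in> atom \<kappa>"
proof -
  define t K where "t = atom_step \<kappa>" and "K = \<kappa> - int t *\<^sub>Z varpi2"
  have w: "w \<in> preatom \<kappa>" "w \<notin> Psibar_pow t K ` preatom K"
    using assms(1) by (auto simp: atom_alt t_def K_def)
  have "s1 w \<notin> Psibar_pow t K ` preatom K"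
  proof
    assume "s1 w \<in> Psibar_pow t K ` preatom K"
    then obtain v where v: "v \<in> preatom K" "s1 w = Psibar_pow t K v" by blast
    then have "wt v = refl1 (wt w)" using Psibar_pow(2) by (metis wt_s1)
    then have "w = Psibar_pow t K (s1 v)"
      using s1_Psibar_pow[OF v(1)] assms(2) v(2) by (metis fst_refl1 neg_equal_0_iff_equal s1_s1)
    then show False using w(2) s1_preatom[OF v(1)] by blast
  qed
  then show ?thesis using s1_preatom[OF w(1)] by (simp add: atom_alt t_def K_def)
qed

text \<open>A preatom string is removed exactly if inverting \<open>psi_string\<close> gives a
  preatom string for \<kappa> - \<varpi>_2. What is left is a path in the (c, d)-plane along which b
  + d increases, which is why a weight occurs only once.\<close>

lemma atom_strings_pos:
  assumes "fst \<kappa> > 0"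
  shows "(a, b, c, d) \<in> atom_strings \<kappa> \<longleftrightarrow> (a, b, c, d) \<in> strings \<kappa> \<and>
    (if d = 0 then c = 0 \<or> int b = fst \<kappa> + 2 * int c
     else int b = fst \<kappa> + 2 * int c - 2 * int d \<and> (d = 1 \<or> int c = snd \<kappa> + int d))"
    (is "?L \<longleftrightarrow> ?R")
proof -
  let ?K = "\<kappa> - varpi2"
  have K: "int 1 *\<^sub>Z varpi2 = varpi2" by (simp add: zscale_def)
  have L: "?L \<longleftrightarrow> (a, b, c, d) \<in> preatom_strings \<kappa> \<and> (a, b, c, d) \<notin> psi_string \<kappa> ` preatom_strings ?K"
    using assms K by (simp add: atom_strings_def atom_step_def)
  show ?thesis
  proof
    assume l: ?L
    then have s: "(a, b, c, d) \<in> strings \<kappa>" "d = 0 \<or> int d = fst \<kappa> \<or> int b = fst \<kappa> + 2 * int c - 2 * int d"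
      by (simp_all add: L preatom_strings_iff)
    have n: "psi_string \<kappa> t = (a, b, c, d) \<Longrightarrow> t \<in> preatom_strings ?K \<Longrightarrow> False" for t
      using l by (metis L image_eqI)
    consider "d = 0" "c = 0" | "d = 0" "c > 0" | "0 < d" "int d = fst \<kappa>" "int b < fst \<kappa> + 2 * int c - 2 * int d"
      | "0 < d" "int b = fst \<kappa> + 2 * int c - 2 * int d"
      using s by (fastforce simp: strings_def)
    then show ?R
    proof cases
      case 1
      then show ?thesis using s by simp
    next
      case 2
      have "int b = fst \<kappa> + 2 * int c"
      proof (rule ccontr)
        assume "int b \<noteq> fst \<kappa> + 2 * int c"
        then show False using n[of "(a, b - 1, c - 1, 0)"] s(1) 2 diff_le_mono[of c b "Suc 0"]
          by (auto simp: preatom_strings_iff strings_def of_nat_diff)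
      qed
      then show ?thesis using s(1) 2 by simp
    next
      case 3
      have "d \<le> c - 1" "c - 1 \<le> b - 1" using 3 s(1) by (auto simp: strings_def)
      then show ?thesis using n[of "(a, b - 1, c - 1, d)"] s(1) 3
        by (auto simp: preatom_strings_iff strings_def of_nat_diff)
    next
      case 4
      show ?thesis
      proof (cases "d = 1 \<or> int c = snd \<kappa> + int d")
        case True
        then show ?thesis using 4 s by auto
      next
        case False
        have "d - 1 \<le> c - 1" "c - 1 \<le> b" using s(1) by (auto simp: strings_def)
        with False have False using n[of "(a, b, c - 1, d - 1)"] s(1) 4
          by (auto simp: preatom_strings_iff strings_def of_nat_diff)
        then show ?thesis ..
      qed
    qed
  next
    assume r: ?R
    have False if t: "t \<in> preatom_strings ?K" "psi_string \<kappa> t = (a, b, c, d)" for t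
    proof -
      obtain a' b' c' d' where t': "t = (a', b', c', d')" by (cases t)
      show False using t r unfolding t'
        by (auto simp: preatom_strings_iff strings_def split: if_splits)
    qed
    then have "(a, b, c, d) \<notin> psi_string \<kappa> ` preatom_strings ?K"
      by (metis imageE)
    then show ?L unfolding L using r by (simp add: preatom_strings_iff split: if_splits)
  qed
qed

text \<open>Here d = 0, and two applications of \<open>psi_string\<close> raise b and c by 2.
  Together with b \<le> 2c from \<open>strings\<close> the condition leaves only the upper half of b
  for c.\<close>

lemma atom_strings_0:
  assumes "fst \<kappa> = 0"
  shows "(a, b, c, d) \<in> atom_strings \<kappa> \<longleftrightarrow> (a, b, c, d) \<in> strings \<kappa> \<and> 2 * c \<le> b + 1"
    (is "?L \<longleftrightarrow> ?R")
proof -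
  let ?K = "\<kappa> - 2 *\<^sub>Z varpi2"
  have L: "?L \<longleftrightarrow> (a, b, c, d) \<in> preatom_strings \<kappa> \<and>
      (a, b, c, d) \<notin> (psi_string \<kappa> ^^ 2) ` preatom_strings ?K"
    using assms by (simp add: atom_strings_def atom_step_def)
  have two: "(psi_string \<kappa> ^^ 2) t = psi_string \<kappa> (psi_string \<kappa> t)" for t
    by (simp add: numeral_2_eq_2)
  show ?thesis
  proof
    assume l: ?L
    then have s: "(a, b, c, d) \<in> strings \<kappa>" by (simp add: L preatom_strings_iff)
    have d: "d = 0" using s assms by (simp add: strings_def)
    have n: "psi_string \<kappa> (psi_string \<kappa> t) = (a, b, c, d) \<Longrightarrow> t \<in> preatom_strings ?K \<Longrightarrow> False" for t
      using l L two by (metis image_eqI)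
    have "2 * c \<le> b + 1"
    proof (rule ccontr)
      assume *: "\<not> 2 * c \<le> b + 1"
      then have c: "2 \<le> c" "c \<le> b" using s by (auto simp: strings_def)
      then obtain c' b' where cb: "c = c' + 2" "b = b' + 2" by (metis add.commute le_Suc_ex le_trans)
      show False using n[of "(a, b', c', 0)"] s * assms d unfolding cb
        by (auto simp: preatom_strings_iff strings_def)
    qed
    then show ?R using s by simp
  next
    assume r: ?R
    have d: "d = 0" using r assms by (simp add: strings_def)
    have False if t: "t \<in> preatom_strings ?K" "psi_string \<kappa> (psi_string \<kappa> t) = (a, b, c, d)" for t
    proof -
      obtain a' b' c' d' where t': "t = (a', b', c', d')" by (cases t)
      show False using t r assms unfolding t'
        by (auto simp: preatom_strings_iff strings_def split: if_splits)
    qed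
    then have "(a, b, c, d) \<notin> (psi_string \<kappa> ^^ 2) ` preatom_strings ?K"
      by (metis imageE two)
    then show ?L unfolding L using r d by (simp add: preatom_strings_iff)
  qed
qed

lemma ex_atom_string:
  assumes "\<mu> \<preceq> \<kappa>"
  shows "\<exists>s \<in> atom_strings \<kappa>. string_wt \<kappa> s = \<mu>"
proof -
  obtain k1 k2 where \<kappa>: "\<kappa> = (k1, k2)" by (cases \<kappa>)
  obtain x y where \<mu>: "\<mu> = (x, y)" by (cases \<mu>)
  have dom: "0 \<le> k1" "0 \<le> k2" and oct: "\<bar>x + y\<bar> \<le> k1 + k2" "\<bar>y\<bar> \<le> k1 + k2" "\<bar>x + y\<bar> + \<bar>y\<bar> \<le> k1 + 2 * k2"
    and par: "even (x - k1)"
    using assms by (simp_all add: weight_le_iff \<kappa> \<mu> dominant_def octagon_def)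
  have "even (k1 - x)" using par by presburger
  then obtain j where j: "k1 - x = 2 * j" by (elim evenE)
  \<comment> \<open>The coefficients of \<alpha>_1 and \<alpha>_2 in \<kappa> - \<mu>, which are b +
    d and a + c for a string of weight \<mu>.\<close>
  define N1 N2 where "N1 = nat (k1 + k2 - x - y)" and "N2 = nat (k2 - y + j)"
  have N: "int N1 = k1 + k2 - x - y" "int N2 = k2 - y + j"
    using oct j by (simp_all add: N1_def N2_def)
  have wt: "string_wt \<kappa> (a, b, c, d) = \<mu> \<longleftrightarrow> b + d = N1 \<and> a + c = N2" for a b c d
  proof -
    have *: "k1 - P * 2 + Q * 2 = x \<and> k2 + P - Q * 2 = y \<longleftrightarrow> P = k1 + k2 - x - y \<and> Q = k2 - y + j" for P Q
      using j by presburger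
    have "string_wt \<kappa> (a, b, c, d) = \<mu> \<longleftrightarrow> int b + int d = int N1 \<and> int a + int c = int N2"
      unfolding N *[symmetric] by (simp add: \<kappa> \<mu> zscale_def algebra_simps)
    then show ?thesis by linarith
  qed
  have "\<exists>a b c d. (a, b, c, d) \<in> atom_strings \<kappa> \<and> b + d = N1 \<and> a + c = N2"
  proof (cases "0 < k1")
    case True
    then have k: "0 < fst \<kappa>" by (simp add: \<kappa>)
    \<comment> \<open>The stretches of the path of \<open>atom_strings_pos\<close>, ordered by N1 =
      b + d: first c = d = 0, then c grows up to \<kappa>_2 with d alternating between 1 and 0,
      finally c = \<kappa>_2 + d.\<close>
    consider "int N1 \<le> k1" | c where "int N1 = k1 + 2 * int c" "int c \<le> k2"
      | c where "int N1 = k1 + 2 * int c - 1" "int c \<le> k2" "0 < c" | d where "int N1 = k1 + 2 * k2 + int d" "0 < d"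
    proof (cases "int N1 \<le> k1 \<or> k1 + 2 * k2 < int N1")
      case True
      then show thesis using that(1) that(4)[of "nat (int N1 - k1 - 2 * k2)"] by fastforce
    next
      case False
      define q where "q = nat ((int N1 - k1) div 2)"
      have q: "int q = (int N1 - k1) div 2" using False by (simp add: q_def)
      have "int N1 - k1 = 2 * int q \<or> int N1 - k1 = 2 * int q + 1" unfolding q by presburger
      then show thesis
      proof
        assume "int N1 - k1 = 2 * int q"
        then show thesis using that(2)[of q] False by linarith
      next
        assume *: "int N1 - k1 = 2 * int q + 1"
        then have "int (Suc q) \<le> k2" using False by presburger
        then show thesis using that(3)[of "Suc q"] * by simp
      qed
    qed
    then show ?thesis
    proof cases
      case 1
      then have "(N2, N1, 0, 0) \<in> atom_strings \<kappa>"
        unfolding atom_strings_pos[OF k] using dom oct N j by (simp add: strings_def \<kappa>)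
      then show ?thesis by fastforce
    next
      case (2 c)
      have "c \<le> N2" using 2 dom oct N j by linarith
      then have "(N2 - c, N1, c, 0) \<in> atom_strings \<kappa>"
        unfolding atom_strings_pos[OF k] using 2 dom oct N j by (simp add: strings_def \<kappa> of_nat_diff)
      then show ?thesis using \<open>c \<le> N2\<close> by fastforce
    next
      case (3 c)
      \<comment> \<open>Parity makes the octagon bound on y strict; the upper bound for a needs this
        extra unit.\<close>
      have "y \<noteq> - k1 - k2" using 3(1) N(1) j by presburger
      then have y: "- y < k1 + k2" using oct(2) by linarith
      have "c \<le> N2" "1 \<le> N1" using 3 dom oct N j True by linarith+
      then have "(N2 - c, N1 - 1, c, 1) \<in> atom_strings \<kappa>"
        unfolding atom_strings_pos[OF k] using 3 dom oct N j True y
        by (simp add: strings_def \<kappa> of_nat_diff)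
      then show ?thesis using \<open>c \<le> N2\<close> \<open>1 \<le> N1\<close> by fastforce
    next
      case (4 d)
      define c where "c = nat k2 + d"
      have c: "int c = k2 + int d" using dom by (simp add: c_def)
      have cd: "c \<le> N2" "d \<le> N1" "c + d \<le> N1" "int d \<le> j" "int d \<le> k1"
        using 4 dom oct N j c by linarith+
      then have "(N2 - c, N1 - d, c, d) \<in> atom_strings \<kappa>"
        unfolding atom_strings_pos[OF k] using 4 dom N j True c cd by (simp add: strings_def \<kappa> of_nat_diff)
      then show ?thesis using cd by fastforce
    qed
  next
    case False
    then have k: "fst \<kappa> = 0" and k1: "k1 = 0" using dom by (simp_all add: \<kappa>)
    define c where "c = (N1 + 1) div 2"
    have c: "2 * c = N1 \<or> 2 * c = N1 + 1" unfolding c_def by linarith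
    have "2 * c \<le> N1 + 1" unfolding c_def by linarith
    then have "2 * int c \<le> 2 * k2 + 1" "2 * int c \<le> 2 * (j + k2) + 1"
      using N(1) j k1 abs_le_D2[OF oct(1)] abs_le_D2[OF oct(2)] by presburger+
    then have bd: "int c \<le> k2" "int c \<le> j + k2" by presburger+
    have "c \<le> N2" using c dom oct N j k1 by linarith
    then have "(N2 - c, N1, c, 0) \<in> atom_strings \<kappa>"
      unfolding atom_strings_0[OF k] using c bd dom N j k1
      by (elim disjE) (simp_all add: strings_def \<kappa> of_nat_diff)
    then show ?thesis using \<open>c \<le> N2\<close> by fastforce
  qed
  then show ?thesis using wt by blast
qed

lemma atom_string_unique:
  assumes "s \<in> atom_strings \<kappa>" "t \<in> atom_strings \<kappa>" "string_wt \<kappa> s = string_wt \<kappa> t"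
  shows "s = t"
proof -
  obtain a b c d where s: "s = (a, b, c, d)" by (cases s)
  obtain a' b' c' d' where t: "t = (a', b', c', d')" by (cases t)
  have wt: "b + d = b' + d'" "a + c = a' + c'"
  proof -
    have "2 * (int a + int c) - (int b + int d) * 2 = 2 * (int a' + int c') - (int b' + int d') * 2"
      "(int b + int d) - 2 * (int a + int c) = (int b' + int d') - 2 * (int a' + int c')"
      using assms(3) by (simp_all add: s t prod_eq_iff)
    moreover have "Q = Q' \<and> P = P'" if "2 * P - Q * 2 = 2 * P' - Q' * 2" "Q - 2 * P = Q' - 2 * P'"
      for P Q P' Q' :: int using that by presburger
    ultimately have "int b + int d = int b' + int d'" "int a + int c = int a' + int c'" by blast+
    then show "b + d = b' + d'" "a + c = a' + c'" by simp_all
  qed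
  have dom: "0 \<le> fst \<kappa>" "0 \<le> snd \<kappa>"
  proof -
    have "(a, b, c, d) \<in> strings \<kappa>"
      using assms(1) by (auto simp: s atom_strings_def preatom_strings_def)
    then show "0 \<le> fst \<kappa>" "0 \<le> snd \<kappa>" by (auto simp: strings_def)
  qed
  have "c = c' \<and> d = d'"
  proof (cases "0 < fst \<kappa>")
    case True
    have dd: "d = 0 \<and> c = 0 \<and> int (b + d) \<le> fst \<kappa> \<or> d = 0 \<and> int (b + d) = fst \<kappa> + 2 * int c \<and> int c \<le> snd \<kappa> \<or>
        d = 1 \<and> int (b + d) = fst \<kappa> + 2 * int c - 1 \<and> int c \<le> snd \<kappa> + 1 \<and> 0 < c \<or>
        1 < d \<and> int (b + d) = fst \<kappa> + 2 * snd \<kappa> + int d \<and> int c = snd \<kappa> + int d"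
      if "(a, b, c, d) \<in> atom_strings \<kappa>" for a b c d
      using that unfolding atom_strings_pos[OF True] by (auto simp: strings_def split: if_splits)
    \<comment> \<open>\<open>f\<close> and \<open>g\<close> recover c and d from N = b + d along
      that path.\<close>
    define f where "f N = (if N > fst \<kappa> + 2 * snd \<kappa> + 1 then N - fst \<kappa> - snd \<kappa>
      else if N \<le> fst \<kappa> then 0 else (N - fst \<kappa> + 1) div 2)" for N :: int
    define g where "g N = (if N > fst \<kappa> + 2 * snd \<kappa> + 1 then N - fst \<kappa> - 2 * snd \<kappa>
      else if N \<le> fst \<kappa> \<or> even (N - fst \<kappa>) then 0 else 1)" for N :: int
    have fg: "int c = f (int (b + d)) \<and> int d = g (int (b + d))" if "(a, b, c, d) \<in> atom_strings \<kappa>" for a b c d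
    proof -
      note st = that
      define N where "N = int (b + d)"
      consider "d = 0" "c = 0" "N \<le> fst \<kappa>" | "d = 0" "N = fst \<kappa> + 2 * int c" "int c \<le> snd \<kappa>"
        | "d = 1" "N = fst \<kappa> + 2 * int c - 1" "int c \<le> snd \<kappa> + 1" "0 < c"
        | "1 < d" "N = fst \<kappa> + 2 * snd \<kappa> + int d" "int c = snd \<kappa> + int d"
        using dd[OF st] unfolding N_def by blast
      then have "int c = f N \<and> int d = g N"
      proof cases
        case 1
        then show ?thesis using dom by (simp add: f_def g_def)
      next
        case 2
        have "(2 * int c + 1) div 2 = int c" by presburger
        then show ?thesis using 2 dom by (simp add: f_def g_def)
      next
        case 3
        then show ?thesis using dom by (simp add: f_def g_def)
      next
        case 4
        then show ?thesis by (simp add: f_def g_def)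
      qed
      then show ?thesis by (simp add: N_def)
    qed
    show ?thesis using fg[OF assms(1)[unfolded s]] fg[OF assms(2)[unfolded t]] unfolding wt(1) by linarith
  next
    case False
    then have k: "fst \<kappa> = 0" using dom by simp
    show ?thesis using assms(1,2) wt(1) unfolding s t atom_strings_0[OF k]
      by (auto simp: strings_def k)
  qed
  then show ?thesis using wt by (simp add: s t)
qed

lemma ex1_atom_nonpos:
  assumes "\<mu> \<preceq> \<kappa>" "fst \<mu> \<le> 0"
  shows "\<exists>!w. w \<in> atom \<kappa> \<and> wt w = \<mu>"
proof -
  obtain s where s: "s \<in> atom_strings \<kappa>" "string_wt \<kappa> s = \<mu>" using ex_atom_string[OF assms(1)] by blast
  then obtain w where w: "w \<in> preatom \<kappa>" "str2 w = s"
    using ex_preatom_string[of s \<kappa>] by (auto simp: atom_strings_def)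
  have wt: "wt w = \<mu>" using wt_crystal_string[OF preatom_crystal[OF w(1)]] w(2) s(2) by simp
  show ?thesis
  proof (rule ex1I[of _ w])
    show "w \<in> atom \<kappa> \<and> wt w = \<mu>" using wt w s assms(2) by (simp add: atom_iff_string)
    fix v assume v: "v \<in> atom \<kappa> \<and> wt v = \<mu>"
    then have v': "v \<in> preatom \<kappa>" "str2 v \<in> atom_strings \<kappa>" using assms(2) by (auto simp: atom_iff_string)
    then have "str2 v = s"
      using atom_string_unique[OF v'(2) s(1)] wt_crystal_string[OF preatom_crystal[OF v'(1)]] v s(2) by simp
    then show "v = w" using v'(1) w str2_eq_iff_preatom by blast
  qed
qed

lemma weight_le_refl1: "\<mu> \<preceq> \<kappa> \<Longrightarrow> refl1 \<mu> \<preceq> \<kappa>"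
  by (cases \<mu>) (auto simp: weight_le_iff octagon_def)

text \<open>For positive first coordinate, \<open>s1\<close> transports existence and uniqueness
  from the reflected weight, where strings are available.\<close>

lemma ex1_atom:
  assumes "\<mu> \<preceq> \<kappa>"
  shows "\<exists>!w. w \<in> atom \<kappa> \<and> wt w = \<mu>"
proof (cases "fst \<mu> \<le> 0")
  case True
  then show ?thesis using assms ex1_atom_nonpos by blast
next
  case False
  have "\<exists>!w. w \<in> atom \<kappa> \<and> wt w = refl1 \<mu>"
    using False by (intro ex1_atom_nonpos weight_le_refl1 assms) simp
  then obtain w where w: "w \<in> atom \<kappa>" "wt w = refl1 \<mu>"
    and uniq: "\<And>v. v \<in> atom \<kappa> \<Longrightarrow> wt v = refl1 \<mu> \<Longrightarrow> v = w" by blast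
  show ?thesis
  proof (rule ex1I[of _ "s1 w"])
    show "s1 w \<in> atom \<kappa> \<and> wt (s1 w) = \<mu>" using w False by (auto intro: s1_atom simp: wt_s1)
    fix v assume "v \<in> atom \<kappa> \<and> wt v = \<mu>"
    then have "s1 v = w" using False by (intro uniq) (auto intro: s1_atom simp: wt_s1)
    then show "v = s1 w" by (metis s1_s1)
  qed
qed

lemma atom_preatom: "w \<in> atom \<kappa> \<Longrightarrow> w \<in> preatom \<kappa>"
  by (simp add: atom_alt)

lemma atom_inE:
  assumes "U \<in> atom_in p \<kappa> b"
  obtains w where "atom_exponent \<kappa> b" "w \<in> atom (\<kappa> - int b *\<^sub>Z varpi2)"
    "Psibar_pow b (\<kappa> - int b *\<^sub>Z varpi2) w \<in> preatom \<kappa>"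
    "U = Phi_pow p \<kappa> (Psibar_pow b (\<kappa> - int b *\<^sub>Z varpi2) w)"
proof -
  obtain w where w: "atom_exponent \<kappa> b" "w \<in> atom (\<kappa> - int b *\<^sub>Z varpi2)"
    "U = Phi_pow p \<kappa> (Psibar_pow b (\<kappa> - int b *\<^sub>Z varpi2) w)"
    using assms by (auto simp: atom_in_def split: if_splits)
  then show thesis using that Psibar_pow(1)[OF atom_preatom[OF w(2)], of b] by simp
qed

lemma ex1_atom_in:
  assumes "atom_exponent \<kappa> b" "\<mu> \<preceq> \<kappa> - int b *\<^sub>Z varpi2"
  shows "\<exists>!U. U \<in> atom_in p \<kappa> b \<and> wt U = \<mu>"
proof -
  let ?K = "\<kappa> - int b *\<^sub>Z varpi2" and ?F = "\<lambda>w. Phi_pow p \<kappa> (Psibar_pow b (\<kappa> - int b *\<^sub>Z varpi2) w)"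
  have wt: "wt (?F w) = wt w" if "w \<in> atom ?K" for w
    using Psibar_pow[OF atom_preatom[OF that], of b] Phi_pow(2)[of "Psibar_pow b ?K w" \<kappa> p] preatom_crystal
    by simp
  have "\<exists>!w. w \<in> atom ?K \<and> wt w = \<mu>" using assms(2) by (rule ex1_atom)
  then obtain w where w: "w \<in> atom ?K" "wt w = \<mu>" "\<And>v. v \<in> atom ?K \<Longrightarrow> wt v = \<mu> \<Longrightarrow> v = w" by blast
  show ?thesis
  proof (rule ex1I[of _ "?F w"])
    show "?F w \<in> atom_in p \<kappa> b \<and> wt (?F w) = \<mu>" using w(1) wt[OF w(1)] w(2) assms(1) unfolding atom_in_def by auto
    fix U assume U: "U \<in> atom_in p \<kappa> b \<and> wt U = \<mu>"
    then obtain v where v: "v \<in> atom ?K" "U = ?F v" using assms(1) by (auto simp: atom_in_def)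
    have "v = w" using w(3)[OF v(1)] wt[OF v(1)] U v(2) by simp
    then show "U = ?F w" using v(2) by simp
  qed
qed

lemma atom_in_statistics:
  assumes "U \<in> atom_in p \<kappa> b" "dominant \<kappa>"
  shows "atom_exponent \<kappa> b" "pat (\<kappa> + (2 * int p) *\<^sub>Z varpi1) U = p"
    "atomic_number (\<kappa> + (2 * int p) *\<^sub>Z varpi1) U = b"
proof -
  let ?K = "\<kappa> - int b *\<^sub>Z varpi2"
  obtain w where w: "atom_exponent \<kappa> b" "w \<in> atom ?K" "Psibar_pow b ?K w \<in> preatom \<kappa>"
    "U = Phi_pow p \<kappa> (Psibar_pow b ?K w)"
    using assms(1) by (rule atom_inE)
  show "atom_exponent \<kappa> b" by (rule w)
  show pat: "pat (\<kappa> + (2 * int p) *\<^sub>Z varpi1) U = p" unfolding w(4) by (rule pat_eq[OF w(3)])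
  have "(THE T'. T' \<in> preatom \<kappa> \<and> Phi_pow p \<kappa> T' = U) = Psibar_pow b ?K w"
  proof (rule the_equality)
    fix T' assume "T' \<in> preatom \<kappa> \<and> Phi_pow p \<kappa> T' = U"
    then show "T' = Psibar_pow b ?K w"
      using inj_onD[OF inj_on_Phi_pow[of p \<kappa>], of T' "Psibar_pow b ?K w"] w(3,4) by (simp add: preatom_crystal)
  qed (use w(3,4) in simp)
  moreover have "\<kappa> + (2 * int p) *\<^sub>Z varpi1 - (2 * int p) *\<^sub>Z varpi1 = \<kappa>" by simp
  ultimately show "atomic_number (\<kappa> + (2 * int p) *\<^sub>Z varpi1) U = b"
    using atomic_number_preatom_eq[OF w(2,1) assms(2)]
    by (simp only: atomic_number_def pat Let_def)
qed

subsection \<open>Swappable and non-swappable edges\<close>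

text \<open>The edges \<mu> \<rightarrow> \<mu> - k\<beta> whose label belongs to the sequence
  \<gamma>; the level of the label is k minus the pairing at \<mu>.\<close>

definition bstep :: "weight \<Rightarrow> posroot \<Rightarrow> weight \<Rightarrow> int \<Rightarrow> bool" where
  "bstep lam \<beta> \<mu> k \<longleftrightarrow> \<beta> \<noteq> A1 \<and> 1 \<le> k \<and> 1 \<le> k - pairing \<mu> (coroot \<beta>) \<and> \<mu> \<preceq> lam \<and> \<mu> - k *\<^sub>Z pos_root \<beta> \<preceq> lam"

text \<open>The arithmetic form of a non-swappable edge, justified by \<open>bstep_ell\<close> and
  \<open>edge_sets\<close>.\<close>

definition ns_step :: "weight \<Rightarrow> posroot \<Rightarrow> weight \<Rightarrow> int \<Rightarrow> bool" where
  "ns_step lam \<beta> \<mu> k \<longleftrightarrow> bstep lam \<beta> \<mu> k \<and> (\<beta> = A2 \<or> \<beta> = A12) \<and>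
     ns_cond lam (cross \<beta> \<mu>) k (k - pairing \<mu> (coroot \<beta>))"

lemma edge_label_eq_minus:
  assumes "1 \<le> M"
  shows "edge_label \<beta>' j = (- coroot \<beta>, M) \<longleftrightarrow> \<beta>' = \<beta> \<and> j = - M"
proof (cases "j < 0")
  case True
  then show ?thesis unfolding edge_label_def by (auto dest: coroot_inj)
next
  case False
  then show ?thesis using assms unfolding edge_label_def by (auto simp: coroot_neq_minus)
qed

lemma gamma_edge_iff:
  assumes "1 \<le> i"
  shows "(\<mu>, t_refl i \<mu>, gamma i) \<in> bruhat_edges lam \<longleftrightarrow>
    bstep lam (gamma_root i) \<mu> (pairing \<mu> (coroot (gamma_root i)) + gamma_level i)"
proof -
  define \<beta> M p where "\<beta> = gamma_root i" and "M = gamma_level i" and "p = pairing \<mu> (coroot \<beta>)"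
  have M: "1 \<le> M" using gamma_root_level(1)[OF assms] by (simp add: M_def)
  have g: "gamma i = (- coroot \<beta>, M)" by (simp add: gamma_def \<beta>_def M_def)
  have t: "t_refl i \<mu> = \<mu> - (p + M) *\<^sub>Z pos_root \<beta>" by (simp add: t_refl_def p_def \<beta>_def M_def)
  have "(\<mu>, t_refl i \<mu>, gamma i) \<in> bruhat_edges lam \<longleftrightarrow> bstep lam \<beta> \<mu> (p + M)"
  proof
    assume e: "(\<mu>, t_refl i \<mu>, gamma i) \<in> bruhat_edges lam"
    then have v: "\<mu> \<preceq> lam" "t_refl i \<mu> \<preceq> lam" using bruhat_edgesD by blast+
    from e obtain \<beta>' k where k: "k \<noteq> 0" "gamma i = edge_label \<beta>' (pairing \<mu> (coroot \<beta>') - k)"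
      "0 < k \<longleftrightarrow> pairing \<mu> (coroot \<beta>') - k < 0" unfolding bruhat_out_iff[OF v(1)] by blast
    have "\<beta>' = \<beta>" "pairing \<mu> (coroot \<beta>') - k = - M"
      using k(2)[symmetric] unfolding g edge_label_eq_minus[OF M] by auto
    then have "1 \<le> p + M" using k(3) M by (simp add: p_def)
    then show "bstep lam \<beta> \<mu> (p + M)"
      using v M unfolding bstep_def t by (simp add: \<beta>_def p_def)
  next
    assume b: "bstep lam \<beta> \<mu> (p + M)"
    then have v: "\<mu> \<preceq> lam" by (simp add: bstep_def)
    show "(\<mu>, t_refl i \<mu>, gamma i) \<in> bruhat_edges lam"
      unfolding bruhat_out_iff[OF v] t g
      by (rule exI[of _ \<beta>], rule exI[of _ "p + M"]) (use b M in \<open>auto simp: bstep_def edge_label_def p_def\<close>)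
  qed
  then show ?thesis by (simp add: \<beta>_def M_def p_def)
qed

lemma cross_target: "\<beta> = A2 \<or> \<beta> = A12 \<Longrightarrow> cross \<beta> (\<mu> - k *\<^sub>Z pos_root \<beta>) = cross \<beta> \<mu>"
  by (auto simp: zscale_def)

lemma bstep_axis:
  fixes \<mu> :: weight
  assumes "\<beta> = A2 \<or> \<beta> = A12"
  defines "w \<equiv> pairing \<mu> (coroot \<beta>)" and "z \<equiv> cross \<beta> \<mu>"
  shows "bstep (l1, l2) \<beta> \<mu> k \<longleftrightarrow> 1 \<le> k \<and> 1 \<le> k - w \<and> 0 \<le> l1 \<and> 0 \<le> l2 \<and>
    axis_octagon l1 l2 z w \<and> axis_octagon l1 l2 z (w - 2 * k)"
proof -
  have "\<beta> \<noteq> A1" using assms(1) by auto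
  then show ?thesis
    unfolding bstep_def weight_le_axis[OF assms(1)] cross_target[OF assms(1)] pairing_diff w_def z_def by blast
qed

lemma bstep_ell:
  assumes b: "bstep lam \<beta> \<mu> k"
  defines "i \<equiv> gamma_index \<beta> (k - pairing \<mu> (coroot \<beta>))"
  shows "int (ell (i - 1) \<mu> lam) = int (ell (i - 1) (\<mu> - k *\<^sub>Z pos_root \<beta>) lam) - 1 \<longleftrightarrow> \<not> ns_step lam \<beta> \<mu> k"
proof (cases "\<beta> = A2 \<or> \<beta> = A12")
  case True
  obtain l1 l2 where lam: "lam = (l1, l2)" by (cases lam)
  define M where "M = k - pairing \<mu> (coroot \<beta>)"
  have w: "pairing \<mu> (coroot \<beta>) = k - M" by (simp add: M_def)
  have w': "pairing (\<mu> - k *\<^sub>Z pos_root \<beta>) (coroot \<beta>) = - (k + M)" unfolding pairing_diff w by simp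
  have kM: "1 \<le> k" "1 \<le> M" "0 \<le> l1" "0 \<le> l2" "axis_octagon l1 l2 (cross \<beta> \<mu>) (k - M)"
    "axis_octagon l1 l2 (cross \<beta> \<mu>) (- (k + M))"
    using b[unfolded lam bstep_axis[OF True] w] by (simp_all add: algebra_simps)
  have v: "\<mu> \<preceq> lam" "\<mu> - k *\<^sub>Z pos_root \<beta> \<preceq> lam" using b by (simp_all add: bstep_def)
  have c: "root_shift \<beta> = 0 \<or> root_shift \<beta> = 1" by (simp add: root_shift_def)
  have "int (ell (i - 1) \<mu> lam) = int (ell (i - 1) (\<mu> - k *\<^sub>Z pos_root \<beta>) lam) - 1 \<longleftrightarrow>
      \<not> ns_cond lam (cross \<beta> \<mu>) k M"
    unfolding i_def M_def[symmetric] ell_eq_ell_axis(1)[OF v(1) True kM(2)] ell_eq_ell_axis(1)[OF v(2) True kM(2)]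
    unfolding w w' cross_target[OF True] unfolding lam by (rule ell_axis_swap_iff[OF kM(5,6,1,2,3,4) c])
  then show ?thesis using b True by (simp add: ns_step_def M_def)
next
  case False
  then have "\<beta> = A21" using b by (cases \<beta>) (auto simp: bstep_def)
  then show ?thesis using ell_A21_edge(1)[of \<mu> lam k] b unfolding i_def by (simp add: bstep_def ns_step_def)
qed

lemma gamma_index_edge:
  assumes "1 \<le> i"
  shows "bstep lam (gamma_root i) \<mu> (pairing \<mu> (coroot (gamma_root i)) + gamma_level i) \<and>
      t_refl i \<mu> = \<nu> \<and> gamma i = l \<longleftrightarrow>
    (\<exists>\<beta> k. bstep lam \<beta> \<mu> k \<and> \<nu> = \<mu> - k *\<^sub>Z pos_root \<beta> \<and> l = (- coroot \<beta>, k - pairing \<mu> (coroot \<beta>)) \<and>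
      i = gamma_index \<beta> (k - pairing \<mu> (coroot \<beta>)))" (is "?L \<longleftrightarrow> ?R")
proof
  assume ?L
  then show ?R
    by (intro exI[of _ "gamma_root i"] exI[of _ "pairing \<mu> (coroot (gamma_root i)) + gamma_level i"])
      (auto simp: t_refl_def gamma_def gamma_root_level(2)[OF assms])
next
  assume ?R
  then obtain \<beta> k where k: "bstep lam \<beta> \<mu> k" "\<nu> = \<mu> - k *\<^sub>Z pos_root \<beta>"
    "l = (- coroot \<beta>, k - pairing \<mu> (coroot \<beta>))" "i = gamma_index \<beta> (k - pairing \<mu> (coroot \<beta>))" by blast
  then have "\<beta> \<noteq> A1" "1 \<le> k - pairing \<mu> (coroot \<beta>)" by (simp_all add: bstep_def)
  from gamma_index(2,3)[OF this] have "gamma_root i = \<beta>" "gamma_level i = k - pairing \<mu> (coroot \<beta>)"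
    by (simp_all add: k(4))
  then show ?L using k(1-3) by (simp add: t_refl_def gamma_def)
qed

lemma edge_sets:
  shows "(\<mu>, \<nu>, l) \<in> swappable_edges lam \<longleftrightarrow> (\<exists>\<beta> k. bstep lam \<beta> \<mu> k \<and> \<not> ns_step lam \<beta> \<mu> k \<and>
      \<nu> = \<mu> - k *\<^sub>Z pos_root \<beta> \<and> l = (- coroot \<beta>, k - pairing \<mu> (coroot \<beta>)))" (is ?S)
    and "(\<mu>, \<nu>, l) \<in> nonswappable_edges lam \<longleftrightarrow> (\<exists>\<beta> k. ns_step lam \<beta> \<mu> k \<and>
      \<nu> = \<mu> - k *\<^sub>Z pos_root \<beta> \<and> l = (- coroot \<beta>, k - pairing \<mu> (coroot \<beta>)))" (is ?N)
proof -
  \<comment> \<open>Q is later the identity for swappable and the negation for non-swappable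
    edges.\<close>
  have *: "(\<exists>m. \<nu> = t_refl (m + 1) \<mu> \<and> l = gamma (m + 1) \<and> (\<mu>, t_refl (m + 1) \<mu>, gamma (m + 1)) \<in> bruhat_edges lam \<and>
        Q (int (ell m \<mu> lam) = int (ell m (t_refl (m + 1) \<mu>) lam) - 1)) \<longleftrightarrow>
     (\<exists>\<beta> k. bstep lam \<beta> \<mu> k \<and> Q (\<not> ns_step lam \<beta> \<mu> k) \<and>
      \<nu> = \<mu> - k *\<^sub>Z pos_root \<beta> \<and> l = (- coroot \<beta>, k - pairing \<mu> (coroot \<beta>)))" (is "?L \<longleftrightarrow> ?R") for Q
  proof
    assume ?L
    then obtain m where m: "\<nu> = t_refl (m + 1) \<mu>" "l = gamma (m + 1)"
      "(\<mu>, t_refl (m + 1) \<mu>, gamma (m + 1)) \<in> bruhat_edges lam"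
      "Q (int (ell m \<mu> lam) = int (ell m (t_refl (m + 1) \<mu>) lam) - 1)" by blast
    have "1 \<le> m + 1" by simp
    from gamma_index_edge[OF this, of lam \<mu> \<nu> l] gamma_edge_iff[OF this, of \<mu> lam] m(1-3)
    obtain \<beta> k where k: "bstep lam \<beta> \<mu> k" "\<nu> = \<mu> - k *\<^sub>Z pos_root \<beta>"
      "l = (- coroot \<beta>, k - pairing \<mu> (coroot \<beta>))" "m + 1 = gamma_index \<beta> (k - pairing \<mu> (coroot \<beta>))" by blast
    have "Q (\<not> ns_step lam \<beta> \<mu> k)"
      using m(4) bstep_ell[OF k(1)] unfolding k(4)[symmetric] m(1)[symmetric] k(2)[symmetric] by simp
    then show ?R using k(1-3) by blast
  next
    assume ?R
    then obtain \<beta> k where k: "bstep lam \<beta> \<mu> k" "Q (\<not> ns_step lam \<beta> \<mu> k)" "\<nu> = \<mu> - k *\<^sub>Z pos_root \<beta>"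
      "l = (- coroot \<beta>, k - pairing \<mu> (coroot \<beta>))" by blast
    define i where "i = gamma_index \<beta> (k - pairing \<mu> (coroot \<beta>))"
    have i: "1 \<le> i" using gamma_index(1)[of \<beta> "k - pairing \<mu> (coroot \<beta>)"] k(1) by (simp add: i_def bstep_def)
    then obtain m where m: "i = m + 1" using le_Suc_ex by (metis add.commute)
    have "bstep lam (gamma_root i) \<mu> (pairing \<mu> (coroot (gamma_root i)) + gamma_level i) \<and>
      t_refl i \<mu> = \<nu> \<and> gamma i = l" unfolding gamma_index_edge[OF i] using k(1,3,4) i_def by blast
    then have "\<nu> = t_refl (m + 1) \<mu>" "l = gamma (m + 1)" "(\<mu>, t_refl (m + 1) \<mu>, gamma (m + 1)) \<in> bruhat_edges lam"
      using gamma_edge_iff[OF i, of \<mu> lam] unfolding m by auto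
    moreover have "Q (int (ell m \<mu> lam) = int (ell m \<nu> lam) - 1)"
      using k(2) bstep_ell[OF k(1)] unfolding i_def[symmetric] m k(3)[symmetric] by simp
    ultimately show ?L by blast
  qed
  show ?S unfolding swappable_edges_def using *[of "\<lambda>x. x"] by blast
  show ?N unfolding nonswappable_edges_def using *[of "\<lambda>x. \<not> x"] unfolding ns_step_def by blast
qed

lemma NS_count_eq:
  assumes "\<And>\<beta>' k. ns_step lam \<beta>' \<mu> k \<Longrightarrow> k - pairing \<mu> (coroot \<beta>') \<le> level_bound m \<beta>' \<Longrightarrow> \<beta>' = \<beta>"
  shows "NS_count m \<mu> lam = card {k. ns_step lam \<beta> \<mu> k \<and> k - pairing \<mu> (coroot \<beta>) \<le> level_bound m \<beta>}"
proof -
  let ?K = "{k. ns_step lam \<beta> \<mu> k \<and> k - pairing \<mu> (coroot \<beta>) \<le> level_bound m \<beta>}"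
  let ?f = "\<lambda>k. (\<mu>, \<mu> - k *\<^sub>Z pos_root \<beta>, (- coroot \<beta>, k - pairing \<mu> (coroot \<beta>)))"
  have lev: "(- coroot \<beta>', k - pairing \<mu> (coroot \<beta>')) \<in> gamma ` {1..m} \<longleftrightarrow> k - pairing \<mu> (coroot \<beta>') \<le> level_bound m \<beta>'"
    if "ns_step lam \<beta>' \<mu> k" for \<beta>' k
    unfolding gamma_image_iff using that by (simp add: ns_step_def bstep_def)
  have "{(x, y, l) \<in> nonswappable_edges lam. x = \<mu> \<and> l \<in> gamma ` {1..m}} = ?f ` ?K"
  proof (intro set_eqI iffI)
    fix t assume "t \<in> {(x, y, l) \<in> nonswappable_edges lam. x = \<mu> \<and> l \<in> gamma ` {1..m}}"
    then obtain y l where t: "t = (\<mu>, y, l)" "(\<mu>, y, l) \<in> nonswappable_edges lam" "l \<in> gamma ` {1..m}" by blast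
    from t(2) obtain \<beta>' k where k: "ns_step lam \<beta>' \<mu> k" "y = \<mu> - k *\<^sub>Z pos_root \<beta>'"
      "l = (- coroot \<beta>', k - pairing \<mu> (coroot \<beta>'))" unfolding edge_sets(2) by blast
    have le: "k - pairing \<mu> (coroot \<beta>') \<le> level_bound m \<beta>'" using t(3) lev[OF k(1)] unfolding k(3) by blast
    have "\<beta>' = \<beta>" by (rule assms[OF k(1) le])
    then show "t \<in> ?f ` ?K" using t(1) k le by blast
  next
    fix t assume "t \<in> ?f ` ?K"
    then obtain k where k: "t = ?f k" "ns_step lam \<beta> \<mu> k" "k - pairing \<mu> (coroot \<beta>) \<le> level_bound m \<beta>" by blast
    then have "(- coroot \<beta>, k - pairing \<mu> (coroot \<beta>)) \<in> gamma ` {1..m}" using lev by blast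
    moreover have "?f k \<in> nonswappable_edges lam" unfolding edge_sets(2) using k(2) by blast
    ultimately show "t \<in> {(x, y, l) \<in> nonswappable_edges lam. x = \<mu> \<and> l \<in> gamma ` {1..m}}" unfolding k(1) by blast
  qed
  moreover have "inj_on ?f ?K" by (rule inj_onI) auto
  ultimately show ?thesis by (simp add: NS_count_def card_image)
qed

lemma NS_count_0:
  assumes "\<And>\<beta> k. ns_step lam \<beta> \<mu> k \<Longrightarrow> k - pairing \<mu> (coroot \<beta>) \<le> level_bound m \<beta> \<Longrightarrow> False"
  shows "NS_count m \<mu> lam = 0"
proof -
  have "{k. ns_step lam A1 \<mu> k \<and> k - pairing \<mu> (coroot A1) \<le> level_bound m A1} = {}" using assms by blast
  then show ?thesis using NS_count_eq[of lam \<mu> m A1] assms by (metis card.empty)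
qed

lemma NS_staircase_step:
  assumes "NS_staircase m \<mu> lam \<alpha> n a" "1 \<le> i" "i \<le> a"
  shows "ns_step (lam + int i *\<^sub>Z varpi2) \<alpha> \<mu> (int (n + i))"
    "int (n + i) - pairing \<mu> (coroot \<alpha>) \<le> level_bound m \<alpha>"
proof -
  obtain l where l: "l \<in> gamma ` {1..m}"
    "(\<mu>, \<mu> - int (n + i) *\<^sub>Z pos_root \<alpha>, l) \<in> nonswappable_edges (lam + int i *\<^sub>Z varpi2)"
    using assms unfolding NS_staircase_def by (meson atLeastAtMost_iff)
  from l(2) obtain \<beta> k where k: "ns_step (lam + int i *\<^sub>Z varpi2) \<beta> \<mu> k"
    "\<mu> - int (n + i) *\<^sub>Z pos_root \<alpha> = \<mu> - k *\<^sub>Z pos_root \<beta>" "l = (- coroot \<beta>, k - pairing \<mu> (coroot \<beta>))"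
    unfolding edge_sets(2) by blast
  have "int (n + i) *\<^sub>Z pos_root \<alpha> = k *\<^sub>Z pos_root \<beta>" using k(2) by (simp add: prod_eq_iff)
  then have "\<alpha> = \<beta> \<and> int (n + i) = k" by (rule pos_root_scale_inj) (use assms(2) in simp)
  then show "ns_step (lam + int i *\<^sub>Z varpi2) \<alpha> \<mu> (int (n + i))"
    "int (n + i) - pairing \<mu> (coroot \<alpha>) \<le> level_bound m \<alpha>"
    using k(1,3) l(1) gamma_image_iff by auto
qed

lemma Dhat_eqI:
  assumes "NS_staircase m \<mu> lam \<alpha> n a" "\<And>\<alpha> n b. NS_staircase m \<mu> lam \<alpha> n b \<Longrightarrow> b \<le> a"
  shows "Dhat m \<mu> lam = a"
  unfolding Dhat_def
proof (rule Max_eqI)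
  show "finite {a. \<exists>\<alpha> n. NS_staircase m \<mu> lam \<alpha> n a}"
    by (rule finite_subset[of _ "{..a}"]) (use assms(2) in auto)
qed (use assms in blast)+

text \<open>A staircase of positive length has its first edge over \<lambda> + \<varpi>_2, so it is
  enough to exclude non-swappable edges there.\<close>

lemma Dhat_0:
  assumes "\<And>\<beta> k. ns_step (lam + int 1 *\<^sub>Z varpi2) \<beta> \<mu> k \<Longrightarrow> k - pairing \<mu> (coroot \<beta>) \<le> level_bound m \<beta> \<Longrightarrow> False"
  shows "Dhat m \<mu> lam = 0"
proof (rule Dhat_eqI)
  show "NS_staircase m \<mu> lam A1 0 0" by (simp add: NS_staircase_def)
  fix \<alpha> n b assume s: "NS_staircase m \<mu> lam \<alpha> n b"
  show "b \<le> 0"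
  proof (rule ccontr)
    assume "\<not> b \<le> 0"
    then have "1 \<le> b" by simp
    from NS_staircase_step[OF s order.refl this] show False by (rule assms)
  qed
qed

lemma lowers_to_swappable_iff:
  assumes "1 \<le> k"
  shows "lowers_to_swappable \<nu> (\<mu>, \<mu> - k *\<^sub>Z pos_root \<beta>, l) j \<longleftrightarrow>
    bstep (\<nu> - int j *\<^sub>Z varpi2) \<beta> \<mu> (k - int j) \<and> \<not> ns_step (\<nu> - int j *\<^sub>Z varpi2) \<beta> \<mu> (k - int j)"
proof
  assume "lowers_to_swappable \<nu> (\<mu>, \<mu> - k *\<^sub>Z pos_root \<beta>, l) j"
  then obtain k2 \<alpha> l' where k2: "1 \<le> k2" "\<mu> - k *\<^sub>Z pos_root \<beta> = \<mu> - k2 *\<^sub>Z pos_root \<alpha>"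
    "(\<mu>, \<mu> - (k2 - int j) *\<^sub>Z pos_root \<alpha>, l') \<in> swappable_edges (\<nu> - int j *\<^sub>Z varpi2)"
    unfolding lowers_to_swappable_def by blast
  have "k *\<^sub>Z pos_root \<beta> = k2 *\<^sub>Z pos_root \<alpha>" using k2(2) by (simp add: prod_eq_iff)
  then have a: "\<beta> = \<alpha> \<and> k = k2" by (rule pos_root_scale_inj) (use assms in simp)
  from k2(3) obtain \<beta>' k' where k': "bstep (\<nu> - int j *\<^sub>Z varpi2) \<beta>' \<mu> k'" "\<not> ns_step (\<nu> - int j *\<^sub>Z varpi2) \<beta>' \<mu> k'"
    "\<mu> - (k2 - int j) *\<^sub>Z pos_root \<alpha> = \<mu> - k' *\<^sub>Z pos_root \<beta>'" unfolding edge_sets(1) by blast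
  have "k' *\<^sub>Z pos_root \<beta>' = (k2 - int j) *\<^sub>Z pos_root \<alpha>" using k'(3) by (simp add: prod_eq_iff)
  then have "\<beta>' = \<alpha> \<and> k' = k2 - int j" by (rule pos_root_scale_inj) (use k'(1) in \<open>simp add: bstep_def\<close>)
  then show "bstep (\<nu> - int j *\<^sub>Z varpi2) \<beta> \<mu> (k - int j) \<and> \<not> ns_step (\<nu> - int j *\<^sub>Z varpi2) \<beta> \<mu> (k - int j)"
    using k'(1,2) a by simp
next
  assume "bstep (\<nu> - int j *\<^sub>Z varpi2) \<beta> \<mu> (k - int j) \<and> \<not> ns_step (\<nu> - int j *\<^sub>Z varpi2) \<beta> \<mu> (k - int j)"
  then show "lowers_to_swappable \<nu> (\<mu>, \<mu> - k *\<^sub>Z pos_root \<beta>, l) j"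
    unfolding lowers_to_swappable_def edge_sets(1) using assms by blast
qed

subsection \<open>The statistics along an edge\<close>

lemma axis_cases:
  assumes "\<beta> = A2 \<or> \<beta> = A12" "\<beta>' = A2 \<or> \<beta>' = A12" "\<beta>' \<noteq> \<beta>"
  shows "pairing \<mu> (coroot \<beta>') = cross \<beta> \<mu>" "cross \<beta>' \<mu> = pairing \<mu> (coroot \<beta>)"
  using assms by (auto simp: pairing_def)

lemma level_bound_gamma_index:
  assumes "1 \<le> M"
  shows "\<beta> \<noteq> A1 \<Longrightarrow> level_bound (gamma_index \<beta> M) \<beta> = M"
    "\<beta> = A2 \<or> \<beta> = A12 \<Longrightarrow> \<beta>' = A2 \<or> \<beta>' = A12 \<Longrightarrow> level_bound (gamma_index \<beta> M) \<beta>' \<le> M"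
    "\<beta>' = A2 \<or> \<beta>' = A12 \<Longrightarrow> 2 * level_bound (gamma_index A21 M) \<beta>' \<le> M"
proof -
  define j where "j = nat (M - 1)"
  have j: "M = int j + 1" using assms by (simp add: j_def)
  have g: "gamma_index A2 M = 4 * j + 4" "gamma_index A12 M = 4 * j + 2" "gamma_index A21 M = 2 * j + 1"
    using j by simp_all
  have l: "level_bound (4 * j + 4) A2 = M" "level_bound (4 * j + 4) A12 = M"
    "level_bound (4 * j + 2) A2 = M - 1" "level_bound (4 * j + 2) A12 = M" "level_bound (2 * j + 1) A21 = M"
    "2 * level_bound (2 * j + 1) A2 \<le> M" "2 * level_bound (2 * j + 1) A12 \<le> M"
    unfolding level_bound.simps j by presburger+
  show "\<beta> \<noteq> A1 \<Longrightarrow> level_bound (gamma_index \<beta> M) \<beta> = M"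
    using l g by (cases \<beta>) (simp_all del: level_bound.simps gamma_index.simps)
  show "\<beta> = A2 \<or> \<beta> = A12 \<Longrightarrow> \<beta>' = A2 \<or> \<beta>' = A12 \<Longrightarrow> level_bound (gamma_index \<beta> M) \<beta>' \<le> M"
    using l g by (elim disjE) (simp_all del: level_bound.simps gamma_index.simps)
  show "\<beta>' = A2 \<or> \<beta>' = A12 \<Longrightarrow> 2 * level_bound (gamma_index A21 M) \<beta>' \<le> M"
    using l g by (elim disjE) (simp_all del: level_bound.simps gamma_index.simps)
qed

lemma ns_stepD:
  assumes "ns_step (l1, l2) \<beta> \<mu> k"
  defines "p \<equiv> pairing \<mu> (coroot \<beta>)" and "z \<equiv> cross \<beta> \<mu>"
  shows "\<beta> = A2 \<or> \<beta> = A12" "1 \<le> k" "1 \<le> k - p" "ns_cond (l1, l2) z k (k - p)"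
    "l1 + l2 + 2 \<le> z + 2 * k - 2 * p" "2 * k - p \<le> l1 + l2"
proof -
  show b: "\<beta> = A2 \<or> \<beta> = A12" using assms by (simp add: ns_step_def)
  show n: "ns_cond (l1, l2) z k (k - p)" using assms by (simp add: ns_step_def)
  have s: "bstep (l1, l2) \<beta> \<mu> k" using assms(1) by (simp add: ns_step_def)
  from s[unfolded bstep_axis[OF b]] show "1 \<le> k" "1 \<le> k - p" by (simp_all add: p_def)
  show "l1 + l2 + 2 \<le> z + 2 * k - 2 * p" using n by (simp add: ns_cond_def)
  have "axis_octagon l1 l2 z (p - 2 * k)" using s[unfolded bstep_axis[OF b]] by (simp add: p_def z_def)
  then show "2 * k - p \<le> l1 + l2" unfolding axis_octagon_def by linarith
qed

lemma no_ns_step_target: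
  assumes b: "bstep (l1, l2) \<beta> \<mu> k" and i: "i = gamma_index \<beta> (k - pairing \<mu> (coroot \<beta>))" and r: "0 \<le> r"
    and n: "ns_step (l1, l2 + r) \<beta>' (\<mu> - k *\<^sub>Z pos_root \<beta>) k'"
    and l: "k' - pairing (\<mu> - k *\<^sub>Z pos_root \<beta>) (coroot \<beta>') \<le> level_bound i \<beta>'"
  shows False
proof -
  let ?t = "\<mu> - k *\<^sub>Z pos_root \<beta>"
  define M where "M = k - pairing \<mu> (coroot \<beta>)"
  have kM: "1 \<le> k" "1 \<le> M" "\<beta> \<noteq> A1" using b by (simp_all add: bstep_def M_def)
  note n' = ns_stepD[OF n]
  show False
  proof (cases "\<beta> = A2 \<or> \<beta> = A12")
    case True
    have w: "pairing \<mu> (coroot \<beta>) = k - M" by (simp add: M_def)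
    have w': "pairing ?t (coroot \<beta>) = - (k + M)" unfolding pairing_diff w by simp
    have o: "axis_octagon l1 l2 (cross \<beta> \<mu>) (- (k + M))"
      using b[unfolded bstep_axis[OF True] w] by (simp add: algebra_simps)
    then have A: "k + M \<le> l1 + l2" unfolding axis_octagon_def by linarith
    have lb: "level_bound i \<beta>' \<le> M"
      using level_bound_gamma_index(2)[OF kM(2) True n'(1)] by (simp add: i M_def)
    show False
    proof (cases "\<beta>' = \<beta>")
      case True
      then show False using l lb n'(2) w' kM by simp
    next
      case False
      from axis_cases[OF True n'(1) False, of ?t] have c: "cross \<beta>' ?t = - (k + M)" using w' by simp
      have "l1 + (l2 + r) + 2 \<le> - (k + M) + 2 * k' - 2 * pairing ?t (coroot \<beta>')" using n'(5) unfolding c .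
      then show False using l lb A r kM by linarith
    qed
  next
    case False
    then have b21: "\<beta> = A21" using kM(3) by (cases \<beta>) auto
    define x y where "x = fst \<mu> + snd \<mu>" and "y = snd \<mu>"
    have t: "fst ?t + snd ?t = - y - M" "snd ?t = - x - M"
      by (simp_all add: b21 M_def x_def y_def zscale_def pairing_def)
    have A: "- x \<le> l1 + l2" "- y \<le> l1 + l2"
      using b by (auto simp: bstep_def weight_le_iff octagon_def x_def y_def)
    have lb: "2 * level_bound i \<beta>' \<le> M"
      using level_bound_gamma_index(3)[OF kM(2) n'(1)] by (simp add: i M_def b21)
    have "cross \<beta>' ?t = - y - M \<or> cross \<beta>' ?t = - x - M" using n'(1) t by (auto simp del: fst_diff snd_diff)
    then show False using n'(5) l lb A r by linarith
  qed
qed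

text \<open>The third inequality of \<open>ns_cond\<close> bounds the constant coordinate plus twice
  the level from below. For a root other than \<beta> and a label not after that of the given edge,
  the same quantity is at most \<lambda>_1 + \<lambda>_2, since the target of the given edge lies in
  the octagon.\<close>

lemma ns_step_other_root:
  assumes b: "bstep (l1, l2) \<beta> \<mu> k" and i: "i = gamma_index \<beta> (k - pairing \<mu> (coroot \<beta>))" and r: "0 \<le> r"
    and n: "ns_step (l1, l2 + r) \<beta>' \<mu> k'" and l: "k' - pairing \<mu> (coroot \<beta>') \<le> level_bound i \<beta>'"
  shows "\<beta>' = \<beta>"
proof (rule ccontr)
  assume ne: "\<beta>' \<noteq> \<beta>"
  define M where "M = k - pairing \<mu> (coroot \<beta>)"
  have kM: "1 \<le> k" "1 \<le> M" "\<beta> \<noteq> A1" using b by (simp_all add: bstep_def M_def)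
  note n' = ns_stepD[OF n]
  show False
  proof (cases "\<beta> = A2 \<or> \<beta> = A12")
    case True
    have w: "pairing \<mu> (coroot \<beta>) = k - M" by (simp add: M_def)
    have "axis_octagon l1 l2 (cross \<beta> \<mu>) (- (k + M))"
      using b[unfolded bstep_axis[OF True] w] by (simp add: algebra_simps)
    then have A: "k + M \<le> l1 + l2" unfolding axis_octagon_def by linarith
    have lb: "level_bound i \<beta>' \<le> M"
      using level_bound_gamma_index(2)[OF kM(2) True n'(1)] by (simp add: i M_def)
    have c: "cross \<beta>' \<mu> = k - M" using axis_cases(2)[OF True n'(1) ne] w by simp
    show False using n'(5) l lb A r unfolding c by linarith
  next
    case False
    then have b21: "\<beta> = A21" using kM(3) by (cases \<beta>) auto
    define x y where "x = fst \<mu> + snd \<mu>" and "y = snd \<mu>"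
    have t: "fst (\<mu> - k *\<^sub>Z pos_root \<beta>) + snd (\<mu> - k *\<^sub>Z pos_root \<beta>) = - y - M"
      "snd (\<mu> - k *\<^sub>Z pos_root \<beta>) = - x - M"
      by (simp_all add: b21 M_def x_def y_def zscale_def pairing_def)
    have "\<bar>fst (\<mu> - k *\<^sub>Z pos_root \<beta>) + snd (\<mu> - k *\<^sub>Z pos_root \<beta>)\<bar> \<le> l1 + l2"
      "\<bar>snd (\<mu> - k *\<^sub>Z pos_root \<beta>)\<bar> \<le> l1 + l2"
      using b by (simp_all only: bstep_def weight_le_iff octagon_def fst_conv snd_conv)
    then have A: "x + M \<le> l1 + l2" "y + M \<le> l1 + l2" unfolding t(1) unfolding t(2) by linarith+
    have lb: "2 * level_bound i \<beta>' \<le> M"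
      using level_bound_gamma_index(3)[OF kM(2) n'(1)] by (simp add: i M_def b21)
    have "cross \<beta>' \<mu> = x \<or> cross \<beta>' \<mu> = y" using n'(1) by (auto simp: x_def y_def)
    then show False using n'(5) l lb A r by linarith
  qed
qed

text \<open>Lowering \<lambda>_2 and lengthening the step both weaken the inequalities; p is the
  pairing at the source, so the level k - p grows with k.\<close>

lemma ns_cond_mono:
  assumes "ns_cond (l1, l2 + r) z k' (k' - p)" "k' \<le> k" "0 \<le> r"
  shows "ns_cond (l1, l2) z k (k - p)"
  using assms unfolding ns_cond_def fst_conv snd_conv right_diff_distrib by linarith

text \<open>Such an edge would have root \<beta> and step at most k, and \<open>ns_cond_mono\<close>
  would pass its non-swappability on to the given edge.\<close>

lemma swappable_no_ns_step:
  assumes b: "bstep (l1, l2) \<beta> \<mu> k" and i: "i = gamma_index \<beta> (k - pairing \<mu> (coroot \<beta>))" and r: "0 \<le> r"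
    and s: "\<not> ns_step (l1, l2) \<beta> \<mu> k"
    and n: "ns_step (l1, l2 + r) \<beta>' \<mu> k'" and l: "k' - pairing \<mu> (coroot \<beta>') \<le> level_bound i \<beta>'"
  shows False
proof -
  have e: "\<beta>' = \<beta>" by (rule ns_step_other_root[OF b i r n l])
  have kM: "1 \<le> k - pairing \<mu> (coroot \<beta>)" "\<beta> \<noteq> A1" using b by (simp_all add: bstep_def)
  have "k' \<le> k" using l level_bound_gamma_index(1)[OF kM] by (simp add: e i)
  then have "ns_cond (l1, l2) (cross \<beta> \<mu>) k (k - pairing \<mu> (coroot \<beta>))"
    using ns_cond_mono[OF ns_stepD(4)[OF n] _ r] unfolding e by blast
  then show False using s b ns_stepD(1)[OF n] by (simp add: ns_step_def e)
qed

text \<open>Reversing the label of the edge adds one incoming edge at \<mu> and removes one at the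
  other end, which turns the difference -1 before the reversal into +1.\<close>

lemma ell_swappable:
  assumes b: "bstep (l1, l2) \<beta> \<mu> k" and s: "\<not> ns_step (l1, l2) \<beta> \<mu> k"
  defines "i \<equiv> gamma_index \<beta> (k - pairing \<mu> (coroot \<beta>))"
  shows "int (ell i (\<mu> - k *\<^sub>Z pos_root \<beta>) (l1, l2)) = int (ell i \<mu> (l1, l2)) - 1"
proof (cases "\<beta> = A2 \<or> \<beta> = A12")
  case True
  define M where "M = k - pairing \<mu> (coroot \<beta>)"
  have w: "pairing \<mu> (coroot \<beta>) = k - M" by (simp add: M_def)
  have w': "pairing (\<mu> - k *\<^sub>Z pos_root \<beta>) (coroot \<beta>) = - (k + M)" unfolding pairing_diff w by simp
  have kM: "1 \<le> k" "1 \<le> M" "0 \<le> l1" "0 \<le> l2" "axis_octagon l1 l2 (cross \<beta> \<mu>) (k - M)"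
    "axis_octagon l1 l2 (cross \<beta> \<mu>) (- (k + M))"
    using b[unfolded bstep_axis[OF True] w] by (simp_all add: algebra_simps)
  have v: "\<mu> \<preceq> (l1, l2)" "\<mu> - k *\<^sub>Z pos_root \<beta> \<preceq> (l1, l2)" using b by (simp_all add: bstep_def)
  have c: "root_shift \<beta> = 0 \<or> root_shift \<beta> = 1" by (simp add: root_shift_def)
  note ax = axis_edge_ineqs[OF kM(5,6,1,2,3,4)]
  have x: "axis_excess (l1, l2) r (cross \<beta> \<mu>) = 0" if "r \<le> k + M" for r
  proof -
    have "(r - l1 - l2 + 1) div 2 \<le> 0" using that ax(1) by linarith
    moreover have "(r - l1 - 2 * l2 + \<bar>cross \<beta> \<mu>\<bar>) div 2 \<le> 0" using that ax(2,3) by linarith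
    ultimately show ?thesis by (simp add: axis_excess_def)
  qed
  have g: "gcount (k - M + M) = k" "gcount (k - M + (M - 1)) = k - 1" using kM by (simp_all add: gcount_def)
  have "ell_axis (l1, l2) (root_shift \<beta>) M M (cross \<beta> \<mu>) (k - M) =
      ell_axis (l1, l2) (root_shift \<beta>) M (M - 1) (cross \<beta> \<mu>) (k - M) + 1"
    unfolding ell_axis_def g using x[of "k - M + 2 * M"] x[of "k - M + 2 * (M - 1)"] by simp
  moreover have "ell_axis (l1, l2) (root_shift \<beta>) M M (cross \<beta> \<mu>) (- (k + M)) =
      ell_axis (l1, l2) (root_shift \<beta>) M (M - 1) (cross \<beta> \<mu>) (- (k + M)) - 1"
    using ell_axis_edge(2,3)[OF kM(5,6,1,2,3,4) c] by linarith
  moreover have "int (ell (i - 1) \<mu> (l1, l2)) = int (ell (i - 1) (\<mu> - k *\<^sub>Z pos_root \<beta>) (l1, l2)) - 1"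
    using bstep_ell[OF b] s by (simp add: i_def)
  moreover have "i = gamma_index \<beta> M" by (simp add: i_def M_def)
  ultimately show ?thesis
    using ell_eq_ell_axis[OF v(1) True kM(2)] ell_eq_ell_axis[OF v(2) True kM(2)] w w' cross_target[OF True, of \<mu> k]
    by simp
next
  case False
  then have "\<beta> = A21" using b by (cases \<beta>) (auto simp: bstep_def)
  then show ?thesis using ell_A21_edge(2)[of \<mu> "(l1, l2)" k] b by (simp add: bstep_def i_def)
qed

text \<open>The excess is the number of steps, each changing the pairing by 2, by which r must be
  reduced to fit into the octagon.\<close>

lemma axis_excess_le_iff:
  assumes "even (r + z - l1)" "0 \<le> j"
  shows "axis_excess (l1, l2) r z \<le> j \<longleftrightarrow> r - 2 * j \<le> l1 + l2 \<and> r - 2 * j + \<bar>z\<bar> \<le> l1 + 2 * l2"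
proof -
  have 1: "(r - l1 - l2 + 1) div 2 \<le> j \<longleftrightarrow> r - 2 * j \<le> l1 + l2" by linarith
  have "even (r - l1 - 2 * l2 + \<bar>z\<bar>)"
  proof (cases "0 \<le> z")
    case True
    then have "\<bar>z\<bar> = z" by simp
    then show ?thesis using assms(1) by presburger
  next
    case False
    then have "\<bar>z\<bar> = - z" by simp
    then show ?thesis using assms(1) by presburger
  qed
  then obtain u where u: "r - l1 - 2 * l2 + \<bar>z\<bar> = 2 * u" by (elim evenE)
  then have "(r - l1 - 2 * l2 + \<bar>z\<bar>) div 2 = u" by simp
  then have 2: "(r - l1 - 2 * l2 + \<bar>z\<bar>) div 2 \<le> j \<longleftrightarrow> r - 2 * j + \<bar>z\<bar> \<le> l1 + 2 * l2" using u by linarith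
  show ?thesis unfolding axis_excess_def fst_conv snd_conv max.bounded_iff 1 2 using assms(2) by simp
qed

lemma axis_octagon_raise:
  assumes "axis_octagon l1 (l2 - d) z v" "j \<le> d"
  shows "axis_octagon l1 (l2 - j) z v"
  using assms unfolding axis_octagon_def right_diff_distrib by linarith

text \<open>For every j from 0 to d the edge lowered by j exists: at \<mu> the octagon inequalities
  follow from those for j = d, at the other end from those for j = 0. By minimality of d all edges
  with j < d are then non-swappable.\<close>

lemma elevated_edge:
  assumes ns: "ns_step (l1, l2) \<beta> \<mu> k" and b: "bstep (l1, l2 - d) \<beta> \<mu> (k - d)"
    and s: "\<not> ns_step (l1, l2 - d) \<beta> \<mu> (k - d)" and d0: "0 \<le> d"
    and before: "\<And>j. 0 \<le> j \<Longrightarrow> j < d \<Longrightarrow> bstep (l1, l2 - j) \<beta> \<mu> (k - j) \<Longrightarrow> ns_step (l1, l2 - j) \<beta> \<mu> (k - j)"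
  defines "M \<equiv> k - pairing \<mu> (coroot \<beta>)" and "z \<equiv> cross \<beta> \<mu>"
  shows "1 \<le> d" "1 \<le> k - d" "1 \<le> M - d" "0 \<le> l1" "0 \<le> l2 - d"
    "axis_octagon l1 l2 z (k - M)" "axis_octagon l1 l2 z (- (k + M))" "axis_octagon l1 (l2 - d) z (k - M)"
    "axis_octagon l1 (l2 - d) z (- (k + M - 2 * d))"
    "\<And>j. 0 \<le> j \<Longrightarrow> j < d \<Longrightarrow> ns_step (l1, l2 - j) \<beta> \<mu> (k - j)"
    "\<not> ns_cond (l1, l2 - d) z (k - d) (M - d)"
    "\<And>j. 0 \<le> j \<Longrightarrow> j < d \<Longrightarrow> ns_cond (l1, l2 - j) z (k - j) (M - j)" "k < z + M"
proof -
  have \<beta>: "\<beta> = A2 \<or> \<beta> = A12" by (rule ns_stepD(1)[OF ns])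
  have w: "pairing \<mu> (coroot \<beta>) = k - M" by (simp add: M_def)
  have "bstep (l1, l2) \<beta> \<mu> k" using ns by (simp add: ns_step_def)
  note B0 = this[unfolded bstep_axis[OF \<beta>] w, folded z_def]
  note Bd = b[unfolded bstep_axis[OF \<beta>] w, folded z_def]
  show k: "1 \<le> k - d" and M: "1 \<le> M - d" and l: "0 \<le> l1" "0 \<le> l2 - d"
    and o: "axis_octagon l1 l2 z (k - M)" and od: "axis_octagon l1 (l2 - d) z (k - M)"
    using B0 Bd by simp_all
  have e: "k - M - 2 * k = - (k + M)" "k - M - 2 * (k - d) = - (k + M - 2 * d)" by simp_all
  show ot: "axis_octagon l1 l2 z (- (k + M))" and odt: "axis_octagon l1 (l2 - d) z (- (k + M - 2 * d))"
    using B0 Bd unfolding e by simp_all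
  have "d \<noteq> 0" using ns s by auto
  then show d: "1 \<le> d" using d0 by simp
  show ns_j: "ns_step (l1, l2 - j) \<beta> \<mu> (k - j)" if j: "0 \<le> j" "j < d" for j
  proof (rule before[OF j])
    have ej: "k - M - 2 * (k - j) = - (k + M - 2 * j)" by simp
    have "axis_octagon l1 (l2 - j) z (- (k + M - 2 * j))"
    proof -
      have a: "\<bar>- (k + M - 2 * j)\<bar> = k + M - 2 * j" "\<bar>- (k + M)\<bar> = k + M" using j k M by simp_all
      have "\<bar>z\<bar> \<le> l1 + (l2 - j)" using od j unfolding axis_octagon_def by linarith
      moreover have "k + M - 2 * j \<le> l1 + (l2 - j)" "\<bar>z\<bar> + (k + M - 2 * j) \<le> l1 + 2 * (l2 - j)"
        using ot j unfolding axis_octagon_def a(2) by simp_all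
      moreover have "even (z + - (k + M - 2 * j) - l1)" using ot unfolding axis_octagon_def by presburger
      ultimately show ?thesis unfolding axis_octagon_def a(1) by blast
    qed
    moreover have "axis_octagon l1 (l2 - j) z (k - M)" by (rule axis_octagon_raise[OF od]) (use j in simp)
    ultimately show "bstep (l1, l2 - j) \<beta> \<mu> (k - j)"
      unfolding bstep_axis[OF \<beta>] w z_def[symmetric] ej using j k M l by simp
  qed
  have sub: "k - j - (k - M) = M - j" for j by simp
  show "\<not> ns_cond (l1, l2 - d) z (k - d) (M - d)"
    using s b \<beta> unfolding ns_step_def w sub z_def[symmetric] by blast
  show c: "ns_cond (l1, l2 - j) z (k - j) (M - j)" if j: "0 \<le> j" "j < d" for j
    using ns_j[OF j] unfolding ns_step_def w sub z_def[symmetric] by blast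
  \<comment> \<open>Combined with the third inequality of \<open>ns_cond\<close> for j = 0. The
    resulting k < z + M later rules out the other axis direction at \<mu>.\<close>
  have "k + M \<le> l1 + l2" using ot unfolding axis_octagon_def by linarith
  then show "k < z + M" using c[of 0] d unfolding ns_cond_def by simp
qed

text \<open>Over \<lambda> - d\<varpi>_2 the counted non-swappable steps at \<mu> are those from k -
  d + 1 to k - x; longer ones leave the octagon. The same x is cut off from \<open>ell\<close> on
  the line of \<beta>, so the difference of the two numbers is independent of x, and
  \<open>elevation_core\<close> accounts for the other excess terms.\<close>

lemma elevation_statistics:
  assumes ns: "ns_step (l1, l2) \<beta> \<mu> k" and b: "bstep (l1, l2 - d) \<beta> \<mu> (k - d)"
    and s: "\<not> ns_step (l1, l2 - d) \<beta> \<mu> (k - d)" and d0: "0 \<le> d"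
    and before: "\<And>j. 0 \<le> j \<Longrightarrow> j < d \<Longrightarrow> bstep (l1, l2 - j) \<beta> \<mu> (k - j) \<Longrightarrow> ns_step (l1, l2 - j) \<beta> \<mu> (k - j)"
  defines "i \<equiv> gamma_index \<beta> (k - pairing \<mu> (coroot \<beta>))"
  shows "int (ell i (\<mu> - k *\<^sub>Z pos_root \<beta>) (l1, l2)) =
      int (ell i \<mu> (l1, l2 - d)) - int (NS_count i \<mu> (l1, l2 - d)) + 2 * d - 1"
    and "int (Dhat i \<mu> (l1, l2 - d)) = d"
proof -
  define M z where "M = k - pairing \<mu> (coroot \<beta>)" and "z = cross \<beta> \<mu>"
  have \<beta>: "\<beta> = A2 \<or> \<beta> = A12" by (rule ns_stepD(1)[OF ns])
  have w: "pairing \<mu> (coroot \<beta>) = k - M" by (simp add: M_def)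
  have w': "pairing (\<mu> - k *\<^sub>Z pos_root \<beta>) (coroot \<beta>) = - (k + M)" unfolding pairing_diff w by simp
  have iM: "i = gamma_index \<beta> M" by (simp add: i_def M_def)
  note E = elevated_edge[OF ns b s d0 before, folded M_def z_def]
  have kM: "1 \<le> k" "1 \<le> M" "0 \<le> l2" using E(1,2,3,5) by linarith+
  have lb: "level_bound i \<beta> = M" unfolding iM using \<beta> by (intro level_bound_gamma_index(1)[OF kM(2)]) auto
  \<comment> \<open>For the other axis direction, the third inequality of \<open>ns_cond\<close> and
    the octagon bound for its target add up to z + M + 2 \<le> k.\<close>
  have other: "\<beta>' = \<beta>" if n: "ns_step (l1, l2 - d + r) \<beta>' \<mu> k'" for \<beta>' k' r
  proof (rule ccontr)
    assume ne: "\<beta>' \<noteq> \<beta>"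
    note n' = ns_stepD[OF n]
    have "pairing \<mu> (coroot \<beta>') = z" "cross \<beta>' \<mu> = k - M" using axis_cases[OF \<beta> n'(1) ne] w z_def by simp_all
    then show False using n'(5,6) E(13) by simp
  qed
  have low: "k - d < k'" if "ns_step (l1, l2 - d + r) \<beta> \<mu> k'" "0 \<le> r" for k' r
  proof (rule ccontr)
    assume "\<not> k - d < k'"
    then have "k' \<le> k - d" by simp
    from ns_cond_mono[OF ns_stepD(4)[OF that(1)] this that(2)]
    have "ns_cond (l1, l2 - d) z (k - d) (k - d - (k - M))" unfolding w z_def .
    then show False using E(11) by simp
  qed
  \<comment> \<open>The witness starts at the swappable edge of step k - d and climbs back to the
    given edge. A staircase starts above k - d by \<open>low\<close> and stops at step k by its
    labels, so none is longer.\<close>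
  have "int (Dhat i \<mu> (l1, l2 - d)) = int (nat d)"
  proof (rule arg_cong[of _ _ int], rule Dhat_eqI)
    define n where "n = nat (k - d)"
    have n: "int n = k - d" using E(2) by (simp add: n_def)
    show "NS_staircase i \<mu> (l1, l2 - d) \<beta> n (nat d)"
      unfolding NS_staircase_def
    proof (intro conjI disjI2 ballI)
      show "\<exists>l. (\<mu>, \<mu> - int n *\<^sub>Z pos_root \<beta>, l) \<in> swappable_edges (l1, l2 - d)"
        unfolding edge_sets(1) n using b s by blast
      fix j assume j: "j \<in> {1..nat d}"
      have e: "(l1, l2 - d) + int j *\<^sub>Z varpi2 = (l1, l2 - (d - int j))" "int (n + j) = k - (d - int j)"
        using n by (simp_all add: zscale_def)
      have ns_j: "ns_step (l1, l2 - (d - int j)) \<beta> \<mu> (k - (d - int j))" using j by (intro E(10)) auto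
      let ?l = "(- coroot \<beta>, k - (d - int j) - pairing \<mu> (coroot \<beta>))"
      have "?l \<in> gamma ` {1..i}"
        unfolding gamma_image_iff lb w using j E(3) by auto
      moreover have "(\<mu>, \<mu> - int (n + j) *\<^sub>Z pos_root \<beta>, ?l) \<in> nonswappable_edges ((l1, l2 - d) + int j *\<^sub>Z varpi2)"
        unfolding edge_sets(2) e using ns_j by blast
      ultimately show "\<exists>l \<in> gamma ` {1..i}. (\<mu>, \<mu> - int (n + j) *\<^sub>Z pos_root \<beta>, l)
          \<in> nonswappable_edges ((l1, l2 - d) + int j *\<^sub>Z varpi2)" by blast
    qed
    fix \<alpha> n b assume st: "NS_staircase i \<mu> (l1, l2 - d) \<alpha> n b"
    show "b \<le> nat d"
    proof (cases "b = 0")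
      case False
      then have b1: "1 \<le> b" by simp
      have e: "(l1, l2 - d) + int 1 *\<^sub>Z varpi2 = (l1, l2 - d + 1)" by (simp add: zscale_def)
      have n1: "ns_step (l1, l2 - d + 1) \<alpha> \<mu> (int (n + 1))"
        using NS_staircase_step(1)[OF st order.refl b1] unfolding e .
      have \<alpha>: "\<alpha> = \<beta>" by (rule other[OF n1])
      have "k - d < int (n + 1)" using low[of 1 "int (n + 1)"] n1 unfolding \<alpha> by simp
      moreover have "int (n + b) - (k - M) \<le> M"
        using NS_staircase_step(2)[OF st b1 order.refl] unfolding \<alpha> lb w .
      ultimately show ?thesis by simp
    qed simp
  qed
  then show "int (Dhat i \<mu> (l1, l2 - d)) = d" using d0 by simp
  \<comment> \<open>The number of steps just below or equal to k that no longer fit after lowering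
    \<lambda> by d\<varpi>_2.\<close>
  define x where "x = axis_excess (l1, l2 - d) (k + M) z"
  have ev: "even (k + M + z - l1)" using E(7) unfolding axis_octagon_def by presburger
  have x_le: "x \<le> j \<longleftrightarrow> k + M - 2 * j \<le> l1 + (l2 - d) \<and> k + M - 2 * j + \<bar>z\<bar> \<le> l1 + 2 * (l2 - d)" if "0 \<le> j" for j
    unfolding x_def by (rule axis_excess_le_iff[OF ev that])
  have xd: "x \<le> d" using E(9) E(2,3) unfolding x_le[OF d0] axis_octagon_def by linarith
  have x0: "0 \<le> x" by (simp add: x_def axis_excess_def)
  have "NS_count i \<mu> (l1, l2 - d) =
      card {k'. ns_step (l1, l2 - d) \<beta> \<mu> k' \<and> k' - pairing \<mu> (coroot \<beta>) \<le> level_bound i \<beta>}"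
    by (rule NS_count_eq) (use other[of 0] in simp)
  also have "{k'. ns_step (l1, l2 - d) \<beta> \<mu> k' \<and> k' - pairing \<mu> (coroot \<beta>) \<le> level_bound i \<beta>} = {k - d + 1..k - x}"
  proof (intro set_eqI iffI)
    fix k' assume "k' \<in> {k'. ns_step (l1, l2 - d) \<beta> \<mu> k' \<and> k' - pairing \<mu> (coroot \<beta>) \<le> level_bound i \<beta>}"
    then have n: "ns_step (l1, l2 - d) \<beta> \<mu> k'" and le: "k' \<le> k" unfolding lb w by simp_all
    have "k - d < k'" using low[of 0 k'] n by simp
    moreover have "x \<le> k - k'"
    proof -
      have "bstep (l1, l2 - d) \<beta> \<mu> k'" using n by (simp add: ns_step_def)
      then have o: "axis_octagon l1 (l2 - d) z (k - M - 2 * k')" unfolding bstep_axis[OF \<beta>] w z_def by blast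
      define j where "j = k - k'"
      have j: "0 \<le> j" using le by (simp add: j_def)
      have e: "k - M - 2 * k' = - (k + M - 2 * j)" by (simp add: j_def)
      have "x \<le> j" using o unfolding e x_le[OF j] axis_octagon_def by linarith
      then show ?thesis by (simp add: j_def)
    qed
    ultimately show "k' \<in> {k - d + 1..k - x}" by simp
  next
    fix k' assume k': "k' \<in> {k - d + 1..k - x}"
    define j where "j = k - k'"
    have j: "0 \<le> j" "x \<le> j" "j < d" "k' = k - j" using k' x0 by (simp_all add: j_def)
    have o: "axis_octagon l1 (l2 - d) z (k - M - 2 * k')"
    proof -
      have e: "k - M - 2 * k' = - (k + M - 2 * j)" unfolding j(4) by simp
      have a: "\<bar>- (k + M - 2 * j)\<bar> = k + M - 2 * j" using j E(2,3) by simp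
      have "\<bar>z\<bar> \<le> l1 + (l2 - d)" using E(8) unfolding axis_octagon_def by linarith
      moreover have "k + M - 2 * j \<le> l1 + (l2 - d)" "\<bar>z\<bar> + (k + M - 2 * j) \<le> l1 + 2 * (l2 - d)"
        using j(2) unfolding x_le[OF j(1)] by simp_all
      moreover have "even (z + - (k + M - 2 * j) - l1)" using ev by presburger
      ultimately show ?thesis unfolding e axis_octagon_def a by blast
    qed
    then have "bstep (l1, l2 - d) \<beta> \<mu> k'"
      unfolding bstep_axis[OF \<beta>] w z_def[symmetric] using E(2-5,8) j by simp
    moreover have "ns_cond (l1, l2 - d) z k' (k' - (k - M))"
    proof (rule ns_cond_mono[where r = 1])
      have q: "l2 - d + 1 = l2 - (d - 1)" "k - (d - 1) - (k - M) = M - (d - 1)" by simp_all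
      show "ns_cond (l1, l2 - d + 1) z (k - (d - 1)) (k - (d - 1) - (k - M))"
        unfolding q by (rule E(12)) (use E(1) in simp_all)
    qed (use j in simp_all)
    ultimately show "k' \<in> {k'. ns_step (l1, l2 - d) \<beta> \<mu> k' \<and> k' - pairing \<mu> (coroot \<beta>) \<le> level_bound i \<beta>}"
      using \<beta> j unfolding ns_step_def lb w z_def by simp
  qed
  finally have count: "int (NS_count i \<mu> (l1, l2 - d)) = d - x" using xd by simp
  define c where "c = root_shift \<beta>"
  have c: "c = 0 \<or> c = 1" by (simp add: c_def root_shift_def)
  define e h R h' where "e = z + 2 * M - (l1 + l2)" and "h = (z + 2 * M - (l1 + l2) + 1) div 2"
    and "R = (z + k + 3 * M - (l1 + 2 * l2)) div 2" and "h' = (z + 2 * M - (l1 + (l2 - d)) + 1) div 2"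
  define G where "G = gcount (z + M - k - c) + gcount (z + M - c) + gcount (z + k + M - c)"
  have v: "\<mu> \<preceq> (l1, l2 - d)" "\<mu> - k *\<^sub>Z pos_root \<beta> \<preceq> (l1, l2)"
    using ns b by (simp_all add: ns_step_def bstep_def)
  have t: "int (ell i (\<mu> - k *\<^sub>Z pos_root \<beta>) (l1, l2)) =
      G + k - 1 - max 0 (max (e - c) (R - k - c)) - max 0 (max (h - c) (R - c))"
    unfolding iM ell_eq_ell_axis(2)[OF v(2) \<beta> kM(2)] w' cross_target[OF \<beta>] c_def[symmetric] z_def[symmetric]
      G_def e_def h_def R_def by (rule ell_axis_edge(3)[OF E(6,7) kM(1,2) E(4) kM(3) c])
  have R: "2 * R = z + k + 3 * M - (l1 + 2 * l2)" unfolding R_def using ev by presburger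
  have m: "int (ell i \<mu> (l1, l2 - d)) =
      G + k - x - max 0 (max (e + d - c) (R + d - c)) - max 0 (max (h' - c) (R - min k M + d - c))"
  proof -
    have Rd: "(z + k + 3 * M - (l1 + 2 * (l2 - d))) div 2 = R + d" using R by simp
    have ed: "z + 2 * M - (l1 + (l2 - d)) = e + d" by (simp add: e_def)
    have d1: "diag_excess (l1, l2 - d) (z + (k - M) + 4 * M - 2 * c) (z - (k - M)) = max 0 (max (e + d - c) (R + d - c))"
    proof -
      have q: "z + (k - M) + 4 * M - 2 * c = z + k + 3 * M - 2 * c" "z - (k - M) = z - k + M" by simp_all
      have "even (z + k + M - l1)" using ev by presburger
      then show ?thesis unfolding q Rd[symmetric] ed[symmetric]
        by (rule diag_excess_form) (use E(13) c in auto)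
    qed
    have a1: "axis_excess (l1, l2 - d) (z + 2 * M - 2 * c) (k - M) = max 0 (max (h' - c) (R - min k M + d - c))"
    proof -
      have n: "z + 2 * M - (l1 + 2 * (l2 - d)) + \<bar>k - M\<bar> = 2 * (R - min k M + d)"
        using R by (simp add: min_def abs_if)
      show ?thesis unfolding axis_excess_form n h'_def by simp
    qed
    have a2: "axis_excess (l1, l2 - d) (k - M + 2 * M) z = x" by (simp add: x_def add.commute)
    have g: "z - (k - M) - c = z + M - k - c" "z + (k - M) + 2 * M - c = z + k + M - c" "gcount (k - M + M) = k"
      using kM by (simp_all add: gcount_def)
    show ?thesis
      unfolding iM ell_eq_ell_axis(2)[OF v(1) \<beta> kM(2)] w c_def[symmetric] z_def[symmetric] ell_axis_def d1 a1 a2 g G_def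
      by simp
  qed
  \<comment> \<open>\<open>ns_cond\<close> holds at j = d - 1 and fails at j = d; this pins d down
    as the minimum that \<open>elevation_core\<close> requires.\<close>
  have nd: "l2 - (d - 1) + 2 \<le> M - (d - 1) + (k - (d - 1))" "l1 + 2 \<le> z + (M - (d - 1)) + (k - (d - 1))"
    "l1 + (l2 - (d - 1)) + 2 \<le> z + 2 * (M - (d - 1))"
    using E(12)[of "d - 1"] E(1) unfolding ns_cond_def by simp_all
  have de: "d \<le> e - 1" "d \<le> 2 * R - e - 1" "d \<le> e - (R - k)" using nd R unfolding e_def by simp_all
  have "\<not> (l2 - d + 2 \<le> M - d + (k - d) \<and> l1 + 2 \<le> z + (M - d) + (k - d) \<and> l1 + (l2 - d) + 2 \<le> z + 2 * (M - d))"
    using E(11) unfolding ns_cond_def by simp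
  then consider "M - d + (k - d) < l2 - d + 2" | "z + (M - d) + (k - d) < l1 + 2" | "z + 2 * (M - d) < l1 + (l2 - d) + 2"
    unfolding de_Morgan_conj not_le by blast
  then have "e - 1 \<le> d \<or> 2 * R - e - 1 \<le> d \<or> e - (R - k) \<le> d"
  proof cases
    case 1
    then have "2 * R - e - 1 \<le> d" unfolding R e_def by simp
    then show ?thesis by simp
  next
    case 2
    then have "z + M - l1 + k \<le> 2 * d + 1" by simp
    moreover have "2 * (e - (R - k)) = z + M - l1 + k" unfolding right_diff_distrib R e_def by simp
    ultimately have "2 * (e - (R - k)) \<le> 2 * d + 1" by (simp only:)
    then have "e - (R - k) \<le> d" by presburger
    then show ?thesis by simp
  next
    case 3
    then have "e - 1 \<le> d" unfolding e_def right_diff_distrib by simp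
    then show ?thesis by simp
  qed
  then have dmin: "d = min (min (e - 1) (2 * R - e - 1)) (e - (R - k))" using de by linarith
  have h: "2 * h = e \<or> 2 * h = e + 1" unfolding h_def e_def by presburger
  have h': "2 * h' = e + d \<or> 2 * h' = e + d + 1" unfolding h'_def e_def by presburger
  have or: "R - min k M = R - k \<or> R - min k M \<le> 0 \<and> R - k \<le> 0"
  proof (cases "k \<le> M")
    case False
    have "z + k + M \<le> l1 + 2 * l2" by (rule axis_edge_ineqs(2)[OF E(6,7) kM(1,2) E(4) kM(3)])
    then have "R \<le> M" using R by linarith
    then show ?thesis using False by simp
  qed simp
  have balance: "g - 1 - A - B = g - x - C - D - (d - x) + 2 * d - 1" if "C + D = A + B + d" for g A B C D :: int
    using that by simp
  have "max 0 (max (e + d - c) (R + d - c)) + max 0 (max (h' - c) (R - min k M + d - c)) =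
      max 0 (max (e - c) (R - k - c)) + max 0 (max (h - c) (R - c)) + d"
    by (rule elevation_core[OF h h' dmin _ _ or c E(1)]) (use E(2,3) in simp_all)
  then show "int (ell i (\<mu> - k *\<^sub>Z pos_root \<beta>) (l1, l2)) =
      int (ell i \<mu> (l1, l2 - d)) - int (NS_count i \<mu> (l1, l2 - d)) + 2 * d - 1"
    unfolding t m count by (rule balance)
qed

lemma sigma_stat_eq:
  assumes "pat lam' U = p" "atomic_number lam' U = b" "wt U = \<mu>"
  shows "sigma_stat m lam' U =
    int (ell m \<mu> (lam' - (2 * int p) *\<^sub>Z varpi1 - int b *\<^sub>Z varpi2))
    - int (NS_count m \<mu> (lam' - (2 * int p) *\<^sub>Z varpi1 - int b *\<^sub>Z varpi2))
    + int (Dtrunc m \<mu> (lam' - (2 * int p) *\<^sub>Z varpi1) b) + int b + 2 * int p"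
  using assms by (simp add: sigma_stat_def Let_def)

theorem proposition6p2:
  fixes lam' lam \<mu> :: weight and p a m :: nat and T :: word and e :: edge
  assumes "dominant lam'"
    and "lam = lam' - (2 * int p) *\<^sub>Z varpi1" and "dominant lam"
    and "less_t (m + 1) \<mu>" and "t_refl (m + 1) \<mu> \<preceq> lam"
    and "T \<in> atom_in p lam a" and "wt T = t_refl (m + 1) \<mu>"
    and "e = (\<mu>, t_refl (m + 1) \<mu>, gamma (m + 1))"
    and "e \<in> bruhat_edges (lam - int a *\<^sub>Z varpi2)"
    and "has_elevation (lam - int a *\<^sub>Z varpi2) e"
  shows "sigma_stat (m + 1) lam' T = sigma_stat (m + 1) lam' (psi p lam a e) - 1"
proof -
  define i \<beta> k where "i = m + 1" and "\<beta> = gamma_root i" and "k = pairing \<mu> (coroot \<beta>) + gamma_level i"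
  define l1 l2 where "l1 = fst lam" and "l2 = snd lam - int a"
  have i1: "1 \<le> i" by (simp add: i_def)
  have nu: "lam - int (a + j) *\<^sub>Z varpi2 = (l1, l2 - int j)" for j
    by (simp add: l1_def l2_def prod_eq_iff)
  have nu0: "lam - int a *\<^sub>Z varpi2 = (l1, l2)" using nu[of 0] by simp
  have t: "t_refl (m + 1) \<mu> = \<mu> - k *\<^sub>Z pos_root \<beta>"
    by (simp add: t_refl_def k_def \<beta>_def i_def)
  have i: "i = gamma_index \<beta> (k - pairing \<mu> (coroot \<beta>))"
    using gamma_root_level(2)[OF i1] by (simp add: k_def \<beta>_def)
  have b: "bstep (l1, l2) \<beta> \<mu> k"
    using assms(9) gamma_edge_iff[OF i1, of \<mu> "(l1, l2)"] unfolding nu0 assms(8) k_def \<beta>_def i_def by blast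
  have k: "1 \<le> k" using b by (simp add: bstep_def)
  define E where "E = elevation (lam - int a *\<^sub>Z varpi2) e"
  have lowers: "lowers_to_swappable (lam - int a *\<^sub>Z varpi2) e j \<longleftrightarrow>
      bstep (l1, l2 - int j) \<beta> \<mu> (k - int j) \<and> \<not> ns_step (l1, l2 - int j) \<beta> \<mu> (k - int j)" for j
  proof -
    have "(l1, l2) - int j *\<^sub>Z varpi2 = (l1, l2 - int j)" by (simp add: zscale_def)
    then show ?thesis unfolding assms(8) t nu0 lowers_to_swappable_iff[OF k] by simp
  qed
  have "lowers_to_swappable (lam - int a *\<^sub>Z varpi2) e E"
    using assms(10) unfolding has_elevation_def E_def elevation_def by (rule LeastI_ex)
  then have bE: "bstep (l1, l2 - int E) \<beta> \<mu> (k - int E)"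
    and sE: "\<not> ns_step (l1, l2 - int E) \<beta> \<mu> (k - int E)" using lowers by auto
  have before: "ns_step (l1, l2 - j) \<beta> \<mu> (k - j)" if "0 \<le> j" "j < int E" "bstep (l1, l2 - j) \<beta> \<mu> (k - j)" for j
  proof -
    have "nat j < E" using that(1,2) by simp
    then have "\<not> lowers_to_swappable (lam - int a *\<^sub>Z varpi2) e (nat j)"
      unfolding E_def elevation_def by (rule not_less_Least)
    then show ?thesis using that(1,3) unfolding lowers by simp
  qed
  have lam': "lam' = lam + (2 * int p) *\<^sub>Z varpi1" using assms(2) by simp
  note T = atom_in_statistics[OF assms(6,3), folded lam']
  have E0: "E = 0" if "\<not> ns_step (l1, l2) \<beta> \<mu> k"
    using that b lowers[of 0] unfolding E_def elevation_def by (simp add: Least_eq_0)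
  have "atom_exponent lam (a + E)"
  proof -
    have "0 \<le> l2 - int E" using bE by (simp add: bstep_def weight_le_iff dominant_def)
    \<comment> \<open>For \<lambda>_1 = 0 the exponent has to stay even. There the first inequality
      of \<open>ns_cond\<close> contradicts the octagon bound for the target, so every such edge is
      swappable and the elevation is 0.\<close>
    moreover have "E = 0" if "fst lam = 0"
    proof (rule E0, rule notI)
      assume n: "ns_step (l1, l2) \<beta> \<mu> k"
      then show False using ns_stepD(4,6)[OF n] that unfolding ns_cond_def l1_def by simp
    qed
    ultimately show ?thesis using T(1) by (auto simp: atom_exponent_def l2_def)
  qed
  moreover have "\<mu> \<preceq> lam - int (a + E) *\<^sub>Z varpi2" unfolding nu using bE by (simp add: bstep_def)
  ultimately have "\<exists>!U. U \<in> atom_in p lam (a + E) \<and> wt U = \<mu>" by (rule ex1_atom_in)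
  from theI'[OF this] have U: "psi p lam a e \<in> atom_in p lam (a + E)" "wt (psi p lam a e) = \<mu>"
    by (simp_all add: psi_def atom_elt_def E_def assms(8))
  note U' = atom_in_statistics[OF U(1) assms(3), folded lam']
  have no_t: False if "ns_step (l1, l2 + r) \<beta>' (\<mu> - k *\<^sub>Z pos_root \<beta>) k'" "0 \<le> r"
    "k' - pairing (\<mu> - k *\<^sub>Z pos_root \<beta>) (coroot \<beta>') \<le> level_bound i \<beta>'" for r \<beta>' k'
    by (rule no_ns_step_target[OF b i that(2,1,3)])
  have up: "(l1, l2) + int 1 *\<^sub>Z varpi2 = (l1, l2 + 1)" by (simp add: zscale_def)
  have Nt: "NS_count i (\<mu> - k *\<^sub>Z pos_root \<beta>) (l1, l2) = 0"
    by (rule NS_count_0) (use no_t[of 0] in simp)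
  have Dt: "Dhat i (\<mu> - k *\<^sub>Z pos_root \<beta>) (l1, l2) = 0"
    by (rule Dhat_0) (use no_t[of 1] up in simp)
  have sT: "sigma_stat i lam' T = int (ell i (\<mu> - k *\<^sub>Z pos_root \<beta>) (l1, l2)) + int a + 2 * int p"
    unfolding sigma_stat_eq[OF T(2,3) assms(7)] assms(2)[symmetric] nu0 t Dtrunc_def Nt Dt by simp
  have sU: "sigma_stat i lam' (psi p lam a e) =
      int (ell i \<mu> (l1, l2 - int E)) - int (NS_count i \<mu> (l1, l2 - int E))
      + int (min (a + E) (Dhat i \<mu> (l1, l2 - int E))) + int a + int E + 2 * int p"
    unfolding sigma_stat_eq[OF U'(2,3) U(2)] assms(2)[symmetric] nu Dtrunc_def by simp
  show ?thesis
  proof (cases "ns_step (l1, l2) \<beta> \<mu> k")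
    case True
    have ell: "int (ell i (\<mu> - k *\<^sub>Z pos_root \<beta>) (l1, l2)) =
        int (ell i \<mu> (l1, l2 - int E)) - int (NS_count i \<mu> (l1, l2 - int E)) + 2 * int E - 1"
      and D: "Dhat i \<mu> (l1, l2 - int E) = E"
      using elevation_statistics[OF True bE sE of_nat_0_le_iff before] i by simp_all
    \<comment> \<open>The staircase has length E, which the truncation at a + E respects. Hence E
      enters \<sigma> twice, as staircase length and through the atomic number, against the 2E in
      \<open>ell\<close>.\<close>
    show ?thesis unfolding i_def[symmetric] sT sU ell D by simp
  next
    case False
    have no: False if "ns_step (l1, l2 + r) \<beta>' \<mu> k'" "0 \<le> r"
      "k' - pairing \<mu> (coroot \<beta>') \<le> level_bound i \<beta>'" for r \<beta>' k'
      by (rule swappable_no_ns_step[OF b i that(2) False that(1,3)])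
    have N: "NS_count i \<mu> (l1, l2) = 0" by (rule NS_count_0) (use no[of 0] in simp)
    have D: "Dhat i \<mu> (l1, l2) = 0" by (rule Dhat_0) (use no[of 1] up in simp)
    have ell: "int (ell i (\<mu> - k *\<^sub>Z pos_root \<beta>) (l1, l2)) = int (ell i \<mu> (l1, l2)) - 1"
      using ell_swappable[OF b False] i by simp
    have E: "E = 0" by (rule E0[OF False])
    show ?thesis unfolding i_def[symmetric] sT sU E ell using N D by simp
  qed
qed

end
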